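(* Let $(M,g,\lambda)$ be a thermostat. For a given $v\in SM$, either of the following holds. (a) There exist $t_0\in\mathbb{R}$ and $t\neq 0$ such that $$d\varphi_t^{-\top}\big(\mathbb{H}^*(\varphi_{t_0}(v))\big)=\mathbb{H}^*(\varphi_{t_0+t}(v)).$$ This happens if and only if the points $\pi(\varphi_{t_0}(v))$ and $\pi(\varphi_{t_0+t}(v))$ on $M$ are conjugate along the thermostat geodesic $t\mapsto\pi(\varphi_t(v))$. (b) There exist two invariant subbundles $G^*_{s},G^*_u\subset\Sigma$ along the orbit of $v$ given by $$G_s^*(v):=\lim_{t\to\infty}d\varphi_{-t}^{-\top}\big(\mathbb{H}^*(\varphi_t(v))\big),\qquad G_u^*(v):=\lim_{t\to\infty}d\varphi_t^{-\top}\big(\mathbb{H}^*(\varphi_{-t}(v))\big).$$ They satisfy the transversality condition $$G_s^*(v)\cap\mathbb{H}^*(v)=\{0\}=G_u^*(v)\cap\mathbb{H}^*(v).$$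
   Context: A thermostat $(M,g,\lambda)$ consists of a closed oriented Riemannian surface $(M,g)$ and a function $\lambda\in\mathcal{C}^\infty(SM,\mathbb{R})$, where $\pi:SM\to M$ is the unit tangent bundle. Let $X$ be the geodesic vector field on $SM$, $V$ the vertical vector field (generator of the rotations of the fibers), and $H:=[V,X]$. The thermostat flow $\varphi_t$ on $SM$ is the flow of $F:=X+\lambda V$; its orbits are $(\gamma,\dot\gamma)$ with $\nabla_{\dot\gamma}\dot\gamma=\lambda(\gamma,\dot\gamma)J\dot\gamma$ (the curves $\gamma$ are thermostat geodesics), where $\nabla$ is the Levi-Civita connection and $J$ is rotation by $\pi/2$. Let $(\alpha,\beta,\psi)$ be the coframe of $T^*(SM)$ dual to the frame $(X,H,V)$. Put $\mathbb{H}^*:=\mathbb{R}\beta$ and $\Sigma(v):=\{\xi\in T^*_v(SM): \xi(F(v))=0\}$; $\Sigma$ is a rank-2 subbundle of $T^*(SM)$ containing $\mathbb{H}^*$. The inverse transpose $d_v\varphi_t^{-\top}:T^*_v(SM)\to T^*_{\varphi_t(v)}(SM)$ is $\xi\mapsto\xi\circ(d_v\varphi_t)^{-1}$; it preserves $\Sigma$. Limits of lines in $\Sigma(v)$ are taken in the projective line of 1-dimensional subspaces of $\Sigma(v)$. Invariance means invariance under $d\varphi_t^{-\top}$. The exponential map is $\exp^\lambda_x(tv):=\pi(\varphi_t(x,v))$ for $x\in M$, $t\ge0$, $v\in S_xM$. Given a thermostat geodesic segment $\gamma:[0,T]\to M$ with distinct endpoints $x_0=\gamma(0)$, $x_1=\gamma(T)$,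 the points $x_0$ and $x_1$ are conjugate along $\gamma$ if $\exp^\lambda_{x_0}$ is singular at $T\dot\gamma(0)$, i.e. $d_{T\dot\gamma(0)}\exp^\lambda_{x_0}$ has non-trivial kernel. *)

theory Defs
  imports "HOL-Analysis.Analysis"
begin

section \<open>Smooth maps between open subsets of Euclidean spaces\<close>

text \<open>Only meant for open sets \<open>S\<close>.\<close>

primrec Ck_on :: "nat \<Rightarrow> ('a::euclidean_space \<Rightarrow> 'b::real_normed_vector) \<Rightarrow> 'a set \<Rightarrow> bool" where
  "Ck_on 0 f S \<longleftrightarrow> continuous_on S f"
| "Ck_on (Suc k) f S \<longleftrightarrow>
     f differentiable_on S \<and> (\<forall>e. Ck_on k (\<lambda>x. frechet_derivative f (at x) e) S)"

definition smooth_on :: "('a::euclidean_space \<Rightarrow> 'b::real_normed_vector) \<Rightarrow> 'a set \<Rightarrow> bool" where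
  "smooth_on f S \<longleftrightarrow> (\<forall>k. Ck_on k f S)"


section \<open>Smooth manifolds given by an atlas\<close>

text \<open>A chart is a coordinate domain together with a coordinate map, whose values outside the
  domain are irrelevant. A manifold is represented by an atlas; its underlying set is the union of
  the coordinate domains and its topology is the one induced by the charts.\<close>

type_synonym ('m, 'e) chart = "'m set \<times> ('m \<Rightarrow> 'e)"
type_synonym ('m, 'e) atlas = "('m, 'e) chart set"

definition carrier :: "('m, 'e) atlas \<Rightarrow> 'm set" where
  "carrier A = \<Union> (fst ` A)"

definition charts_at :: "('m, 'e) atlas \<Rightarrow> 'm \<Rightarrow> ('m, 'e) chart set" where
  "charts_at A p = {c \<in> A. p \<in> fst c}"

definition chart_range :: "('m, 'e) chart \<Rightarrow> 'e set" where
  "chart_range c = snd c ` fst c"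

definition chart_inv :: "('m, 'e) chart \<Rightarrow> 'e \<Rightarrow> 'm" where
  "chart_inv c = inv_into (fst c) (snd c)"

definition transition :: "('m, 'e) chart \<Rightarrow> ('m, 'e) chart \<Rightarrow> 'e \<Rightarrow> 'e" where
  "transition c d = snd d \<circ> chart_inv c"

definition smooth_atlas :: "('m, 'e::euclidean_space) atlas \<Rightarrow> bool" where
  "smooth_atlas A \<longleftrightarrow>
     (\<forall>c\<in>A. inj_on (snd c) (fst c) \<and> open (chart_range c)) \<and>
     (\<forall>c\<in>A. \<forall>d\<in>A. open (snd c ` (fst c \<inter> fst d)) \<and>
        smooth_on (transition c d) (snd c ` (fst c \<inter> fst d)))"

definition atlas_open :: "('m, 'e::euclidean_space) atlas \<Rightarrow> 'm set \<Rightarrow> bool" where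
  "atlas_open A U \<longleftrightarrow> U \<subseteq> carrier A \<and> (\<forall>c\<in>A. open (snd c ` (U \<inter> fst c)))"

definition atlas_topology :: "('m, 'e::euclidean_space) atlas \<Rightarrow> 'm topology" where
  "atlas_topology A = topology (atlas_open A)"

lemma openin_atlas_topology:
  assumes "smooth_atlas A"
  shows "openin (atlas_topology A) = atlas_open A"
proof -
  have "istopology (atlas_open A)"
    unfolding istopology_def
  proof (intro conjI allI impI)
    fix S T assume S: "atlas_open A S" and T: "atlas_open A T"
    have "open (snd c ` (S \<inter> T \<inter> fst c))" if "c \<in> A" for c
    proof -
      have "inj_on (snd c) (fst c)" using assms that by (auto simp: smooth_atlas_def)
      then have "snd c ` ((S \<inter> fst c) \<inter> (T \<inter> fst c)) = snd c ` (S \<inter> fst c) \<inter> snd c ` (T \<inter> fst c)"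
        by (rule inj_on_image_Int) auto
      moreover have "(S \<inter> fst c) \<inter> (T \<inter> fst c) = S \<inter> T \<inter> fst c" by auto
      ultimately show ?thesis using S T that by (auto simp: atlas_open_def)
    qed
    then show "atlas_open A (S \<inter> T)" using S by (auto simp: atlas_open_def)
  next
    fix K assume K: "\<forall>U\<in>K. atlas_open A U"
    have "open (snd c ` (\<Union>K \<inter> fst c))" if "c \<in> A" for c
    proof -
      have "snd c ` (\<Union>K \<inter> fst c) = (\<Union>U\<in>K. snd c ` (U \<inter> fst c))" by auto
      then show ?thesis using K that by (auto simp: atlas_open_def intro!: open_UN)
    qed
    then show "atlas_open A (\<Union>K)" using K by (auto simp: atlas_open_def)
  qed
  then show ?thesis by (simp add: atlas_topology_def)
qed

definition smooth_manifold :: "('m, 'e::euclidean_space) atlas \<Rightarrow> bool" where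
  "smooth_manifold A \<longleftrightarrow> smooth_atlas A \<and> Hausdorff_space (atlas_topology A) \<and>
     second_countable (atlas_topology A)"

definition euclid_atlas :: "('e, 'e::euclidean_space) atlas" where
  "euclid_atlas = {(UNIV, \<lambda>x. x)}"

definition product_atlas :: "('m, 'e) atlas \<Rightarrow> ('n, 'f) atlas \<Rightarrow> ('m \<times> 'n, 'e \<times> 'f) atlas" where
  "product_atlas A B = {(fst c \<times> fst d, map_prod (snd c) (snd d)) | c d. c \<in> A \<and> d \<in> B}"

definition smooth_map ::
  "('m, 'e::euclidean_space) atlas \<Rightarrow> ('n, 'f::euclidean_space) atlas \<Rightarrow> ('m \<Rightarrow> 'n) \<Rightarrow> bool" where
  "smooth_map A B f \<longleftrightarrow> (\<forall>p\<in>carrier A. f p \<in> carrier B \<and>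
     (\<forall>c\<in>charts_at A p. \<forall>d\<in>charts_at B (f p).
        \<exists>W. open W \<and> snd c p \<in> W \<and> W \<subseteq> chart_range c \<and> f ` chart_inv c ` W \<subseteq> fst d \<and>
            smooth_on (snd d \<circ> f \<circ> chart_inv c) W))"


section \<open>Tangent and cotangent vectors\<close>

text \<open>A tangent vector at \<open>p\<close> is the family of its coordinate expressions in the charts around \<open>p\<close>,
  related by the derivatives of the transition maps. Entries for all other charts are \<open>0\<close>, so that
  equality of tangent vectors is equality of functions. Linear operations are pointwise.\<close>

type_synonym ('m, 'e) tangent = "('m, 'e) chart \<Rightarrow> 'e"
type_synonym ('m, 'e) covector = "('m, 'e) tangent \<Rightarrow> real"

definition tangent_space :: "('m, 'e::euclidean_space) atlas \<Rightarrow> 'm \<Rightarrow> ('m, 'e) tangent set" where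
  "tangent_space A p = {v.
     (\<forall>c\<in>charts_at A p. \<forall>d\<in>charts_at A p.
        v d = frechet_derivative (transition c d) (at (snd c p)) (v c)) \<and>
     (\<forall>c. c \<notin> charts_at A p \<longrightarrow> v c = 0)}"

definition vcomb ::
  "real \<Rightarrow> ('c \<Rightarrow> 'e::real_vector) \<Rightarrow> real \<Rightarrow> ('c \<Rightarrow> 'e) \<Rightarrow> 'c \<Rightarrow> 'e" where
  "vcomb a v b w = (\<lambda>c. a *\<^sub>R v c + b *\<^sub>R w c)"

definition coord_vec ::
  "('m, 'e::euclidean_space) atlas \<Rightarrow> ('m, 'e) chart \<Rightarrow> 'm \<Rightarrow> 'e \<Rightarrow> ('m, 'e) tangent" where
  "coord_vec A c p e = (\<lambda>d. if d \<in> charts_at A p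
     then frechet_derivative (transition c d) (at (snd c p)) e else 0)"

text \<open>Derivative of a vector-valued function along a tangent vector. By the chain rule it does not
  depend on the chosen chart.\<close>

definition dir_deriv ::
  "('m, 'e::euclidean_space) atlas \<Rightarrow> ('m \<Rightarrow> 'b::real_normed_vector) \<Rightarrow> 'm \<Rightarrow> ('m, 'e) tangent \<Rightarrow> 'b"
  where
  "dir_deriv A f p v = (let c = (SOME c. c \<in> charts_at A p) in
     frechet_derivative (f \<circ> chart_inv c) (at (snd c p)) (v c))"

definition differential ::
  "('m, 'e::euclidean_space) atlas \<Rightarrow> ('n, 'f::euclidean_space) atlas \<Rightarrow> ('m \<Rightarrow> 'n) \<Rightarrow>
   'm \<Rightarrow> ('m, 'e) tangent \<Rightarrow> ('n, 'f) tangent" where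
  "differential A B f p v =
     (\<lambda>d. if d \<in> charts_at B (f p) then dir_deriv A (snd d \<circ> f) p v else 0)"

definition velocity ::
  "('m, 'e::euclidean_space) atlas \<Rightarrow> (real \<Rightarrow> 'm) \<Rightarrow> real \<Rightarrow> ('m, 'e) tangent" where
  "velocity A \<gamma> t =
     (\<lambda>c. if c \<in> charts_at A (\<gamma> t) then vector_derivative (snd c \<circ> \<gamma>) (at t) else 0)"

text \<open>In coordinates \<open>[Y, Z] = DZ(Y) - DY(Z)\<close>, i.e. \<open>[Y, Z] f = Y (Z f) - Z (Y f)\<close>.\<close>

definition lie_bracket ::
  "('m, 'e::euclidean_space) atlas \<Rightarrow> ('m \<Rightarrow> ('m, 'e) tangent) \<Rightarrow> ('m \<Rightarrow> ('m, 'e) tangent) \<Rightarrow>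
   'm \<Rightarrow> ('m, 'e) tangent" where
  "lie_bracket A Y Z p = (\<lambda>c. if c \<in> charts_at A p
     then frechet_derivative (\<lambda>x. Z (chart_inv c x) c) (at (snd c p)) (Y p c)
        - frechet_derivative (\<lambda>x. Y (chart_inv c x) c) (at (snd c p)) (Z p c)
     else 0)"

text \<open>Covectors are extended by \<open>0\<close> outside the tangent space.\<close>

definition cotangent_space :: "('m, 'e::euclidean_space) atlas \<Rightarrow> 'm \<Rightarrow> ('m, 'e) covector set" where
  "cotangent_space A p = {\<xi>.
     (\<forall>v\<in>tangent_space A p. \<forall>w\<in>tangent_space A p. \<forall>a b. \<xi> (vcomb a v b w) = a * \<xi> v + b * \<xi> w) \<and>
     (\<forall>v. v \<notin> tangent_space A p \<longrightarrow> \<xi> v = 0)}"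

text \<open>\<open>\<xi> \<mapsto> \<xi> \<circ> (d\<^sub>pf)\<^sup>-\<^sup>1\<close> for a diffeomorphism \<open>f\<close> of the manifold.\<close>

definition inv_transpose ::
  "('m, 'e::euclidean_space) atlas \<Rightarrow> ('m \<Rightarrow> 'm) \<Rightarrow> 'm \<Rightarrow> ('m, 'e) covector \<Rightarrow> ('m, 'e) covector"
  where
  "inv_transpose A f p \<xi> = (\<lambda>w. if w \<in> tangent_space A (f p)
     then \<xi> (inv_into (tangent_space A p) (differential A A f p) w) else 0)"

definition smooth_covector_along ::
  "('m, 'e::euclidean_space) atlas \<Rightarrow> (real \<Rightarrow> 'm) \<Rightarrow> (real \<Rightarrow> ('m, 'e) covector) \<Rightarrow> bool" where
  "smooth_covector_along A \<gamma> \<xi> \<longleftrightarrow> (\<forall>s. \<xi> s \<in> cotangent_space A (\<gamma> s)) \<and>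
     (\<forall>s. \<forall>c\<in>charts_at A (\<gamma> s). \<exists>\<epsilon>>0. \<gamma> ` {s - \<epsilon><..<s + \<epsilon>} \<subseteq> fst c \<and>
        (\<forall>e. smooth_on (\<lambda>r. \<xi> r (coord_vec A c (\<gamma> r) e)) {s - \<epsilon><..<s + \<epsilon>}))"

text \<open>The global flow of a vector field \<open>Y\<close>: a smooth action of \<open>\<real>\<close> whose orbits are the
  integral curves of \<open>Y\<close>.\<close>

definition is_flow ::
  "('m, 'e::euclidean_space) atlas \<Rightarrow> ('m \<Rightarrow> ('m, 'e) tangent) \<Rightarrow> (real \<Rightarrow> 'm \<Rightarrow> 'm) \<Rightarrow> bool" where
  "is_flow A Y \<phi> \<longleftrightarrow>
     smooth_map (product_atlas euclid_atlas A) A (\<lambda>(t, p). \<phi> t p) \<and>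
     (\<forall>p\<in>carrier A. \<phi> 0 p = p \<and>
        (\<forall>s t. \<phi> (s + t) p = \<phi> s (\<phi> t p)) \<and>
        (\<forall>t. velocity A (\<lambda>s. \<phi> s p) t = Y (\<phi> t p)))"


section \<open>Projective spaces of spaces of covectors\<close>

definition line_of :: "('v \<Rightarrow> real) \<Rightarrow> ('v \<Rightarrow> real) set" where
  "line_of \<xi> = range (\<lambda>(r::real) v. r * \<xi> v)"

definition projective_space :: "('v \<Rightarrow> real) set \<Rightarrow> ('v \<Rightarrow> real) set set" where
  "projective_space S = line_of ` (S - {\<lambda>_. 0})"

text \<open>The quotient topology of \<open>S - {0}\<close>, for a vector space \<open>S\<close> of functionals. The topology of
  the function type is that of pointwise convergence, which on a finite-dimensional \<open>S\<close> is the
  canonical vector space topology.\<close>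

definition projective_topology :: "('v \<Rightarrow> real) set \<Rightarrow> ('v \<Rightarrow> real) set topology" where
  "projective_topology S = topology (\<lambda>U. U \<subseteq> projective_space S \<and>
     openin (top_of_set (S - {\<lambda>_. 0})) {\<xi> \<in> S - {\<lambda>_. 0}. line_of \<xi> \<in> U})"

lemma openin_projective_topology:
  "openin (projective_topology S) U \<longleftrightarrow> U \<subseteq> projective_space S \<and>
     openin (top_of_set (S - {\<lambda>_. 0})) {\<xi> \<in> S - {\<lambda>_. 0}. line_of \<xi> \<in> U}"
proof -
  let ?X = "top_of_set (S - {\<lambda>_. 0})"
  have "istopology (\<lambda>U. U \<subseteq> projective_space S \<and>
     openin ?X {\<xi> \<in> S - {\<lambda>_. 0}. line_of \<xi> \<in> U})"
    unfolding istopology_def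
  proof (intro conjI allI impI)
    fix U V assume *: "U \<subseteq> projective_space S \<and> openin ?X {\<xi> \<in> S - {\<lambda>_. 0}. line_of \<xi> \<in> U}"
      "V \<subseteq> projective_space S \<and> openin ?X {\<xi> \<in> S - {\<lambda>_. 0}. line_of \<xi> \<in> V}"
    have "{\<xi> \<in> S - {\<lambda>_. 0}. line_of \<xi> \<in> U \<inter> V} =
      {\<xi> \<in> S - {\<lambda>_. 0}. line_of \<xi> \<in> U} \<inter> {\<xi> \<in> S - {\<lambda>_. 0}. line_of \<xi> \<in> V}" by auto
    then show "openin ?X {\<xi> \<in> S - {\<lambda>_. 0}. line_of \<xi> \<in> U \<inter> V}"
      using * by (metis (no_types, lifting) openin_Int)
    show "U \<inter> V \<subseteq> projective_space S" using * by auto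
  next
    fix K assume *: "\<forall>U\<in>K. U \<subseteq> projective_space S \<and> openin ?X {\<xi> \<in> S - {\<lambda>_. 0}. line_of \<xi> \<in> U}"
    have "{\<xi> \<in> S - {\<lambda>_. 0}. line_of \<xi> \<in> \<Union>K} = (\<Union>U\<in>K. {\<xi> \<in> S - {\<lambda>_. 0}. line_of \<xi> \<in> U})" by auto
    then show "openin ?X {\<xi> \<in> S - {\<lambda>_. 0}. line_of \<xi> \<in> \<Union>K}"
      using * by (metis (no_types, lifting) openin_clauses(3) imageE)
    show "\<Union>K \<subseteq> projective_space S" using * by auto
  qed
  then show ?thesis by (simp add: projective_topology_def)
qed


section \<open>Closed oriented Riemannian surfaces\<close>

text \<open>Orientation is encoded by an oriented atlas. Connectedness is not required.\<close>

definition closed_oriented_surface :: "('m, real^2) atlas \<Rightarrow> bool" where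
  "closed_oriented_surface A \<longleftrightarrow> smooth_manifold A \<and> compact_space (atlas_topology A) \<and>
     (\<forall>c\<in>A. \<forall>d\<in>A. \<forall>x\<in>snd c ` (fst c \<inter> fst d).
        0 < det (matrix (frechet_derivative (transition c d) (at x))))"

type_synonym 'm metric = "'m \<Rightarrow> ('m, real^2) tangent \<Rightarrow> ('m, real^2) tangent \<Rightarrow> real"

definition metric_matrix ::
  "('m, real^2) atlas \<Rightarrow> 'm metric \<Rightarrow> ('m, real^2) chart \<Rightarrow> real^2 \<Rightarrow> real^2^2" where
  "metric_matrix A g c x = (let p = chart_inv c x in
     \<chi> i j. g p (coord_vec A c p (axis i 1)) (coord_vec A c p (axis j 1)))"

definition riemannian_metric :: "('m, real^2) atlas \<Rightarrow> 'm metric \<Rightarrow> bool" where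
  "riemannian_metric A g \<longleftrightarrow>
     (\<forall>p\<in>carrier A.
        (\<forall>u\<in>tangent_space A p. \<forall>v\<in>tangent_space A p. g p u v = g p v u) \<and>
        (\<forall>u\<in>tangent_space A p. \<forall>v\<in>tangent_space A p. \<forall>w\<in>tangent_space A p. \<forall>a b.
           g p (vcomb a u b v) w = a * g p u w + b * g p v w) \<and>
        (\<forall>v\<in>tangent_space A p. v \<noteq> (\<lambda>_. 0) \<longrightarrow> 0 < g p v v)) \<and>
     (\<forall>c\<in>A. smooth_on (metric_matrix A g c) (chart_range c))"

definition christoffel ::
  "('m, real^2) atlas \<Rightarrow> 'm metric \<Rightarrow> ('m, real^2) chart \<Rightarrow> real^2 \<Rightarrow> 2 \<Rightarrow> 2 \<Rightarrow> 2 \<Rightarrow> real" where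
  "christoffel A g c x k i j =
     (let dg = (\<lambda>i a b. frechet_derivative (\<lambda>y. metric_matrix A g c y $ a $ b) (at x) (axis i 1))
      in (\<Sum>l\<in>UNIV. matrix_inv (metric_matrix A g c x) $ k $ l
            * (dg i j l + dg j i l - dg l i j)) / 2)"

text \<open>Rotation by \<open>\<pi>/2\<close>. The determinant condition says that \<open>(v, Jv)\<close> is positively oriented if
  \<open>v \<noteq> 0\<close>, and it is trivial if \<open>v = 0\<close>.\<close>

definition rotJ ::
  "('m, real^2) atlas \<Rightarrow> 'm metric \<Rightarrow> 'm \<Rightarrow> ('m, real^2) tangent \<Rightarrow> ('m, real^2) tangent" where
  "rotJ A g p v = (THE w. w \<in> tangent_space A p \<and> g p v w = 0 \<and> g p w w = g p v v \<and>
     (\<forall>c\<in>charts_at A p. 0 \<le> det (vector [v c, w c] :: real^2^2)))"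


section \<open>The unit tangent bundle\<close>

type_synonym 'm tpoint = "'m \<times> ('m, real^2) tangent"
type_synonym 'm sm_chart = "('m tpoint, (real^2) \<times> real) chart"
type_synonym 'm sm_tangent = "('m tpoint, (real^2) \<times> real) tangent"
type_synonym 'm sm_covector = "('m tpoint, (real^2) \<times> real) covector"

definition unit_tangent_bundle :: "('m, real^2) atlas \<Rightarrow> 'm metric \<Rightarrow> 'm tpoint set" where
  "unit_tangent_bundle A g = {(p, v). p \<in> carrier A \<and> v \<in> tangent_space A p \<and> g p v v = 1}"

definition rotate_fiber ::
  "('m, real^2) atlas \<Rightarrow> 'm metric \<Rightarrow> real \<Rightarrow> 'm tpoint \<Rightarrow> 'm tpoint" where
  "rotate_fiber A g \<theta> u = (fst u, vcomb (cos \<theta>) (snd u) (sin \<theta>) (rotJ A g (fst u) (snd u)))"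

text \<open>The smooth structure of \<open>SM\<close>: coordinates \<open>(x, \<theta>)\<close>, where \<open>x\<close> are the coordinates of the base
  point in a chart of \<open>M\<close> and \<open>\<theta>\<close> is the angle from the first coordinate direction, taken
  in an open interval of length \<open>2\<pi>\<close>.\<close>

definition sm_param ::
  "('m, real^2) atlas \<Rightarrow> 'm metric \<Rightarrow> ('m, real^2) chart \<Rightarrow> (real^2) \<times> real \<Rightarrow> 'm tpoint" where
  "sm_param A g c = (\<lambda>(x, \<theta>).
     let p = chart_inv c x; e = coord_vec A c p (axis 1 1)
     in rotate_fiber A g \<theta> (p, \<lambda>d. e d /\<^sub>R sqrt (g p e e)))"

definition sm_chart ::
  "('m, real^2) atlas \<Rightarrow> 'm metric \<Rightarrow> ('m, real^2) chart \<Rightarrow> real \<Rightarrow> 'm sm_chart" where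
  "sm_chart A g c a = (let D = chart_range c \<times> {a - pi<..<a + pi}
     in (sm_param A g c ` D, inv_into D (sm_param A g c)))"

definition sm_atlas ::
  "('m, real^2) atlas \<Rightarrow> 'm metric \<Rightarrow> ('m tpoint, (real^2) \<times> real) atlas" where
  "sm_atlas A g = {sm_chart A g c a | c a. c \<in> A}"

definition vertical_field ::
  "('m, real^2) atlas \<Rightarrow> 'm metric \<Rightarrow> 'm tpoint \<Rightarrow> 'm sm_tangent" where
  "vertical_field A g u = velocity (sm_atlas A g) (\<lambda>\<theta>. rotate_fiber A g \<theta> u) 0"

text \<open>The geodesic vector field, in coordinates
  \<open>\<Sum>k. v\<^sup>k \<partial>/\<partial>x\<^sup>k - \<Sum>k i j. \<Gamma>\<^sup>k\<^sub>i\<^sub>j v\<^sup>i v\<^sup>j \<partial>/\<partial>v\<^sup>k\<close>.\<close>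

definition geodesic_field ::
  "('m, real^2) atlas \<Rightarrow> 'm metric \<Rightarrow> 'm tpoint \<Rightarrow> 'm sm_tangent" where
  "geodesic_field A g u = (THE \<xi>. \<xi> \<in> tangent_space (sm_atlas A g) u \<and>
     (\<forall>c\<in>charts_at A (fst u).
        dir_deriv (sm_atlas A g) (\<lambda>w. snd c (fst w)) u \<xi> = snd u c \<and>
        dir_deriv (sm_atlas A g) (\<lambda>w. snd w c) u \<xi> =
          - (\<chi> k. \<Sum>i\<in>UNIV. \<Sum>j\<in>UNIV.
               christoffel A g c (snd c (fst u)) k i j * (snd u c $ i) * (snd u c $ j))))"

definition horizontal_field ::
  "('m, real^2) atlas \<Rightarrow> 'm metric \<Rightarrow> 'm tpoint \<Rightarrow> 'm sm_tangent" where
  "horizontal_field A g = lie_bracket (sm_atlas A g) (vertical_field A g) (geodesic_field A g)"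


section \<open>Thermostats\<close>

definition thermostat ::
  "('m, real^2) atlas \<Rightarrow> 'm metric \<Rightarrow> ('m tpoint \<Rightarrow> real) \<Rightarrow> bool" where
  "thermostat A g lam \<longleftrightarrow> closed_oriented_surface A \<and> riemannian_metric A g \<and>
     smooth_map (sm_atlas A g) euclid_atlas lam"

definition thermostat_field ::
  "('m, real^2) atlas \<Rightarrow> 'm metric \<Rightarrow> ('m tpoint \<Rightarrow> real) \<Rightarrow> 'm tpoint \<Rightarrow> 'm sm_tangent" where
  "thermostat_field A g lam u = vcomb 1 (geodesic_field A g u) (lam u) (vertical_field A g u)"

definition thermostat_flow ::
  "('m, real^2) atlas \<Rightarrow> 'm metric \<Rightarrow> ('m tpoint \<Rightarrow> real) \<Rightarrow>
   (real \<Rightarrow> 'm tpoint \<Rightarrow> 'm tpoint) \<Rightarrow> bool" where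
  "thermostat_flow A g lam \<phi> \<longleftrightarrow> is_flow (sm_atlas A g) (thermostat_field A g lam) \<phi>"

text \<open>The member \<open>\<beta>\<close> of the coframe dual to \<open>(X, H, V)\<close>.\<close>

definition coframe_beta ::
  "('m, real^2) atlas \<Rightarrow> 'm metric \<Rightarrow> 'm tpoint \<Rightarrow> 'm sm_covector" where
  "coframe_beta A g u = (THE \<xi>. \<xi> \<in> cotangent_space (sm_atlas A g) u \<and>
     \<xi> (geodesic_field A g u) = 0 \<and> \<xi> (horizontal_field A g u) = 1 \<and>
     \<xi> (vertical_field A g u) = 0)"

definition Hstar ::
  "('m, real^2) atlas \<Rightarrow> 'm metric \<Rightarrow> 'm tpoint \<Rightarrow> 'm sm_covector set" where
  "Hstar A g u = line_of (coframe_beta A g u)"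

definition Sigma_bundle ::
  "('m, real^2) atlas \<Rightarrow> 'm metric \<Rightarrow> ('m tpoint \<Rightarrow> real) \<Rightarrow> 'm tpoint \<Rightarrow> 'm sm_covector set" where
  "Sigma_bundle A g lam u =
     {\<xi> \<in> cotangent_space (sm_atlas A g) u. \<xi> (thermostat_field A g lam u) = 0}"

text \<open>The image of a set \<open>L\<close> of covectors at \<open>u\<close> under the inverse transpose of the differential
  of \<open>\<phi>\<^sub>t\<close> at \<open>u\<close>.\<close>

definition flow_push ::
  "('m, real^2) atlas \<Rightarrow> 'm metric \<Rightarrow> (real \<Rightarrow> 'm tpoint \<Rightarrow> 'm tpoint) \<Rightarrow> real \<Rightarrow> 'm tpoint \<Rightarrow>
   'm sm_covector set \<Rightarrow> 'm sm_covector set" where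
  "flow_push A g \<phi> t u L = inv_transpose (sm_atlas A g) (\<phi> t) u ` L"

text \<open>A line subbundle of \<open>\<Sigma>\<close> along the orbit of \<open>v\<close>. Smoothness is expressed by a nowhere
  vanishing smooth section over \<open>\<real>\<close>.\<close>

definition line_subbundle_along ::
  "('m, real^2) atlas \<Rightarrow> 'm metric \<Rightarrow> ('m tpoint \<Rightarrow> real) \<Rightarrow> (real \<Rightarrow> 'm tpoint \<Rightarrow> 'm tpoint) \<Rightarrow>
   'm tpoint \<Rightarrow> ('m tpoint \<Rightarrow> 'm sm_covector set) \<Rightarrow> bool" where
  "line_subbundle_along A g lam \<phi> v G \<longleftrightarrow>
     (\<forall>s. G (\<phi> s v) \<in> projective_space (Sigma_bundle A g lam (\<phi> s v))) \<and>
     (\<exists>\<xi>. smooth_covector_along (sm_atlas A g) (\<lambda>s. \<phi> s v) \<xi> \<and> (\<forall>s. G (\<phi> s v) = line_of (\<xi> s)))"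

definition invariant_along ::
  "('m, real^2) atlas \<Rightarrow> 'm metric \<Rightarrow> (real \<Rightarrow> 'm tpoint \<Rightarrow> 'm tpoint) \<Rightarrow>
   'm tpoint \<Rightarrow> ('m tpoint \<Rightarrow> 'm sm_covector set) \<Rightarrow> bool" where
  "invariant_along A g \<phi> v G \<longleftrightarrow>
     (\<forall>s t. flow_push A g \<phi> t (\<phi> s v) (G (\<phi> s v)) = G (\<phi> t (\<phi> s v)))"


section \<open>The exponential map and conjugate points\<close>

definition thermostat_exp ::
  "'m metric \<Rightarrow> (real \<Rightarrow> 'm tpoint \<Rightarrow> 'm tpoint) \<Rightarrow> 'm \<Rightarrow> ('m, real^2) tangent \<Rightarrow> 'm" where
  "thermostat_exp g \<phi> x w = (let r = sqrt (g x w w) in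
     if r = 0 then x else fst (\<phi> r (x, \<lambda>c. w c /\<^sub>R r)))"

text \<open>The vector space \<open>T\<^sub>xM\<close> as a manifold, with linear charts.\<close>

definition tangent_space_atlas ::
  "('m, real^2) atlas \<Rightarrow> 'm \<Rightarrow> (('m, real^2) tangent, real^2) atlas" where
  "tangent_space_atlas A x = {(tangent_space A x, \<lambda>w. w c) | c. c \<in> charts_at A x}"

definition exp_singular_at ::
  "('m, real^2) atlas \<Rightarrow> 'm metric \<Rightarrow> (real \<Rightarrow> 'm tpoint \<Rightarrow> 'm tpoint) \<Rightarrow>
   'm \<Rightarrow> ('m, real^2) tangent \<Rightarrow> bool" where
  "exp_singular_at A g \<phi> x w \<longleftrightarrow>
     (\<exists>\<zeta>\<in>tangent_space (tangent_space_atlas A x) w. \<zeta> \<noteq> (\<lambda>_. 0) \<and>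
        differential (tangent_space_atlas A x) A (thermostat_exp g \<phi> x) w \<zeta> = (\<lambda>_. 0))"

text \<open>The points with parameters \<open>a \<noteq> b\<close> on the thermostat geodesic \<open>t \<mapsto> \<pi>(\<phi>\<^sub>t(v))\<close> are conjugate
  along it. The geodesic is directed, so the segment starts at the smaller parameter. Conjugacy is
  attached to the parameters: the two points of \<open>M\<close> may coincide, as for the great
  circles of length \<open>2\<pi>\<close> on the round sphere.\<close>

definition conjugate_along ::
  "('m, real^2) atlas \<Rightarrow> 'm metric \<Rightarrow> (real \<Rightarrow> 'm tpoint \<Rightarrow> 'm tpoint) \<Rightarrow> 'm tpoint \<Rightarrow>
   real \<Rightarrow> real \<Rightarrow> bool" where
  "conjugate_along A g \<phi> v a b \<longleftrightarrow>
     (let u = \<phi> (min a b) v; T = \<bar>b - a\<bar>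
      in exp_singular_at A g \<phi> (fst u) (\<lambda>c. T *\<^sub>R snd u c))"

end

theory Submission
  imports Defs
begin

text \<open>The line \<open>H\<^sup>*(u)\<close> is the annihilator of \<open>F(u)\<close> and \<open>V(u)\<close>. Hence \<open>H\<^sup>*(\<phi>\<^sub>t(u))\<close>, transported
  back to \<open>u\<close>, is the annihilator of \<open>F(u)\<close> and of \<open>W(t) = d\<phi>\<^sub>-\<^sub>t V(\<phi>\<^sub>t(u))\<close>. Modulo \<open>F(u)\<close>, \<open>W\<close> is a curve
  in the plane spanned by \<open>H(u)\<close> and \<open>V(u)\<close>, with \<open>W(0) = V\<close>; since \<open>H = [V, X]\<close>, the derivative of its
  \<open>H\<close>-component at \<open>0\<close> is \<open>-1\<close>. If no two of the transported lines along the orbit coincide, this curve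
  meets every line through the origin at most once, so for \<open>t > 0\<close> its slope \<open>V : H\<close> is monotone and
  bounded by the slope at any negative time. The slope therefore has a finite limit as \<open>t\<close> tends to
  infinity, and finiteness of the limit is transversality to \<open>H\<^sup>*\<close>.

  In polar coordinates, the radial and angular derivatives of the exponential map at \<open>t u\<close> are the
  projections of \<open>F(\<phi>\<^sub>t(u))\<close> and \<open>d\<phi>\<^sub>t V(u)\<close> to the surface. They are linearly dependent iff \<open>d\<phi>\<^sub>t V(u)\<close>
  lies in the span of \<open>F\<close> and \<open>V\<close>, that is, iff \<open>d\<phi>\<^sub>t\<^sup>-\<^sup>\<top>\<close> maps \<open>H\<^sup>*(u)\<close> to \<open>H\<^sup>*(\<phi>\<^sub>t(u))\<close>.\<close>

section \<open>Differential calculus\<close>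

text \<open>The fields and covectors of the statement are given by definite descriptions, a Lie
  bracket and a chosen inverse. All of them are computed in bundle coordinates (x, theta), where V
  is the constant vector (0, 1). The atlas of SM is only shown to have differentiable transition
  maps, enough for tangent vectors and the chain rule; second-order information on SM comes from the
  joint smoothness of the flow, including the differentiability of F that the bracket H requires.
  The frame is (F, H, V) instead of (X, H, V): beta stays the same, and together with a covector
  killing F and H it is a basis of Sigma. Transport of a line in Sigma then means transport of one
  vector modulo F. Absence of coincidences concerns all base points of the orbit; pulling beta back
  to one point u turns it into a nonzero determinant for any two times, the form needed for
  convergence. The limits are found point by point, so smoothness of the limit bundles is deduced
  from their invariance.\<close>

lemma open_differentiable_onD:
  "f differentiable_on S \<Longrightarrow> open S \<Longrightarrow> x \<in> S \<Longrightarrow> f differentiable (at x)"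
  by (simp add: differentiable_on_eq_differentiable_at)

lemma frechet_eqI: "(f has_derivative D) (at x) \<Longrightarrow> frechet_derivative f (at x) = D"
  by (rule frechet_derivative_at[symmetric])

lemma frechet_has_derivative:
  "f differentiable (at x) \<Longrightarrow> (f has_derivative frechet_derivative f (at x)) (at x)"
  by (simp add: frechet_derivative_works)

lemma has_derivative_eventually_eq:
  assumes "(f has_derivative D) (at x)" "\<forall>\<^sub>F y in nhds x. g y = f y"
  shows "(g has_derivative D) (at x)"
proof -
  obtain U where "open U" "x \<in> U" "\<forall>y\<in>U. g y = f y"
    using assms(2) unfolding eventually_nhds by blast
  then show ?thesis
    using has_derivative_transform_within_open[OF assms(1), of U g] by simp
qed

lemma differentiable_eventually_eq:
  "f differentiable (at x) \<Longrightarrow> \<forall>\<^sub>F y in nhds x. g y = f y \<Longrightarrow> g differentiable (at x)"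
  unfolding differentiable_def using has_derivative_eventually_eq by blast

text \<open>No differentiability is assumed: \<open>frechet_derivative\<close> is chosen from the
  set of derivatives at \<open>x\<close>, and both functions have the same set.\<close>

lemma frechet_eventually_eq:
  assumes "\<forall>\<^sub>F y in nhds x. g y = f y"
  shows "frechet_derivative g (at x) = frechet_derivative f (at x)"
proof -
  have "(g has_derivative D) (at x) \<longleftrightarrow> (f has_derivative D) (at x)" for D
    using has_derivative_eventually_eq[of f D x g] has_derivative_eventually_eq[of g D x f] assms
    by (auto simp: eq_commute)
  then show ?thesis unfolding frechet_derivative_def by simp
qed

lemma frechet_chain:
  assumes "g differentiable (at x)" "f differentiable (at (g x))"
  shows "frechet_derivative (\<lambda>y. f (g y)) (at x) =
     (\<lambda>v. frechet_derivative f (at (g x)) (frechet_derivative g (at x) v))"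
  using has_derivative_compose[OF frechet_has_derivative[OF assms(1)] frechet_has_derivative[OF
    assms(2)]]
  by (rule frechet_eqI)

lemma differentiable_chain:
  "g differentiable (at x) \<Longrightarrow> f differentiable (at (g x)) \<Longrightarrow> (\<lambda>y. f (g y)) differentiable (at x)"
  unfolding differentiable_def using has_derivative_compose by blast

lemma linear_frechet: "f differentiable (at x) \<Longrightarrow> linear (frechet_derivative f (at x))"
  by (rule linear_frechet_derivative)

section \<open>Closure properties of C^k and smooth maps\<close>

lemma Ck_on_cong:
  assumes "open S" "\<And>x. x \<in> S \<Longrightarrow> g x = f x" "Ck_on k f S"
  shows "Ck_on k g S"
  using assms(2,3)
proof (induction k arbitrary: f g)
  case 0
  then show ?case using continuous_on_cong by (metis Ck_on.simps(1))
next
  case (Suc k)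
  have ev: "\<forall>\<^sub>F y in nhds x. g y = f y" if "x \<in> S" for x
    using Suc.prems(1) \<open>open S\<close> that eventually_nhds by blast
  have "g differentiable_on S"
    using Suc.prems(2) ev \<open>open S\<close> differentiable_eventually_eq[of f _ g]
    by (simp add: differentiable_on_eq_differentiable_at)
  moreover have "Ck_on k (\<lambda>x. frechet_derivative g (at x) e) S" for e
  proof (rule Suc.IH[of _ "\<lambda>x. frechet_derivative f (at x) e"])
    show "frechet_derivative g (at x) e = frechet_derivative f (at x) e" if "x \<in> S" for x
      using frechet_eventually_eq[OF ev[OF that]] by simp
  qed (use Suc.prems in simp)
  ultimately show ?case by simp
qed

lemma Ck_on_subset: "Ck_on k f S \<Longrightarrow> T \<subseteq> S \<Longrightarrow> Ck_on k f T"
  by (induction k arbitrary: f) (auto intro: continuous_on_subset differentiable_on_subset)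

lemma Ck_on_Suc_imp: "Ck_on (Suc k) f S \<Longrightarrow> Ck_on k f S"
  by (induction k arbitrary: f) (auto intro: differentiable_imp_continuous_on)

lemma Ck_on_const: "Ck_on k (\<lambda>x. c) S"
  by (induction k arbitrary: c) auto

lemma Ck_on_add:
  assumes "open S"
  shows "Ck_on k f S \<Longrightarrow> Ck_on k g S \<Longrightarrow> Ck_on k (\<lambda>x. f x + g x) S"
proof (induction k arbitrary: f g)
  case 0
  then show ?case by (simp add: continuous_on_add)
next
  case (Suc k)
  have d: "frechet_derivative (\<lambda>x. f x + g x) (at x) e =
      frechet_derivative f (at x) e + frechet_derivative g (at x) e" if "x \<in> S" for x e
    using Suc.prems that \<open>open S\<close>
    by (subst frechet_eqI[OF has_derivative_add[OF frechet_has_derivative frechet_has_derivative]])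
       (auto intro: open_differentiable_onD)
  have "Ck_on k (\<lambda>x. frechet_derivative (\<lambda>x. f x + g x) (at x) e) S" for e
    by (rule Ck_on_cong[OF \<open>open S\<close> d Suc.IH]) (use Suc.prems in auto)
  then show ?case using Suc.prems by simp
qed

lemma Ck_on_sum:
  assumes "open S" "finite I" "\<And>i. i \<in> I \<Longrightarrow> Ck_on k (f i) S"
  shows "Ck_on k (\<lambda>x. \<Sum>i\<in>I. f i x) S"
  using assms(2,3)
  by (induction I) (auto intro: Ck_on_const Ck_on_add \<open>open S\<close>)

lemma Ck_on_scaleR:
  fixes f :: "'a::euclidean_space \<Rightarrow> real" and g :: "'a \<Rightarrow> 'b::real_normed_vector"
  assumes "open S"
  shows "Ck_on k f S \<Longrightarrow> Ck_on k g S \<Longrightarrow> Ck_on k (\<lambda>x. f x *\<^sub>R g x) S"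
proof (induction k arbitrary: f g)
  case 0
  then show ?case by (simp add: continuous_on_scaleR)
next
  case (Suc k)
  have d: "frechet_derivative (\<lambda>x. f x *\<^sub>R g x) (at x) e =
      f x *\<^sub>R frechet_derivative g (at x) e + frechet_derivative f (at x) e *\<^sub>R g x"
    if "x \<in> S" for x e
    using Suc.prems that \<open>open S\<close>
    by (subst frechet_eqI[OF has_derivative_scaleR[OF frechet_has_derivative
      frechet_has_derivative]])
       (auto intro: open_differentiable_onD)
  \<comment> \<open>The product rule keeps one factor undifferentiated; \<open>Ck_on_Suc_imp\<close>
    lowers it to order \<open>k\<close>, so the induction hypothesis covers both terms.\<close>
  have "Ck_on k (\<lambda>x. frechet_derivative (\<lambda>x. f x *\<^sub>R g x) (at x) e) S" for e
    by (rule Ck_on_cong[OF \<open>open S\<close> d Ck_on_add[OF \<open>open S\<close> Suc.IH Suc.IH]])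
       (use Suc.prems Ck_on_Suc_imp in auto)
  then show ?case using Suc.prems by simp
qed

lemma Ck_on_linear:
  fixes f :: "'a::euclidean_space \<Rightarrow> 'b::real_normed_vector"
  assumes "open S" "bounded_linear h"
  shows "Ck_on k f S \<Longrightarrow> Ck_on k (\<lambda>x. h (f x)) S"
proof (induction k arbitrary: f)
  case 0
  then show ?case using \<open>bounded_linear h\<close>
    by (simp add: bounded_linear.continuous_on)
next
  case (Suc k)
  have hd: "((\<lambda>x. h (f x)) has_derivative (\<lambda>e. h (frechet_derivative f (at x) e))) (at x)"
    if "x \<in> S" for x
    by (rule bounded_linear.has_derivative[OF \<open>bounded_linear h\<close> frechet_has_derivative])
       (use Suc.prems that \<open>open S\<close> open_differentiable_onD in auto)
  have "Ck_on k (\<lambda>x. frechet_derivative (\<lambda>x. h (f x)) (at x) e) S" for e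
    by (rule Ck_on_cong[OF \<open>open S\<close> _ Suc.IH[of "\<lambda>x. frechet_derivative f (at x) e"]])
       (use Suc.prems frechet_eqI[OF hd] in auto)
  moreover have "(\<lambda>x. h (f x)) differentiable_on S"
    using hd \<open>open S\<close> by (auto simp: differentiable_on_eq_differentiable_at differentiable_def)
  ultimately show ?case by simp
qed

text \<open>The chain rule evaluates the derivative of \<open>f\<close> in a direction that varies
  with the point, whereas \<open>Ck_on\<close> speaks of fixed directions. Expanding that direction
  in the standard basis leaves a finite sum of products of C^k functions. The inner map stays fixed
  in the induction.\<close>

lemma Ck_on_compose:
  fixes f :: "'b::euclidean_space \<Rightarrow> 'c::real_normed_vector" and g :: "'a::euclidean_space \<Rightarrow> 'b"
  assumes "open S" "open T" "g ` S \<subseteq> T"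
  shows "Ck_on k f T \<Longrightarrow> Ck_on k g S \<Longrightarrow> Ck_on k (\<lambda>x. f (g x)) S"
proof (induction k arbitrary: f)
  case 0
  then show ?case using assms(3) by (auto intro: continuous_on_compose2)
next
  case (Suc k)
  have dg: "g differentiable (at x)" and df: "f differentiable (at (g x))" if "x \<in> S" for x
    using Suc.prems assms that by (auto intro: open_differentiable_onD)
  have d: "frechet_derivative (\<lambda>x. f (g x)) (at x) e =
      (\<Sum>i\<in>Basis. (frechet_derivative g (at x) e \<bullet> i) *\<^sub>R frechet_derivative f (at (g x)) i)"
    if "x \<in> S" for x e
  proof -
    interpret linear "frechet_derivative f (at (g x))" using df[OF that] by (rule linear_frechet)
    have "frechet_derivative (\<lambda>x. f (g x)) (at x) e =
       frechet_derivative f (at (g x)) (\<Sum>i\<in>Basis. (frechet_derivative g (at x) e \<bullet> i) *\<^sub>R i)"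
      using frechet_chain[OF dg[OF that] df[OF that]] by (simp add: euclidean_representation)
    then show ?thesis by (simp add: sum scaleR)
  qed
  have "Ck_on k (\<lambda>x. frechet_derivative (\<lambda>x. f (g x)) (at x) e) S" for e
  proof (rule Ck_on_cong[OF \<open>open S\<close> d], assumption, rule Ck_on_sum[OF \<open>open S\<close> finite_Basis])
    fix i :: 'b
    have "Ck_on k (\<lambda>x. frechet_derivative g (at x) e \<bullet> i) S"
      by (rule Ck_on_linear[OF \<open>open S\<close> bounded_linear_inner_left]) (use Suc.prems(2) in simp)
    moreover have "Ck_on k (\<lambda>x. frechet_derivative f (at (g x)) i) S"
      by (rule Suc.IH[of "\<lambda>y. frechet_derivative f (at y) i"])
        (use Suc.prems Ck_on_Suc_imp in auto)
    ultimately show "Ck_on k (\<lambda>x. (frechet_derivative g (at x) e \<bullet> i) *\<^sub>R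
       frechet_derivative f (at (g x)) i) S"
      by (rule Ck_on_scaleR[OF \<open>open S\<close>])
  qed
  moreover have "(\<lambda>x. f (g x)) differentiable_on S"
    using differentiable_chain[OF dg df] \<open>open S\<close>
    by (auto simp: differentiable_on_eq_differentiable_at)
  ultimately show ?case by simp
qed

lemma Ck_on_Pair:
  fixes f :: "'a::euclidean_space \<Rightarrow> 'b::real_normed_vector" and g :: "'a \<Rightarrow> 'c::real_normed_vector"
  assumes "open S" "Ck_on k f S" "Ck_on k g S"
  shows "Ck_on k (\<lambda>x. (f x, g x)) S"
proof -
  have "bounded_linear (\<lambda>y::'b. (y, 0::'c))" "bounded_linear (\<lambda>z::'c. (0::'b, z))"
    by (intro bounded_linear_Pair bounded_linear_ident bounded_linear_zero)+
  from Ck_on_add[OF assms(1) Ck_on_linear[OF assms(1) this(1) assms(2)]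
      Ck_on_linear[OF assms(1) this(2) assms(3)]]
  show ?thesis by simp
qed

lemma smooth_on_differentiable:
  "smooth_on f S \<Longrightarrow> open S \<Longrightarrow> x \<in> S \<Longrightarrow> f differentiable (at x)"
  using open_differentiable_onD[of f S x] Ck_on.simps(2)[of 0 f S]
  unfolding smooth_on_def by blast

lemma smooth_on_frechet: "smooth_on f S \<Longrightarrow> smooth_on (\<lambda>x. frechet_derivative f (at x) e) S"
  unfolding smooth_on_def using Ck_on.simps(2) by blast

lemma smooth_on_cong:
  "open S \<Longrightarrow> smooth_on f S \<Longrightarrow> (\<And>x. x \<in> S \<Longrightarrow> g x = f x) \<Longrightarrow> smooth_on g S"
  unfolding smooth_on_def by (auto intro: Ck_on_cong)

lemma smooth_on_subset: "smooth_on f S \<Longrightarrow> T \<subseteq> S \<Longrightarrow> smooth_on f T"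
  unfolding smooth_on_def by (auto intro: Ck_on_subset)

lemma smooth_on_linear: "open S \<Longrightarrow> bounded_linear h \<Longrightarrow> smooth_on f S \<Longrightarrow> smooth_on (\<lambda>x. h (f x)) S"
  unfolding smooth_on_def by (auto intro: Ck_on_linear)

lemma smooth_on_compose:
  "open S \<Longrightarrow> open T \<Longrightarrow> g ` S \<subseteq> T \<Longrightarrow> smooth_on f T \<Longrightarrow> smooth_on g S \<Longrightarrow>
    smooth_on (\<lambda>x. f (g x)) S"
  unfolding smooth_on_def by (auto intro: Ck_on_compose)

lemma smooth_on_Pair:
  "open S \<Longrightarrow> smooth_on f S \<Longrightarrow> smooth_on g S \<Longrightarrow> smooth_on (\<lambda>x. (f x, g x)) S"
  unfolding smooth_on_def by (auto intro: Ck_on_Pair)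

lemma smooth_on_const: "smooth_on (\<lambda>x. c) S"
  unfolding smooth_on_def by (simp add: Ck_on_const)

lemma smooth_on_ident: "smooth_on (\<lambda>x. x) S"
proof -
  have "Ck_on k (\<lambda>x. x) S" for k
    by (cases k) (auto simp: Ck_on_const)
  then show ?thesis by (simp add: smooth_on_def)
qed

lemma smooth_on_bounded_linear: "bounded_linear h \<Longrightarrow> smooth_on h S"
proof -
  assume "bounded_linear h"
  then have "smooth_on h UNIV" using smooth_on_linear[OF open_UNIV _ smooth_on_ident] by blast
  then show ?thesis by (rule smooth_on_subset) simp
qed

section \<open>Symmetry of second derivatives\<close>

lemma DERIV_along_line:
  fixes f :: "'a::real_normed_vector \<Rightarrow> real"
  assumes "f differentiable (at (x + s *\<^sub>R a))"
  shows "((\<lambda>s. f (x + s *\<^sub>R a)) has_real_derivative frechet_derivative f (at (x + s *\<^sub>R a)) a) (at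
    s)"
proof -
  have "((\<lambda>s. x + s *\<^sub>R a) has_derivative (\<lambda>h. h *\<^sub>R a)) (at s)"
    by (auto intro!: derivative_eq_intros)
  from has_derivative_compose[OF this frechet_has_derivative[OF assms]]
  have "((\<lambda>s. f (x + s *\<^sub>R a)) has_derivative
      (\<lambda>h. frechet_derivative f (at (x + s *\<^sub>R a)) (h *\<^sub>R a))) (at s)" .
  moreover have "frechet_derivative f (at (x + s *\<^sub>R a)) (h *\<^sub>R a) =
     frechet_derivative f (at (x + s *\<^sub>R a)) a * h" for h
    using linear_frechet[OF assms] by (simp add: linear_cmul)
  ultimately show ?thesis by (simp add: has_field_derivative_def)
qed

text \<open>The mean value theorem is applied twice to the second difference over a parallelogram:
  in direction \<open>a\<close> to the difference of the two edges parallel to \<open>a\<close>,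
  then in direction \<open>b\<close> to the derivative along \<open>a\<close>.\<close>

lemma mixed_difference_mean_value:
  fixes f :: "'a::euclidean_space \<Rightarrow> real"
  assumes "Ck_on (Suc (Suc 0)) f S" "open S" "0 < s"
    and S: "\<And>\<xi> \<eta>. 0 \<le> \<xi> \<Longrightarrow> \<xi> \<le> s \<Longrightarrow> 0 \<le> \<eta> \<Longrightarrow> \<eta> \<le> s \<Longrightarrow> x + \<xi> *\<^sub>R a + \<eta> *\<^sub>R b \<in> S"
  shows "\<exists>\<xi> \<eta>. 0 < \<xi> \<and> \<xi> < s \<and> 0 < \<eta> \<and> \<eta> < s \<and>
     f (x + s *\<^sub>R a + s *\<^sub>R b) - f (x + s *\<^sub>R a) - f (x + s *\<^sub>R b) + f x =
     s * s * frechet_derivative (\<lambda>y. frechet_derivative f (at y) a) (at (x + \<xi> *\<^sub>R a + \<eta> *\<^sub>R b)) b"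
proof -
  let ?f = "\<lambda>y. frechet_derivative f (at y) a"
  have df: "f differentiable (at y)" "?f differentiable (at y)" if "y \<in> S" for y
    using assms(1) open_differentiable_onD[OF _ \<open>open S\<close> that] by auto
  have "((\<lambda>\<xi>. f (x + \<xi> *\<^sub>R a + s *\<^sub>R b) - f (x + \<xi> *\<^sub>R a)) has_real_derivative
      ?f (x + \<xi> *\<^sub>R a + s *\<^sub>R b) - ?f (x + \<xi> *\<^sub>R a)) (at \<xi>)" if "0 \<le> \<xi>" "\<xi> \<le> s" for \<xi>
  proof (rule DERIV_diff)
    show "((\<lambda>\<xi>. f (x + \<xi> *\<^sub>R a + s *\<^sub>R b)) has_real_derivative ?f (x + \<xi> *\<^sub>R a + s *\<^sub>R b)) (at \<xi>)"
      using DERIV_along_line[of f "x + s *\<^sub>R b" \<xi> a] df(1) S[of \<xi> s] that assms(3)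
      by (simp add: add.assoc add.commute add.left_commute)
    show "((\<lambda>\<xi>. f (x + \<xi> *\<^sub>R a)) has_real_derivative ?f (x + \<xi> *\<^sub>R a)) (at \<xi>)"
      using DERIV_along_line[of f x \<xi> a] df(1) S[of \<xi> 0] that by simp
  qed
  from MVT2[OF \<open>0 < s\<close> this] obtain \<xi> where \<xi>: "0 < \<xi>" "\<xi> < s" and
    1: "f (x + s *\<^sub>R a + s *\<^sub>R b) - f (x + s *\<^sub>R a) - (f (x + s *\<^sub>R b) - f x) =
      s * (?f (x + \<xi> *\<^sub>R a + s *\<^sub>R b) - ?f (x + \<xi> *\<^sub>R a))"
    by auto
  have "((\<lambda>\<eta>. ?f ((x + \<xi> *\<^sub>R a) + \<eta> *\<^sub>R b)) has_real_derivative
      frechet_derivative ?f (at ((x + \<xi> *\<^sub>R a) + \<eta> *\<^sub>R b)) b) (at \<eta>)" if "0 \<le> \<eta>" "\<eta> \<le> s" for \<eta>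
    by (rule DERIV_along_line) (use df(2) S[of \<xi> \<eta>] \<xi> that in simp)
  from MVT2[OF \<open>0 < s\<close> this] obtain \<eta> where \<eta>: "0 < \<eta>" "\<eta> < s" and
    2: "?f (x + \<xi> *\<^sub>R a + s *\<^sub>R b) - ?f (x + \<xi> *\<^sub>R a) =
      s * frechet_derivative ?f (at ((x + \<xi> *\<^sub>R a) + \<eta> *\<^sub>R b)) b"
    by auto
  show ?thesis
    using \<xi> \<eta> 1 2 by (intro exI[of _ \<xi>] exI[of _ \<eta>]) (simp add: algebra_simps)
qed

text \<open>The second difference over a small parallelogram does not depend on the order of
  \<open>a\<close> and \<open>b\<close>. It is \<open>s * s\<close> times either mixed derivative at
  some nearby point; by continuity these two equal values lie within half the gap of the values at
  \<open>x\<close>, so the gap cannot be positive.\<close>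

lemma second_derivative_symmetric_real:
  fixes f :: "'a::euclidean_space \<Rightarrow> real"
  assumes C2: "Ck_on (Suc (Suc 0)) f S" and "open S" "x \<in> S"
  shows "frechet_derivative (\<lambda>y. frechet_derivative f (at y) a) (at x) b =
    frechet_derivative (\<lambda>y. frechet_derivative f (at y) b) (at x) a"
proof (rule ccontr)
  let ?D = "\<lambda>a b y. frechet_derivative (\<lambda>z. frechet_derivative f (at z) a) (at y) b"
  define e where "e = \<bar>?D a b x - ?D b a x\<bar> / 2"
  assume "?D a b x \<noteq> ?D b a x"
  then have "0 < e" by (simp add: e_def)
  have ct: "isCont (?D a b) x" for a b
    using C2 \<open>open S\<close> \<open>x \<in> S\<close> by (simp add: continuous_on_eq_continuous_at)
  obtain d1 where d1: "0 < d1" "\<And>y. dist y x < d1 \<Longrightarrow> dist (?D a b y) (?D a b x) < e"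
    using ct[of a b] \<open>0 < e\<close> unfolding continuous_at_eps_delta dist_norm by blast
  obtain d2 where d2: "0 < d2" "\<And>y. dist y x < d2 \<Longrightarrow> dist (?D b a y) (?D b a x) < e"
    using ct[of b a] \<open>0 < e\<close> unfolding continuous_at_eps_delta dist_norm by blast
  obtain d3 where d3: "0 < d3" "ball x d3 \<subseteq> S" using \<open>open S\<close> \<open>x \<in> S\<close> openE by blast
  define d where "d = min d1 (min d2 d3)"
  have "0 < d" using d1 d2 d3 by (simp add: d_def)
  \<comment> \<open>Small enough for the whole parallelogram to lie within \<open>d\<close> of
    \<open>x\<close>; the summand 1 keeps the denominator positive when both vectors vanish.\<close>
  define s where "s = d / (norm a + norm b + 1)"
  have "0 < norm a + norm b + 1" by (simp add: add_nonneg_pos)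
  then have "0 < s" using \<open>0 < d\<close> by (simp add: s_def)
  have near: "dist (x + \<xi> *\<^sub>R a + \<eta> *\<^sub>R b) x < d" if "0 \<le> \<xi>" "\<xi> \<le> s" "0 \<le> \<eta>" "\<eta> \<le> s" for \<xi> \<eta>
  proof -
    have "dist (x + \<xi> *\<^sub>R a + \<eta> *\<^sub>R b) x \<le> norm (\<xi> *\<^sub>R a) + norm (\<eta> *\<^sub>R b)"
      using norm_triangle_ineq[of "\<xi> *\<^sub>R a" "\<eta> *\<^sub>R b"] by (simp add: dist_norm add.assoc)
    also have "\<dots> \<le> s * norm a + s * norm b"
      using that by (auto intro!: add_mono mult_right_mono)
    also have "\<dots> < s * (norm a + norm b + 1)" using \<open>0 < s\<close> by (simp add: algebra_simps)
    also have "\<dots> = d" using \<open>0 < norm a + norm b + 1\<close> by (simp add: s_def)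
    finally show ?thesis .
  qed
  have near': "dist (x + \<xi> *\<^sub>R b + \<eta> *\<^sub>R a) x < d" if "0 \<le> \<xi>" "\<xi> \<le> s" "0 \<le> \<eta>" "\<eta> \<le> s" for \<xi> \<eta>
    using near[of \<eta> \<xi>] that by (simp add: add.assoc add.commute add.left_commute)
  have inS: "y \<in> S" if "dist y x < d" for y using d3(2) that by (auto simp: d_def dist_commute)
  obtain \<xi> \<eta> where 1: "0 < \<xi>" "\<xi> < s" "0 < \<eta>" "\<eta> < s"
    "f (x + s *\<^sub>R a + s *\<^sub>R b) - f (x + s *\<^sub>R a) - f (x + s *\<^sub>R b) + f x =
     s * s * ?D a b (x + \<xi> *\<^sub>R a + \<eta> *\<^sub>R b)"
    using mixed_difference_mean_value[OF C2 \<open>open S\<close> \<open>0 < s\<close>, of x a b] near inS by blast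
  obtain \<xi>' \<eta>' where 2: "0 < \<xi>'" "\<xi>' < s" "0 < \<eta>'" "\<eta>' < s"
    "f (x + s *\<^sub>R b + s *\<^sub>R a) - f (x + s *\<^sub>R b) - f (x + s *\<^sub>R a) + f x =
     s * s * ?D b a (x + \<xi>' *\<^sub>R b + \<eta>' *\<^sub>R a)"
    using mixed_difference_mean_value[OF C2 \<open>open S\<close> \<open>0 < s\<close>, of x b a] near' inS by blast
  have comm: "x + s *\<^sub>R b + s *\<^sub>R a = x + s *\<^sub>R a + s *\<^sub>R b" by simp
  have "s * s * ?D a b (x + \<xi> *\<^sub>R a + \<eta> *\<^sub>R b) = s * s * ?D b a (x + \<xi>' *\<^sub>R b + \<eta>' *\<^sub>R a)"
    using 1(5) 2(5) unfolding comm by linarith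
  then have eq: "?D a b (x + \<xi> *\<^sub>R a + \<eta> *\<^sub>R b) = ?D b a (x + \<xi>' *\<^sub>R b + \<eta>' *\<^sub>R a)"
    using \<open>0 < s\<close> by simp
  have "dist (?D a b (x + \<xi> *\<^sub>R a + \<eta> *\<^sub>R b)) (?D a b x) < e"
    using near[of \<xi> \<eta>] 1 by (intro d1(2)) (simp add: d_def)
  moreover have "dist (?D b a (x + \<xi>' *\<^sub>R b + \<eta>' *\<^sub>R a)) (?D b a x) < e"
    using near'[of \<xi>' \<eta>'] 2 by (intro d2(2)) (simp add: d_def)
  ultimately have "\<bar>?D a b x - ?D b a x\<bar> < 2 * e"
    using eq by (simp add: dist_real_def)
  then show False by (simp add: e_def)
qed

lemma frechet_inner:
  "f differentiable (at x) \<Longrightarrow>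
    frechet_derivative (\<lambda>y. f y \<bullet> i) (at x) e = frechet_derivative f (at x) e \<bullet> i"
  by (subst frechet_eqI[OF bounded_linear.has_derivative[OF bounded_linear_inner_left
      frechet_has_derivative]]) auto

lemma second_derivative_symmetric:
  fixes f :: "'a::euclidean_space \<Rightarrow> 'b::euclidean_space"
  assumes "smooth_on f S" and "open S" "x \<in> S"
  shows "frechet_derivative (\<lambda>y. frechet_derivative f (at y) a) (at x) b =
    frechet_derivative (\<lambda>y. frechet_derivative f (at y) b) (at x) a"
proof (rule euclidean_eqI)
  fix i :: 'b assume "i \<in> Basis"
  have sm: "smooth_on (\<lambda>y. f y \<bullet> i) S"
    by (rule smooth_on_linear[OF \<open>open S\<close> bounded_linear_inner_left assms(1)])
  have "frechet_derivative (\<lambda>y. frechet_derivative (\<lambda>y. f y \<bullet> i) (at y) a) (at x) b =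
    frechet_derivative (\<lambda>y. frechet_derivative f (at y) a) (at x) b \<bullet> i" for a b
  proof -
    have "\<forall>\<^sub>F y in nhds x. frechet_derivative (\<lambda>y. f y \<bullet> i) (at y) a =
      frechet_derivative f (at y) a \<bullet> i"
      unfolding eventually_nhds
      using assms smooth_on_differentiable[OF assms(1)] frechet_inner by blast
    then show ?thesis
      using frechet_inner[OF smooth_on_differentiable[OF smooth_on_frechet[OF assms(1)] assms(2,3)]]
      by (simp add: frechet_eventually_eq)
  qed
  then show "frechet_derivative (\<lambda>y. frechet_derivative f (at y) a) (at x) b \<bullet> i =
    frechet_derivative (\<lambda>y. frechet_derivative f (at y) b) (at x) a \<bullet> i"
    using second_derivative_symmetric_real[of "\<lambda>y. f y \<bullet> i" S x a b] sm assms
    unfolding smooth_on_def by metis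
qed

section \<open>Tangent vectors and differentials in charts\<close>

lemma chart_inv_in: "x \<in> chart_range c \<Longrightarrow> chart_inv c x \<in> fst c"
  unfolding chart_range_def chart_inv_def by (rule inv_into_into)

lemma snd_chart_inv: "x \<in> chart_range c \<Longrightarrow> snd c (chart_inv c x) = x"
  unfolding chart_range_def chart_inv_def by (rule f_inv_into_f)

lemma snd_in_chart_range: "p \<in> fst c \<Longrightarrow> snd c p \<in> chart_range c"
  unfolding chart_range_def by simp

lemma carrier_iff: "p \<in> carrier A \<longleftrightarrow> (\<exists>c. c \<in> charts_at A p)"
  unfolding carrier_def charts_at_def by blast

lemma charts_at_iff: "c \<in> charts_at A p \<longleftrightarrow> c \<in> A \<and> p \<in> fst c"
  by (auto simp: charts_at_def)

lemma tangent_spaceI: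
  "(\<And>c d. c \<in> charts_at A p \<Longrightarrow> d \<in> charts_at A p \<Longrightarrow>
      v d = frechet_derivative (transition c d) (at (snd c p)) (v c)) \<Longrightarrow>
    (\<And>c. c \<notin> charts_at A p \<Longrightarrow> v c = 0) \<Longrightarrow> v \<in> tangent_space A p"
  unfolding tangent_space_def by blast

lemma differentiable_imp_tendsto_nhds:
  "f differentiable (at x) \<Longrightarrow> (f \<longlongrightarrow> f x) (nhds x)"
  using differentiable_imp_continuous_within[of f x UNIV]
  by (simp add: continuous_within tendsto_at_iff_tendsto_nhds)

text \<open>Pointwise conditions that carry tangent vectors and the chain rule. Three atlases are
  shown to satisfy them: that of the surface, that of its unit tangent bundle, and the linear charts
  of a tangent space.\<close>

locale diff_atlas =
  fixes A :: "('m, 'e::euclidean_space) atlas"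
  assumes chart_inj: "c \<in> A \<Longrightarrow> inj_on (snd c) (fst c)"
    and transition_domain: "c \<in> charts_at A p \<Longrightarrow> d \<in> charts_at A p \<Longrightarrow>
      \<forall>\<^sub>F x in nhds (snd c p). x \<in> chart_range c \<and> chart_inv c x \<in> fst d"
    and transition_differentiable: "c \<in> charts_at A p \<Longrightarrow> d \<in> charts_at A p \<Longrightarrow>
      transition c d differentiable (at (snd c p))"
begin

lemma chart_inv_snd: "c \<in> A \<Longrightarrow> p \<in> fst c \<Longrightarrow> chart_inv c (snd c p) = p"
  unfolding chart_inv_def using chart_inj by (simp add: inv_into_f_f)

lemma chart_inv_snd_at: "c \<in> charts_at A p \<Longrightarrow> chart_inv c (snd c p) = p"
  by (simp add: charts_at_iff chart_inv_snd)

lemma transition_apply: "c \<in> charts_at A p \<Longrightarrow> transition c d (snd c p) = snd d p"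
  by (simp add: transition_def chart_inv_snd_at)

lemma transition_eventually:
  assumes "c \<in> charts_at A p" "d \<in> charts_at A p"
  shows "\<forall>\<^sub>F x in nhds (snd c p). chart_inv d (transition c d x) = chart_inv c x"
  using transition_domain[OF assms]
  by eventually_elim (use assms in \<open>auto simp: transition_def charts_at_iff chart_inv_snd\<close>)

lemma transition_self:
  assumes "c \<in> charts_at A p"
  shows "frechet_derivative (transition c c) (at (snd c p)) = (\<lambda>e. e)"
proof -
  have "\<forall>\<^sub>F x in nhds (snd c p). transition c c x = x"
    using transition_domain[OF assms assms]
    by eventually_elim (simp add: transition_def snd_chart_inv)
  from frechet_eventually_eq[OF this] show ?thesis by simp
qed

lemma transition_cocycle:
  assumes "c \<in> charts_at A p" "d \<in> charts_at A p" "e \<in> charts_at A p"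
  shows "frechet_derivative (transition d e) (at (snd d p))
      (frechet_derivative (transition c d) (at (snd c p)) x) =
    frechet_derivative (transition c e) (at (snd c p)) x"
proof -
  have "\<forall>\<^sub>F x in nhds (snd c p). transition c e x = transition d e (transition c d x)"
    using transition_eventually[OF assms(1,2)] by eventually_elim (simp add: transition_def)
  from frechet_eventually_eq[OF this] show ?thesis
    using frechet_chain[of "transition c d" "snd c p" "transition d e"]
      transition_differentiable assms by (simp add: transition_apply)
qed

lemma linear_transition:
  "c \<in> charts_at A p \<Longrightarrow> d \<in> charts_at A p \<Longrightarrow>
    linear (frechet_derivative (transition c d) (at (snd c p)))"
  using transition_differentiable linear_frechet by blast

lemma coord_vec_tangent: "c \<in> charts_at A p \<Longrightarrow> coord_vec A c p e \<in> tangent_space A p"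
  by (rule tangent_spaceI) (simp_all add: coord_vec_def transition_cocycle)

lemma coord_vec_coord: "c \<in> charts_at A p \<Longrightarrow> coord_vec A c p e c = e"
  by (simp add: coord_vec_def transition_self)

lemma tangent_transition:
  "v \<in> tangent_space A p \<Longrightarrow> c \<in> charts_at A p \<Longrightarrow> d \<in> charts_at A p \<Longrightarrow>
    v d = frechet_derivative (transition c d) (at (snd c p)) (v c)"
  unfolding tangent_space_def by blast

lemma tangent_outside: "v \<in> tangent_space A p \<Longrightarrow> c \<notin> charts_at A p \<Longrightarrow> v c = 0"
  unfolding tangent_space_def by blast

lemma tangent_eq_coord_vec:
  "v \<in> tangent_space A p \<Longrightarrow> c \<in> charts_at A p \<Longrightarrow> v = coord_vec A c p (v c)"
  by (rule ext) (metis coord_vec_def tangent_transition tangent_outside)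

lemma tangent_eqI:
  "v \<in> tangent_space A p \<Longrightarrow> w \<in> tangent_space A p \<Longrightarrow> c \<in> charts_at A p \<Longrightarrow> v c = w c \<Longrightarrow> v = w"
  by (metis tangent_eq_coord_vec)

lemma tangent_vcomb:
  assumes "v \<in> tangent_space A p" "w \<in> tangent_space A p"
  shows "vcomb a v b w \<in> tangent_space A p"
proof -
  have "vcomb a v b w d = frechet_derivative (transition c d) (at (snd c p)) (vcomb a v b w c)"
    if "c \<in> charts_at A p" "d \<in> charts_at A p" for c d
    using tangent_transition[OF assms(1) that] tangent_transition[OF assms(2) that]
    by (simp add: vcomb_def linear_add[OF linear_transition[OF that]]
        linear_cmul[OF linear_transition[OF that]])
  moreover have "vcomb a v b w c = 0" if "c \<notin> charts_at A p" for c
    using assms that by (simp add: vcomb_def tangent_outside)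
  ultimately show ?thesis unfolding tangent_space_def by blast
qed

lemma tangent_zero: "(\<lambda>_. 0) \<in> tangent_space A p"
  unfolding tangent_space_def using linear_0[OF linear_transition] by auto

lemma coord_vec_vcomb:
  "c \<in> charts_at A p \<Longrightarrow>
    coord_vec A c p (a *\<^sub>R x + b *\<^sub>R y) = vcomb a (coord_vec A c p x) b (coord_vec A c p y)"
  by (auto simp: coord_vec_def vcomb_def linear_add[OF linear_transition]
    linear_cmul[OF linear_transition])

lemma function_coord_change:
  fixes f :: "'m \<Rightarrow> 'b::real_normed_vector"
  assumes "c \<in> charts_at A p" "d \<in> charts_at A p" "(f \<circ> chart_inv d) differentiable (at (snd d p))"
  shows "(f \<circ> chart_inv c) differentiable (at (snd c p))"
    and "frechet_derivative (f \<circ> chart_inv c) (at (snd c p)) e =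
      frechet_derivative (f \<circ> chart_inv d) (at (snd d p))
        (frechet_derivative (transition c d) (at (snd c p)) e)"
proof -
  have ev: "\<forall>\<^sub>F x in nhds (snd c p). (f \<circ> chart_inv c) x = (f \<circ> chart_inv d) (transition c d x)"
    using transition_eventually[OF assms(1,2)] by eventually_elim simp
  note 1 = transition_differentiable[OF assms(1,2)]
  have 2: "(f \<circ> chart_inv d) differentiable (at (transition c d (snd c p)))"
    using assms by (simp add: transition_apply)
  show "(f \<circ> chart_inv c) differentiable (at (snd c p))"
    by (rule differentiable_eventually_eq[OF differentiable_chain[OF 1 2] ev])
  show "frechet_derivative (f \<circ> chart_inv c) (at (snd c p)) e =
      frechet_derivative (f \<circ> chart_inv d) (at (snd d p))
        (frechet_derivative (transition c d) (at (snd c p)) e)"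
    using frechet_eventually_eq[OF ev] frechet_chain[OF 1 2] assms
    by (simp add: transition_apply comp_def)
qed

text \<open>\<open>dir_deriv\<close> works in an arbitrarily chosen chart. Passing to
  \<open>c\<close> inserts the derivative of the transition map, which is exactly what turns the
  components of \<open>v\<close> in the chosen chart into those in \<open>c\<close>.\<close>

lemma dir_deriv_coord:
  assumes "v \<in> tangent_space A p" "c \<in> charts_at A p"
    "(f \<circ> chart_inv c) differentiable (at (snd c p))"
  shows "dir_deriv A f p v = frechet_derivative (f \<circ> chart_inv c) (at (snd c p)) (v c)"
proof -
  define c' where "c' = (SOME c. c \<in> charts_at A p)"
  have c': "c' \<in> charts_at A p" using assms(2) unfolding c'_def by (rule someI)
  show ?thesis
    unfolding dir_deriv_def Let_def c'_def[symmetric]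
    using function_coord_change(2)[OF c' assms(2,3)] tangent_transition[OF assms(1) c' assms(2)]
    by simp
qed

end

text \<open>The neighbourhood condition stands for continuity at \<open>p\<close>, expressed in
  coordinates, so that no manifold topology is involved.\<close>

definition diff_at ::
  "('m, 'e::euclidean_space) atlas \<Rightarrow> ('n, 'f::euclidean_space) atlas \<Rightarrow> ('m \<Rightarrow> 'n) \<Rightarrow> 'm \<Rightarrow> bool" where
  "diff_at A B f p \<longleftrightarrow> p \<in> carrier A \<and> f p \<in> carrier B \<and>
     (\<forall>c\<in>charts_at A p. \<forall>d\<in>charts_at B (f p).
        (\<forall>\<^sub>F x in nhds (snd c p). x \<in> chart_range c \<and> f (chart_inv c x) \<in> fst d) \<and>
        (snd d \<circ> f \<circ> chart_inv c) differentiable (at (snd c p)))"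

lemma differential_coord:
  assumes "diff_atlas A" "diff_at A B f p" "v \<in> tangent_space A p"
    "c \<in> charts_at A p" "d \<in> charts_at B (f p)"
  shows "differential A B f p v d =
    frechet_derivative (snd d \<circ> f \<circ> chart_inv c) (at (snd c p)) (v c)"
  unfolding differential_def
  using diff_atlas.dir_deriv_coord[OF assms(1,3,4), of "snd d \<circ> f"] assms(2,4,5)
  by (auto simp: diff_at_def)

lemma differential_tangent:
  assumes "diff_atlas A" "diff_atlas B" "diff_at A B f p" "v \<in> tangent_space A p"
  shows "differential A B f p v \<in> tangent_space B (f p)"
proof -
  interpret B: diff_atlas B by fact
  interpret A: diff_atlas A by fact
  obtain c where c: "c \<in> charts_at A p" using assms(3) by (auto simp: diff_at_def carrier_iff)
  have *: "differential A B f p v d' =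
      frechet_derivative (transition d d') (at (snd d (f p))) (differential A B f p v d)"
    if d: "d \<in> charts_at B (f p)" and d': "d' \<in> charts_at B (f p)" for d d'
  proof -
    have fc: "\<forall>\<^sub>F x in nhds (snd c p). x \<in> chart_range c \<and> f (chart_inv c x) \<in> fst d"
      "(snd d \<circ> f \<circ> chart_inv c) differentiable (at (snd c p))"
      using assms(3) c d by (auto simp: diff_at_def)
    have ev: "\<forall>\<^sub>F x in nhds (snd c p). (snd d' \<circ> f \<circ> chart_inv c) x =
        transition d d' ((snd d \<circ> f \<circ> chart_inv c) x)"
      using fc(1) by eventually_elim (use d in \<open>auto simp: transition_def charts_at_iff
        B.chart_inv_snd\<close>)
    have e: "(snd d \<circ> f \<circ> chart_inv c) (snd c p) = snd d (f p)"
      using c by (simp add: A.chart_inv_snd_at)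
    have t: "transition d d' differentiable (at ((snd d \<circ> f \<circ> chart_inv c) (snd c p)))"
      using B.transition_differentiable[OF d d'] e by simp
    show ?thesis
      using differential_coord[OF assms(1,3,4) c d] differential_coord[OF assms(1,3,4) c d']
        frechet_eventually_eq[OF ev] frechet_chain[OF fc(2) t] e by (simp add: comp_def)
  qed
  show ?thesis by (rule tangent_spaceI[OF *]) (simp_all add: differential_def)
qed

lemma differential_vcomb:
  assumes "diff_atlas A" "diff_at A B f p" "v \<in> tangent_space A p" "w \<in> tangent_space A p"
  shows "differential A B f p (vcomb a v b w) =
    vcomb a (differential A B f p v) b (differential A B f p w)"
proof
  interpret A: diff_atlas A by fact
  fix d
  obtain c where c: "c \<in> charts_at A p" using assms(2) by (auto simp: diff_at_def carrier_iff)
  show "differential A B f p (vcomb a v b w) d =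
    vcomb a (differential A B f p v) b (differential A B f p w) d"
  proof (cases "d \<in> charts_at B (f p)")
    case True
    then have "linear (frechet_derivative (snd d \<circ> f \<circ> chart_inv c) (at (snd c p)))"
      using assms(2) c by (auto simp: diff_at_def intro: linear_frechet)
    then show ?thesis
      using differential_coord[OF assms(1,2) _ c True] assms A.tangent_vcomb
      by (simp add: vcomb_def linear_add linear_cmul)
  next
    case False
    then show ?thesis by (simp add: differential_def vcomb_def)
  qed
qed

lemma diff_at_compose:
  assumes "diff_atlas A" "diff_atlas B" "diff_at A B f p" "diff_at B C h (f p)"
  shows "diff_at A C (\<lambda>q. h (f q)) p"
    and "v \<in> tangent_space A p \<Longrightarrow> differential A C (\<lambda>q. h (f q)) p v =
      differential B C h (f p) (differential A B f p v)"
proof -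
  interpret A: diff_atlas A by fact
  interpret B: diff_atlas B by fact
  obtain d where d: "d \<in> charts_at B (f p)" using assms(3) by (auto simp: diff_at_def carrier_iff)
  have main: "(\<forall>\<^sub>F x in nhds (snd c p). x \<in> chart_range c \<and> h (f (chart_inv c x)) \<in> fst e) \<and>
     ((snd e \<circ> h \<circ> chart_inv d) \<circ> (snd d \<circ> f \<circ> chart_inv c)) differentiable (at (snd c p)) \<and>
     (\<forall>\<^sub>F x in nhds (snd c p). (snd e \<circ> (\<lambda>q. h (f q)) \<circ> chart_inv c) x =
        ((snd e \<circ> h \<circ> chart_inv d) \<circ> (snd d \<circ> f \<circ> chart_inv c)) x) \<and>
     (\<forall>v. frechet_derivative ((snd e \<circ> h \<circ> chart_inv d) \<circ> (snd d \<circ> f \<circ> chart_inv c))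
       (at (snd c p)) v =
       frechet_derivative (snd e \<circ> h \<circ> chart_inv d) (at (snd d (f p)))
        (frechet_derivative (snd d \<circ> f \<circ> chart_inv c) (at (snd c p)) v))"
    if c: "c \<in> charts_at A p" and e: "e \<in> charts_at C (h (f p))" for c e
  proof -
    let ?F = "snd d \<circ> f \<circ> chart_inv c" and ?H = "snd e \<circ> h \<circ> chart_inv d"
    have F: "\<forall>\<^sub>F x in nhds (snd c p). x \<in> chart_range c \<and> f (chart_inv c x) \<in> fst d"
      "?F differentiable (at (snd c p))"
      using assms(3) c d by (auto simp: diff_at_def)
    have F0: "?F (snd c p) = snd d (f p)" using c by (simp add: A.chart_inv_snd_at)
    have H: "\<forall>\<^sub>F y in nhds (?F (snd c p)). y \<in> chart_range d \<and> h (chart_inv d y) \<in> fst e"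
      "?H differentiable (at (?F (snd c p)))"
      using assms(4) d e unfolding F0 by (auto simp: diff_at_def)
    \<comment> \<open>Continuity of \<open>?F\<close> pulls the neighbourhood on which
      \<open>h\<close> is controlled back to one around \<open>snd c p\<close>.\<close>
    have "(?F \<longlongrightarrow> ?F (snd c p)) (nhds (snd c p))"
      by (rule differentiable_imp_tendsto_nhds[OF F(2)])
    from eventually_compose_filterlim[OF H(1) this]
    have ev: "\<forall>\<^sub>F x in nhds (snd c p). ?F x \<in> chart_range d \<and> h (chart_inv d (?F x)) \<in> fst e" .
    have inv: "\<forall>\<^sub>F x in nhds (snd c p). chart_inv d (?F x) = f (chart_inv c x)"
      using F(1) by eventually_elim (use d in \<open>auto simp: charts_at_iff B.chart_inv_snd\<close>)
    have "\<forall>\<^sub>F x in nhds (snd c p). x \<in> chart_range c \<and> h (f (chart_inv c x)) \<in> fst e"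
      using ev inv F(1) by eventually_elim auto
    moreover have "\<forall>\<^sub>F x in nhds (snd c p). (snd e \<circ> (\<lambda>q. h (f q)) \<circ> chart_inv c) x = (?H \<circ> ?F) x"
      using inv by eventually_elim simp
    moreover have "(?H \<circ> ?F) differentiable (at (snd c p))"
      using differentiable_chain[OF F(2) H(2)] by (simp add: o_def)
    moreover have "frechet_derivative (?H \<circ> ?F) (at (snd c p)) v =
       frechet_derivative ?H (at (snd d (f p))) (frechet_derivative ?F (at (snd c p)) v)" for v
      using frechet_chain[OF F(2) H(2)] F0 by (simp add: o_def)
    ultimately show ?thesis by blast
  qed
  show dc: "diff_at A C (\<lambda>q. h (f q)) p"
    unfolding diff_at_def
  proof (intro conjI ballI)
    fix c e assume ce: "c \<in> charts_at A p" "e \<in> charts_at C (h (f p))"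
    show "\<forall>\<^sub>F x in nhds (snd c p). x \<in> chart_range c \<and> h (f (chart_inv c x)) \<in> fst e"
      using main[OF ce] by blast
    show "(snd e \<circ> (\<lambda>q. h (f q)) \<circ> chart_inv c) differentiable (at (snd c p))"
      by (rule differentiable_eventually_eq) (use main[OF ce] in blast)+
  qed (use assms(3,4) in \<open>auto simp: diff_at_def\<close>)
  assume v: "v \<in> tangent_space A p"
  obtain c where c: "c \<in> charts_at A p" using assms(3) by (auto simp: diff_at_def carrier_iff)
  show "differential A C (\<lambda>q. h (f q)) p v = differential B C h (f p) (differential A B f p v)"
  proof
    fix e
    show "differential A C (\<lambda>q. h (f q)) p v e = differential B C h (f p) (differential A B f p v)
      e"
    proof (cases "e \<in> charts_at C (h (f p))")
      case True
      have eq: "frechet_derivative (snd e \<circ> (\<lambda>q. h (f q)) \<circ> chart_inv c) (at (snd c p)) =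
          frechet_derivative ((snd e \<circ> h \<circ> chart_inv d) \<circ> (snd d \<circ> f \<circ> chart_inv c)) (at (snd c p))"
        using main[OF c True] by (intro frechet_eventually_eq) blast
      show ?thesis
        using differential_coord[OF assms(1) dc v c True] differential_coord[OF assms(1,3) v c d]
          differential_coord[OF assms(2,4) differential_tangent[OF assms(1,2,3) v] d True]
          main[OF c True] eq by simp
    next
      case False
      then show ?thesis by (simp add: differential_def)
    qed
  qed
qed

lemma diff_at_cong:
  fixes A :: "('m, 'e::euclidean_space) atlas" and B :: "('n, 'f::euclidean_space) atlas"
  assumes "diff_atlas A" "diff_at A B f p" "\<And>q. q \<in> carrier A \<Longrightarrow> g q = f q"
  shows "diff_at A B g p"
    and "v \<in> tangent_space A p \<Longrightarrow> differential A B g p v = differential A B f p v"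
proof -
  interpret A: diff_atlas A by fact
  have gp: "g p = f p" using assms(2,3) by (auto simp: diff_at_def)
  have ev: "\<forall>\<^sub>F x in nhds (snd c p). g (chart_inv c x) = f (chart_inv c x)" if "c \<in> charts_at A p"
    for c
    using A.transition_domain[OF that that]
  proof eventually_elim
    case (elim x)
    with that have "chart_inv c x \<in> carrier A" by (auto simp: carrier_def charts_at_iff)
    then show ?case by (rule assms(3))
  qed
  have ev': "\<forall>\<^sub>F x in nhds (snd c p). (snd d \<circ> g \<circ> chart_inv c) x = (snd d \<circ> f \<circ> chart_inv c) x"
    if "c \<in> charts_at A p" for c and d :: "('n, 'f) chart"
    using ev[OF that] by eventually_elim simp
  have "(\<forall>\<^sub>F x in nhds (snd c p). x \<in> chart_range c \<and> g (chart_inv c x) \<in> fst d) \<and>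
      (snd d \<circ> g \<circ> chart_inv c) differentiable (at (snd c p))"
    if c: "c \<in> charts_at A p" and d: "d \<in> charts_at B (g p)" for c d
  proof
    from assms(2) c d have f: "\<forall>\<^sub>F x in nhds (snd c p). x \<in> chart_range c \<and>
      f (chart_inv c x) \<in> fst d"
      "(snd d \<circ> f \<circ> chart_inv c) differentiable (at (snd c p))"
      by (auto simp: diff_at_def gp)
    show "\<forall>\<^sub>F x in nhds (snd c p). x \<in> chart_range c \<and> g (chart_inv c x) \<in> fst d"
      using ev[OF c] f(1) by eventually_elim simp
    show "(snd d \<circ> g \<circ> chart_inv c) differentiable (at (snd c p))"
      by (rule differentiable_eventually_eq[OF f(2) ev'[OF c]])
  qed
  then show d: "diff_at A B g p" using assms(2) by (auto simp: diff_at_def gp)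
  assume v: "v \<in> tangent_space A p"
  obtain c where c: "c \<in> charts_at A p" using assms(2) by (auto simp: diff_at_def carrier_iff)
  show "differential A B g p v = differential A B f p v"
  proof
    fix e
    show "differential A B g p v e = differential A B f p v e"
    proof (cases "e \<in> charts_at B (f p)")
      case True
      have eq: "frechet_derivative (snd e \<circ> g \<circ> chart_inv c) (at (snd c p)) =
          frechet_derivative (snd e \<circ> f \<circ> chart_inv c) (at (snd c p))"
        by (rule frechet_eventually_eq[OF ev'[OF c]])
      show ?thesis
        using differential_coord[OF assms(1) d v c] differential_coord[OF assms(1,2) v c] True eq gp
        by simp
    next
      case False
      then show ?thesis by (simp add: differential_def gp)
    qed
  qed
qed

lemma (in diff_atlas) diff_at_id: "p \<in> carrier A \<Longrightarrow> diff_at A A (\<lambda>q. q) p"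
  using transition_domain transition_differentiable
  by (auto simp: diff_at_def transition_def comp_def)

lemma (in diff_atlas) differential_id:
  assumes "v \<in> tangent_space A p" "p \<in> carrier A"
  shows "differential A A (\<lambda>q. q) p v = v"
proof -
  obtain c where c: "c \<in> charts_at A p" using assms by (auto simp: carrier_iff)
  have *: "snd c \<circ> (\<lambda>q. q) \<circ> chart_inv c = transition c c" by (auto simp: transition_def)
  have "differential A A (\<lambda>q. q) p v c = v c"
    using differential_coord[OF diff_atlas_axioms diff_at_id[OF assms(2)] assms(1) c c]
    by (simp add: transition_self[OF c] *)
  then show ?thesis
    using tangent_eqI[OF differential_tangent[OF diff_atlas_axioms diff_atlas_axioms
      diff_at_id[OF assms(2)] assms(1)] assms(1) c] by simp
qed

section \<open>Curves, velocities and covectors in charts\<close>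

definition diff_curve :: "('m, 'e::euclidean_space) atlas \<Rightarrow> (real \<Rightarrow> 'm) \<Rightarrow> real \<Rightarrow> bool" where
  "diff_curve A \<gamma> t \<longleftrightarrow> \<gamma> t \<in> carrier A \<and>
     (\<forall>c\<in>charts_at A (\<gamma> t). (\<forall>\<^sub>F s in nhds t. \<gamma> s \<in> fst c) \<and> (snd c \<circ> \<gamma>) differentiable (at t))"

lemma vector_derivative_chain_frechet:
  fixes g :: "real \<Rightarrow> 'a::real_normed_vector"
  assumes "g differentiable (at t)" "f differentiable (at (g t))"
  shows "((\<lambda>s. f (g s)) has_vector_derivative
     frechet_derivative f (at (g t)) (vector_derivative g (at t))) (at t)"
proof -
  have "(g has_derivative (\<lambda>h. h *\<^sub>R vector_derivative g (at t))) (at t)"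
    using assms(1) by (simp add: vector_derivative_works has_vector_derivative_def)
  from has_derivative_compose[OF this frechet_has_derivative[OF assms(2)]]
  show ?thesis
    using linear_frechet[OF assms(2)] by (simp add: has_vector_derivative_def linear_cmul)
qed

lemma has_vector_derivative_eventually_eq:
  "(f has_vector_derivative D) (at x) \<Longrightarrow> \<forall>\<^sub>F y in nhds x. g y = f y \<Longrightarrow>
    (g has_vector_derivative D) (at x)"
  unfolding has_vector_derivative_def by (rule has_derivative_eventually_eq)

lemma velocity_tangent:
  assumes "diff_atlas A" "diff_curve A \<gamma> t"
  shows "velocity A \<gamma> t \<in> tangent_space A (\<gamma> t)"
proof -
  interpret diff_atlas A by fact
  have *: "vector_derivative (snd d \<circ> \<gamma>) (at t) =
    frechet_derivative (transition c d) (at (snd c (\<gamma> t)))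
      (vector_derivative (snd c \<circ> \<gamma>) (at t))"
    if c: "c \<in> charts_at A (\<gamma> t)" and d: "d \<in> charts_at A (\<gamma> t)" for c d
  proof (rule vector_derivative_at)
    have "((\<lambda>s. transition c d ((snd c \<circ> \<gamma>) s)) has_vector_derivative
        frechet_derivative (transition c d) (at ((snd c \<circ> \<gamma>) t)) (vector_derivative (snd c \<circ> \<gamma>)
          (at t))) (at t)"
    proof (rule vector_derivative_chain_frechet)
      show "(snd c \<circ> \<gamma>) differentiable (at t)"
        using assms(2) c unfolding diff_curve_def by blast
      show "transition c d differentiable (at ((snd c \<circ> \<gamma>) t))"
        using transition_differentiable[OF c d] by simp
    qed
    moreover have "\<forall>\<^sub>F s in nhds t. (snd d \<circ> \<gamma>) s = transition c d ((snd c \<circ> \<gamma>) s)"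
    proof -
      have "\<forall>\<^sub>F s in nhds t. \<gamma> s \<in> fst c" using assms(2) c by (auto simp: diff_curve_def)
      then show ?thesis
        by eventually_elim (use c in \<open>auto simp: transition_def charts_at_iff chart_inv_snd\<close>)
    qed
    ultimately show "((snd d \<circ> \<gamma>) has_vector_derivative frechet_derivative (transition c d)
        (at (snd c (\<gamma> t))) (vector_derivative (snd c \<circ> \<gamma>) (at t))) (at t)"
      using has_vector_derivative_eventually_eq by fastforce
  qed
  show ?thesis
  proof (rule tangent_spaceI)
    fix c d assume "c \<in> charts_at A (\<gamma> t)" "d \<in> charts_at A (\<gamma> t)"
    from *[OF this] this
    show "velocity A \<gamma> t d =
        frechet_derivative (transition c d) (at (snd c (\<gamma> t))) (velocity A \<gamma> t c)"
      by (simp only: velocity_def if_True)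
  qed (simp add: velocity_def)
qed

lemma velocity_compose:
  assumes "diff_atlas A" "diff_curve A \<gamma> t" "diff_at A B f (\<gamma> t)"
  shows "velocity B (\<lambda>s. f (\<gamma> s)) t = differential A B f (\<gamma> t) (velocity A \<gamma> t)"
proof
  interpret diff_atlas A by fact
  fix d
  obtain c where c: "c \<in> charts_at A (\<gamma> t)" using assms(2)
    by (auto simp: diff_curve_def carrier_iff)
  show "velocity B (\<lambda>s. f (\<gamma> s)) t d = differential A B f (\<gamma> t) (velocity A \<gamma> t) d"
  proof (cases "d \<in> charts_at B (f (\<gamma> t))")
    case True
    let ?F = "snd d \<circ> f \<circ> chart_inv c"
    have "((\<lambda>s. ?F ((snd c \<circ> \<gamma>) s)) has_vector_derivative
       frechet_derivative ?F (at ((snd c \<circ> \<gamma>) t)) (vector_derivative (snd c \<circ> \<gamma>) (at t))) (at t)"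
    proof (rule vector_derivative_chain_frechet)
      show "(snd c \<circ> \<gamma>) differentiable (at t)"
        using assms(2) c unfolding diff_curve_def by blast
      have "?F differentiable (at (snd c (\<gamma> t)))"
        using assms(3) c True unfolding diff_at_def by blast
      then show "?F differentiable (at ((snd c \<circ> \<gamma>) t))" by simp
    qed
    moreover have "\<forall>\<^sub>F s in nhds t. (snd d \<circ> (\<lambda>s. f (\<gamma> s))) s = ?F ((snd c \<circ> \<gamma>) s)"
    proof -
      have "\<forall>\<^sub>F s in nhds t. \<gamma> s \<in> fst c" using assms(2) c by (auto simp: diff_curve_def)
      then show ?thesis
        by eventually_elim (use c in \<open>auto simp: charts_at_iff chart_inv_snd\<close>)
    qed
    ultimately have "((snd d \<circ> (\<lambda>s. f (\<gamma> s))) has_vector_derivative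
       frechet_derivative ?F (at ((snd c \<circ> \<gamma>) t)) (vector_derivative (snd c \<circ> \<gamma>) (at t))) (at t)"
      by (rule has_vector_derivative_eventually_eq)
    then show ?thesis
      using differential_coord[OF assms(1,3) velocity_tangent[OF assms(1,2)] c True] True c
      by (simp add: velocity_def vector_derivative_at)
  next
    case False
    then show ?thesis by (simp add: velocity_def differential_def)
  qed
qed

text \<open>A covector becomes a linear form on the model space. Continuity, derivatives and
  smoothness of a coordinate curve of tangent vectors at \<open>p\<close> pass through this form to
  the pairing with the covector.\<close>

lemma (in diff_atlas) cotangent_coord:
  assumes "\<xi> \<in> cotangent_space A p" "c \<in> charts_at A p"
  shows "linear (\<lambda>e. \<xi> (coord_vec A c p e))"
    and "v \<in> tangent_space A p \<Longrightarrow> \<xi> v = \<xi> (coord_vec A c p (v c))"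
proof -
  have comb: "\<xi> (coord_vec A c p (a *\<^sub>R x + b *\<^sub>R y)) =
      a * \<xi> (coord_vec A c p x) + b * \<xi> (coord_vec A c p y)" for a b x y
    using assms by (simp add: coord_vec_vcomb cotangent_space_def coord_vec_tangent)
  show "linear (\<lambda>e. \<xi> (coord_vec A c p e))"
  proof (rule linearI)
    show "\<xi> (coord_vec A c p (x + y)) = \<xi> (coord_vec A c p x) + \<xi> (coord_vec A c p y)" for x y
      using comb[of 1 x 1 y] by simp
    show "\<xi> (coord_vec A c p (r *\<^sub>R x)) = r *\<^sub>R \<xi> (coord_vec A c p x)" for r x
      using comb[of r x 0 0] by simp
  qed
  show "\<xi> v = \<xi> (coord_vec A c p (v c))" if "v \<in> tangent_space A p"
    using tangent_eq_coord_vec[OF that assms(2)] by simp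
qed

section \<open>Riemannian surfaces in coordinates\<close>

lemma smooth_atlas_diff_atlas:
  assumes "smooth_atlas A"
  shows "diff_atlas A"
proof
  fix c assume "c \<in> A"
  then show "inj_on (snd c) (fst c)" using assms by (auto simp: smooth_atlas_def)
next
  fix p c d assume c: "c \<in> charts_at A p" and d: "d \<in> charts_at A p"
  let ?S = "snd c ` (fst c \<inter> fst d)"
  have S: "open ?S" "smooth_on (transition c d) ?S" "inj_on (snd c) (fst c)"
    using assms c d by (auto simp: smooth_atlas_def charts_at_def)
  have p: "snd c p \<in> ?S" using c d by (auto simp: charts_at_def)
  show "transition c d differentiable (at (snd c p))"
    by (rule smooth_on_differentiable[OF S(2,1) p])
  have "x \<in> chart_range c \<and> chart_inv c x \<in> fst d" if "x \<in> ?S" for x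
    using that S(3) by (auto simp: chart_range_def chart_inv_def inv_into_f_f)
  then show "\<forall>\<^sub>F x in nhds (snd c p). x \<in> chart_range c \<and> chart_inv c x \<in> fst d"
    unfolding eventually_nhds using S(1) p by blast
qed

lemma charts_at_carrier: "c \<in> charts_at A p \<Longrightarrow> p \<in> carrier A"
  unfolding carrier_def charts_at_def by blast

lemma vec2_eqI: "x $ 1 = y $ 1 \<Longrightarrow> x $ 2 = y $ 2 \<Longrightarrow> x = (y::'a^2)"
  by (simp add: vec_eq_iff forall_2)

lemma differentiable_sqrt:
  "f differentiable (at x) \<Longrightarrow> 0 < f x \<Longrightarrow> (\<lambda>x. sqrt (f x)) differentiable (at x)"
  by (rule differentiable_chain[of f x sqrt])
    (auto simp: real_differentiable_def intro!: exI DERIV_real_sqrt)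

lemma differentiable_arcsin:
  "f differentiable (at x) \<Longrightarrow> - 1 < f x \<Longrightarrow> f x < 1 \<Longrightarrow> (\<lambda>x. arcsin (f x)) differentiable (at x)"
  by (rule differentiable_chain[of f x arcsin])
    (auto simp: real_differentiable_def intro!: exI DERIV_arcsin)

lemma differentiable_vec_nth: "f differentiable (at x) \<Longrightarrow> (\<lambda>x. f x $ i) differentiable (at x)"
  by (rule differentiable_chain[of f x "\<lambda>y. y $ i"])
    (auto intro: bounded_linear_imp_differentiable bounded_linear_vec_nth)

lemma differentiable_fst: "f differentiable (at x) \<Longrightarrow> (\<lambda>x. fst (f x)) differentiable (at x)"
  by (rule differentiable_chain[of f x fst])
    (auto intro: bounded_linear_imp_differentiable bounded_linear_fst)

lemma differentiable_snd: "f differentiable (at x) \<Longrightarrow> (\<lambda>x. snd (f x)) differentiable (at x)"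
  by (rule differentiable_chain[of f x snd])
    (auto intro: bounded_linear_imp_differentiable bounded_linear_snd)

lemma differentiable_cos: "f differentiable (at x) \<Longrightarrow> (\<lambda>x. cos (f x)) differentiable (at x)"
  for f :: "'a::real_normed_vector \<Rightarrow> real"
  by (rule differentiable_chain[of f x cos]) (auto simp: real_differentiable_def intro!: exI
    DERIV_cos)

lemma differentiable_sin: "f differentiable (at x) \<Longrightarrow> (\<lambda>x. sin (f x)) differentiable (at x)"
  for f :: "'a::real_normed_vector \<Rightarrow> real"
  by (rule differentiable_chain[of f x sin]) (auto simp: real_differentiable_def intro!: exI
    DERIV_sin)

lemma differentiable_vector2:
  assumes "f differentiable (at x)" "h differentiable (at x)"
  shows "(\<lambda>x. vector [f x, h x] :: real^2) differentiable (at x)"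
proof -
  have "vector [f x, h x] = f x *\<^sub>R axis 1 1 + h x *\<^sub>R (axis 2 1 :: real^2)" for x
    by (rule vec2_eqI) (simp_all add: axis_def)
  then show ?thesis
    using assms by (simp add: differentiable_add differentiable_scaleR)
qed

locale surface =
  fixes A :: "('m, real^2) atlas" and g :: "'m metric"
  assumes closed_oriented: "closed_oriented_surface A"
    and metric: "riemannian_metric A g"
begin

lemma smooth_A: "smooth_atlas A"
  using closed_oriented by (simp add: closed_oriented_surface_def smooth_manifold_def)

sublocale diff_atlas A
  by (rule smooth_atlas_diff_atlas[OF smooth_A])

lemma open_chart_range: "c \<in> A \<Longrightarrow> open (chart_range c)"
  using smooth_A by (auto simp: smooth_atlas_def)

lemma chart_inv_charts_at: "c \<in> A \<Longrightarrow> x \<in> chart_range c \<Longrightarrow> c \<in> charts_at A (chart_inv c x)"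
  by (simp add: charts_at_iff chart_inv_in)

lemma metric_sym: "p \<in> carrier A \<Longrightarrow> u \<in> tangent_space A p \<Longrightarrow> v \<in> tangent_space A p \<Longrightarrow> g p u v =
  g p v u"
  using metric unfolding riemannian_metric_def by blast

lemma metric_vcomb: "p \<in> carrier A \<Longrightarrow> u \<in> tangent_space A p \<Longrightarrow> v \<in> tangent_space A p \<Longrightarrow>
    w \<in> tangent_space A p \<Longrightarrow> g p (vcomb a u b v) w = a * g p u w + b * g p v w"
  using metric unfolding riemannian_metric_def by blast

lemma metric_pos: "p \<in> carrier A \<Longrightarrow> v \<in> tangent_space A p \<Longrightarrow> v \<noteq> (\<lambda>_. 0) \<Longrightarrow> 0 < g p v v"
  using metric unfolding riemannian_metric_def by blast

section \<open>The first fundamental form and the rotation in a chart\<close>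

definition gE where "gE c x = metric_matrix A g c x $ 1 $ 1"
definition gF where "gF c x = metric_matrix A g c x $ 1 $ 2"
definition gG where "gG c x = metric_matrix A g c x $ 2 $ 2"
definition gD where "gD c x = gE c x * gG c x - gF c x * gF c x"

definition ip :: "('m, real^2) chart \<Rightarrow> real^2 \<Rightarrow> real^2 \<Rightarrow> real^2 \<Rightarrow> real" where
  "ip c x y z = gE c x * y $ 1 * z $ 1 + gF c x * (y $ 1 * z $ 2 + y $ 2 * z $ 1) + gG c x * y $ 2
    * z $ 2"

lemma ip_sym: "ip c x y z = ip c x z y"
  by (simp add: ip_def algebra_simps)

lemma ip_add_left: "ip c x (y + y') z = ip c x y z + ip c x y' z"
  by (simp add: ip_def algebra_simps)

lemma ip_scale_left: "ip c x (r *\<^sub>R y) z = r * ip c x y z"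
  by (simp add: ip_def algebra_simps)

lemma ip_add_right: "ip c x z (y + y') = ip c x z y + ip c x z y'"
  by (simp add: ip_def algebra_simps)

lemma ip_scale_right: "ip c x z (r *\<^sub>R y) = r * ip c x z y"
  by (simp add: ip_def algebra_simps)

lemma metric_matrix_sym:
  assumes "c \<in> A" "x \<in> chart_range c"
  shows "metric_matrix A g c x $ i $ j = metric_matrix A g c x $ j $ i"
proof -
  have "chart_inv c x \<in> carrier A" using chart_inv_charts_at[OF assms] by (rule charts_at_carrier)
  then show ?thesis
    by (simp only: metric_matrix_def Let_def vec_lambda_beta)
       (intro metric_sym coord_vec_tangent chart_inv_charts_at assms)
qed

lemma metric_coord_vec:
  assumes "c \<in> A" "x \<in> chart_range c"
  shows "g (chart_inv c x) (coord_vec A c (chart_inv c x) y) (coord_vec A c (chart_inv c x) z) =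
    ip c x y z"
proof -
  let ?p = "chart_inv c x"
  let ?k = "\<lambda>i. coord_vec A c ?p (axis i 1)"
  have c: "c \<in> charts_at A ?p" by (rule chart_inv_charts_at[OF assms])
  have p: "?p \<in> carrier A" using c by (rule charts_at_carrier)
  have dec: "coord_vec A c ?p y = vcomb (y $ 1) (?k 1) (y $ 2) (?k 2)" for y
  proof -
    have "y = (y $ 1) *\<^sub>R axis 1 1 + (y $ 2) *\<^sub>R (axis 2 1 :: real^2)"
      by (rule vec2_eqI) (simp_all add: axis_def)
    then show ?thesis using coord_vec_vcomb[OF c] by metis
  qed
  note t = coord_vec_tangent[OF c]
  have left: "g ?p (coord_vec A c ?p y) w = y $ 1 * g ?p (?k 1) w + y $ 2 * g ?p (?k 2) w"
    if "w \<in> tangent_space A ?p" for y w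
    unfolding dec[of y] by (rule metric_vcomb[OF p t t that])
  \<comment> \<open>Linearity is given in the first argument only; symmetry moves \<open>z\<close>
    there for the second expansion.\<close>
  have "g ?p (coord_vec A c ?p y) (coord_vec A c ?p z) =
      y $ 1 * g ?p (coord_vec A c ?p z) (?k 1) + y $ 2 * g ?p (coord_vec A c ?p z) (?k 2)"
    by (simp only: left[OF t, of y z] metric_sym[OF p t[of z] t[of "axis 1 1"]]
        metric_sym[OF p t[of z] t[of "axis 2 1"]])
  also have "\<dots> = y $ 1 * (z $ 1 * g ?p (?k 1) (?k 1) + z $ 2 * g ?p (?k 2) (?k 1)) +
      y $ 2 * (z $ 1 * g ?p (?k 1) (?k 2) + z $ 2 * g ?p (?k 2) (?k 2))"
    by (simp only: left[OF t[of "axis 1 1"], of z] left[OF t[of "axis 2 1"], of z])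
  also have "\<dots> = ip c x y z"
    using metric_sym[OF p t[of "axis 2 1"] t[of "axis 1 1"]]
    by (simp add: ip_def gE_def gF_def gG_def metric_matrix_def Let_def algebra_simps)
  finally show ?thesis .
qed

lemma metric_coord:
  assumes "c \<in> charts_at A p" "u \<in> tangent_space A p" "v \<in> tangent_space A p"
  shows "g p u v = ip c (snd c p) (u c) (v c)"
proof -
  have c: "c \<in> A" "snd c p \<in> chart_range c" using assms(1)
    by (auto simp: charts_at_iff snd_in_chart_range)
  show ?thesis
    using metric_coord_vec[OF c, of "u c" "v c"] tangent_eq_coord_vec[OF assms(2,1)]
      tangent_eq_coord_vec[OF assms(3,1)] by (simp add: chart_inv_snd_at[OF assms(1)])
qed

lemma ip_pos:
  assumes "c \<in> A" "x \<in> chart_range c" "y \<noteq> 0"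
  shows "0 < ip c x y y"
proof -
  have c: "c \<in> charts_at A (chart_inv c x)" by (rule chart_inv_charts_at[OF assms(1,2)])
  have "coord_vec A c (chart_inv c x) y \<noteq> (\<lambda>_. 0)"
    using coord_vec_coord[OF c, of y] assms(3) by auto
  then show ?thesis
    using metric_pos[OF charts_at_carrier[OF c] coord_vec_tangent[OF c], of y]
      metric_coord_vec[OF assms(1,2), of y y] by simp
qed

lemma gE_pos: "c \<in> A \<Longrightarrow> x \<in> chart_range c \<Longrightarrow> 0 < gE c x"
  using ip_pos[of c x "axis 1 1"] axis_eq_0_iff[of 1 "1::real"]
  by (simp add: ip_def) (simp add: axis_def)

lemma gD_pos:
  assumes "c \<in> A" "x \<in> chart_range c"
  shows "0 < gD c x"
proof -
  \<comment> \<open>This vector is orthogonal to the first coordinate direction, and its squared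
    length is \<open>gE c x * gD c x\<close>.\<close>
  define y :: "real^2" where "y = vector [- gF c x, gE c x]"
  have E: "0 < gE c x" by (rule gE_pos[OF assms])
  have "y $ 2 \<noteq> 0" using E by (simp add: y_def)
  then have "y \<noteq> 0" by (metis zero_index)
  from ip_pos[OF assms this] have "0 < gE c x * gD c x"
    by (simp add: ip_def y_def gD_def algebra_simps)
  then show ?thesis using E by (simp add: zero_less_mult_iff)
qed

lemma metric_matrix_smooth: "c \<in> A \<Longrightarrow> smooth_on (metric_matrix A g c) (chart_range c)"
  using metric unfolding riemannian_metric_def by blast

lemma metric_entry_differentiable:
  assumes "c \<in> A" "x \<in> chart_range c"
  shows "(\<lambda>x. metric_matrix A g c x $ i $ j) differentiable (at x)"
  using smooth_on_differentiable[OF metric_matrix_smooth open_chart_range] assms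
  by (intro differentiable_vec_nth) auto

lemma gEFG_differentiable:
  assumes "c \<in> A" "x \<in> chart_range c"
  shows "gE c differentiable (at x)" "gF c differentiable (at x)" "gG c differentiable (at x)"
    "gD c differentiable (at x)"
proof -
  show 1: "gE c differentiable (at x)" "gF c differentiable (at x)" "gG c differentiable (at x)"
    unfolding gE_def[abs_def] gF_def[abs_def] gG_def[abs_def]
    by (rule metric_entry_differentiable[OF assms])+
  have "gD c = (\<lambda>x. gE c x * gG c x - gF c x * gF c x)" by (auto simp: gD_def)
  then show "gD c differentiable (at x)"
    using 1 by (simp add: differentiable_diff differentiable_mult)
qed

text \<open>Rotation by \<open>\<pi>/2\<close> in coordinates; \<open>gE\<close>, \<open>gF\<close>, \<open>gG\<close> are the coefficients of the first
  fundamental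
  form and \<open>gD\<close> is its determinant.\<close>

definition cJ :: "('m, real^2) chart \<Rightarrow> real^2 \<Rightarrow> real^2 \<Rightarrow> real^2" where
  "cJ c x y = vector [- (gF c x * y $ 1 + gG c x * y $ 2) / sqrt (gD c x),
     (gE c x * y $ 1 + gF c x * y $ 2) / sqrt (gD c x)]"

text \<open>The right side is the Riemannian area form on the pair \<open>z\<close>,
  \<open>y\<close>. Orthogonality of a vector and its rotation is therefore antisymmetry of the area
  form.\<close>

lemma ip_cJ:
  assumes "c \<in> A" "x \<in> chart_range c"
  shows "ip c x y (cJ c x z) = sqrt (gD c x) * (z $ 1 * y $ 2 - z $ 2 * y $ 1)"
proof -
  have D: "0 < gD c x" by (rule gD_pos[OF assms])
  have s: "sqrt (gD c x) * sqrt (gD c x) = gE c x * gG c x - gF c x * gF c x"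
    using D by (simp add: gD_def)
  have "sqrt (gD c x) * ip c x y (cJ c x z) = (gE c x * gG c x - gF c x * gF c x) * (z $ 1 * y $ 2
    - z $ 2 * y $ 1)"
    using D by (simp add: ip_def cJ_def field_simps)
  also have "\<dots> = sqrt (gD c x) * (sqrt (gD c x) * (z $ 1 * y $ 2 - z $ 2 * y $ 1))"
    using s by (simp add: mult.assoc[symmetric])
  finally show ?thesis using D by simp
qed

lemma ip_cJ_self: "c \<in> A \<Longrightarrow> x \<in> chart_range c \<Longrightarrow> ip c x y (cJ c x y) = 0"
  by (simp add: ip_cJ)

lemma ip_cJ_cJ:
  assumes "c \<in> A" "x \<in> chart_range c"
  shows "ip c x (cJ c x y) (cJ c x z) = ip c x y z"
  unfolding ip_cJ[OF assms] using gD_pos[OF assms]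
  by (simp add: cJ_def ip_def field_simps)

lemma cJ_add: "cJ c x (y + z) = cJ c x y + cJ c x z"
  by (rule vec2_eqI) (simp_all add: cJ_def algebra_simps add_divide_distrib diff_divide_distrib)

lemma cJ_scale: "cJ c x (r *\<^sub>R y) = r *\<^sub>R cJ c x y"
  by (rule vec2_eqI) (simp_all add: cJ_def algebra_simps add_divide_distrib diff_divide_distrib)

lemma cJ_cJ:
  assumes "c \<in> A" "x \<in> chart_range c"
  shows "cJ c x (cJ c x y) = - y"
proof -
  have D: "0 < gD c x" by (rule gD_pos[OF assms])
  have "gE c x * gG c x - gF c x * gF c x = sqrt (gD c x) * sqrt (gD c x)"
    using D by (simp add: gD_def)
  then have s: "gE c x * gG c x = sqrt (gD c x) * sqrt (gD c x) + gF c x * gF c x" by simp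
  have "cJ c x (cJ c x y) $ 1 = (- (gE c x * gG c x - gF c x * gF c x) / (sqrt (gD c x) * sqrt (gD
    c x))) * y $ 1"
    "cJ c x (cJ c x y) $ 2 = (- (gE c x * gG c x - gF c x * gF c x) / (sqrt (gD c x) * sqrt (gD c
      x))) * y $ 2"
    using D by (simp_all add: cJ_def divide_simps) (simp_all add: algebra_simps)
  then show ?thesis using D s by (intro vec2_eqI) simp_all
qed

lemma unit_decomposition:
  assumes "c \<in> A" "x \<in> chart_range c" "ip c x n n = 1"
  shows "y = ip c x y n *\<^sub>R n + ip c x y (cJ c x n) *\<^sub>R cJ c x n"
proof -
  have D: "sqrt (gD c x) \<noteq> 0" using gD_pos[OF assms(1,2)] by simp
  have "(ip c x y n *\<^sub>R n + ip c x y (cJ c x n) *\<^sub>R cJ c x n) $ 1 = ip c x n n * y $ 1"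
    "(ip c x y n *\<^sub>R n + ip c x y (cJ c x n) *\<^sub>R cJ c x n) $ 2 = ip c x n n * y $ 2"
    unfolding ip_cJ[OF assms(1,2)] using D by (simp_all add: cJ_def ip_def field_simps)
  then show ?thesis using assms(3) by (intro vec2_eqI) simp_all
qed

text \<open>With \<open>(p, q)\<close> the covector dual to \<open>y\<close>, orthogonality forces
  \<open>N w = d (- q, p)\<close>. Equal lengths give \<open>N * N = d * d * gD c x\<close>, and the
  orientation condition, which says \<open>0 \<le> d\<close>, selects the root.\<close>

lemma cJ_unique:
  assumes "c \<in> A" "x \<in> chart_range c" "ip c x y w = 0" "ip c x w w = ip c x y y"
    "0 \<le> det (vector [y, w] :: real^2^2)"
  shows "w = cJ c x y"
proof (cases "y = 0")
  case True
  then have "ip c x w w = 0" using assms(4) by (simp add: ip_def)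
  then have "w = 0" using ip_pos[OF assms(1,2), of w] by force
  then show ?thesis using True by (intro vec2_eqI) (simp_all add: cJ_def)
next
  case False
  define N where "N = ip c x y y"
  define d where "d = y $ 1 * w $ 2 - y $ 2 * w $ 1"
  define p where "p = gE c x * y $ 1 + gF c x * y $ 2"
  define q where "q = gF c x * y $ 1 + gG c x * y $ 2"
  have N: "0 < N" "N = p * y $ 1 + q * y $ 2"
    using ip_pos[OF assms(1,2) False] by (simp_all add: N_def p_def q_def ip_def algebra_simps)
  have d: "0 \<le> d" using assms(5) by (simp add: d_def det_2)
  have D: "0 < gD c x" by (rule gD_pos[OF assms(1,2)])
  have o: "p * w $ 1 + q * w $ 2 = 0" using assms(3) by (simp add: ip_def p_def q_def algebra_simps)
  have w1: "N * w $ 1 = - (q * d)"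
  proof -
    have "N * w $ 1 + q * d = y $ 1 * (p * w $ 1 + q * w $ 2)"
      by (simp add: N(2) d_def algebra_simps)
    then show ?thesis using o by simp
  qed
  have w2: "N * w $ 2 = p * d"
  proof -
    have "N * w $ 2 - p * d = y $ 2 * (p * w $ 1 + q * w $ 2)"
      by (simp add: N(2) d_def algebra_simps)
    then show ?thesis using o by simp
  qed
  have "N * N * ip c x w w = gE c x * (N * w $ 1) * (N * w $ 1) + 2 * gF c x * (N * w $ 1) * (N *
    w $ 2)
      + gG c x * (N * w $ 2) * (N * w $ 2)"
    by (simp add: ip_def algebra_simps)
  also have "\<dots> = d * d * (gE c x * q * q - 2 * gF c x * p * q + gG c x * p * p)"
    unfolding w1 w2 by (simp add: algebra_simps)
  also have "gE c x * q * q - 2 * gF c x * p * q + gG c x * p * p = gD c x * N"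
    unfolding N(2) by (simp add: gD_def p_def q_def algebra_simps)
  finally have "N * N * N = d * d * gD c x * N" using assms(4) by (simp add: N_def mult.assoc)
  then have "N * N = d * d * gD c x" using N(1) by (metis mult_right_cancel less_irrefl)
  also have "\<dots> = (d * sqrt (gD c x)) * (d * sqrt (gD c x))" using D by simp
  finally have "N * N = (d * sqrt (gD c x)) * (d * sqrt (gD c x))" .
  then have "N = d * sqrt (gD c x)"
    using N(1) d D by (metis abs_of_nonneg less_eq_real_def mult_nonneg_nonneg real_sqrt_abs2
      real_sqrt_ge_0_iff)
  then have dN: "d = N / sqrt (gD c x)" using D by (simp add: field_simps)
  have "N * w $ 1 = N * (- q / sqrt (gD c x))" "N * w $ 2 = N * (p / sqrt (gD c x))"
    using w1 w2 unfolding dN by simp_all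
  then have "w $ 1 = - q / sqrt (gD c x)" "w $ 2 = p / sqrt (gD c x)"
    using N(1) mult_left_cancel[of N] by blast+
  then show ?thesis by (intro vec2_eqI) (simp_all add: cJ_def p_def q_def)
qed

lemma det_cJ: "c \<in> A \<Longrightarrow> x \<in> chart_range c \<Longrightarrow> det (vector [y, cJ c x y] :: real^2^2) =
  ip c x y y / sqrt (gD c x)"
  using gD_pos[of c x] by (simp add: det_2 cJ_def ip_def field_simps)

lemma det_linear_image:
  fixes f :: "real^2 \<Rightarrow> real^2"
  assumes "linear f"
  shows "det (vector [f y, f z] :: real^2^2) = det (matrix f) * det (vector [y, z] :: real^2^2)"
proof -
  have f: "f y = matrix f *v y" for y using assms by (simp add: matrix_works)
  show ?thesis unfolding f[of y] f[of z] det_2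
    by (simp add: matrix_vector_mult_def sum_2 algebra_simps)
qed

lemma transition_det_pos:
  assumes "c \<in> charts_at A p" "d \<in> charts_at A p"
  shows "0 < det (matrix (frechet_derivative (transition c d) (at (snd c p))))"
  using closed_oriented assms unfolding closed_oriented_surface_def charts_at_def by blast

text \<open>Resolves the definite description of \<open>rotJ\<close>. The orientation sign has to be
  computed in the chart \<open>c\<close> alone: it is preserved by the transition maps of an
  oriented atlas, whose determinants are positive.\<close>

lemma rotJ_coord:
  assumes c: "c \<in> charts_at A p" and v: "v \<in> tangent_space A p"
  shows "rotJ A g p v = coord_vec A c p (cJ c (snd c p) (v c))"
proof -
  let ?x = "snd c p"
  have cA: "c \<in> A" "?x \<in> chart_range c" using c by (auto simp: charts_at_iff snd_in_chart_range)
  let ?w = "coord_vec A c p (cJ c ?x (v c))"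
  have w: "?w \<in> tangent_space A p" "?w c = cJ c ?x (v c)"
    using coord_vec_tangent[OF c] coord_vec_coord[OF c] by auto
  show ?thesis
    unfolding rotJ_def
  proof (rule the_equality, intro conjI ballI)
    show "?w \<in> tangent_space A p" by fact
    show "g p v ?w = 0" using metric_coord[OF c v w(1)] w(2) ip_cJ_self[OF cA] by simp
    show "g p ?w ?w = g p v v"
      using metric_coord[OF c w(1) w(1)] metric_coord[OF c v v] w(2) ip_cJ_cJ[OF cA] by simp
    fix d assume d: "d \<in> charts_at A p"
    have "0 \<le> det (vector [v c, ?w c] :: real^2^2)"
      unfolding w(2) det_cJ[OF cA] using ip_pos[OF cA, of "v c"] gD_pos[OF cA]
      by (cases "v c = 0") (auto simp: ip_def)
    then show "0 \<le> det (vector [v d, ?w d] :: real^2^2)"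
      unfolding tangent_transition[OF v c d] tangent_transition[OF w(1) c d]
        det_linear_image[OF linear_transition[OF c d]]
      using transition_det_pos[OF c d] by simp
  next
    fix w' assume w': "w' \<in> tangent_space A p \<and> g p v w' = 0 \<and> g p w' w' = g p v v \<and>
      (\<forall>c\<in>charts_at A p. 0 \<le> det (vector [v c, w' c] :: real^2^2))"
    then have "w' c = cJ c ?x (v c)"
      using c v metric_coord[OF c] by (intro cJ_unique[OF cA]) auto
    then show "w' = ?w" using tangent_eqI[of w' p ?w c] w' w c by auto
  qed
qed

text \<open>The unit vector at angle \<open>\<theta>\<close> from the first coordinate direction, in coordinates.\<close>

definition uvec :: "('m, real^2) chart \<Rightarrow> real^2 \<Rightarrow> real \<Rightarrow> real^2" where
  "uvec c x \<theta> = vector [cos \<theta> / sqrt (gE c x) - sin \<theta> * gF c x / (sqrt (gE c x) * sqrt (gD c x)),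
     sin \<theta> * sqrt (gE c x) / sqrt (gD c x)]"

lemma uvec_eq:
  assumes "c \<in> A" "x \<in> chart_range c"
  shows "uvec c x \<theta> = cos \<theta> *\<^sub>R uvec c x 0 + sin \<theta> *\<^sub>R cJ c x (uvec c x 0)"
    and "uvec c x 0 = (1 / sqrt (gE c x)) *\<^sub>R axis 1 1"
proof -
  show 1: "uvec c x 0 = (1 / sqrt (gE c x)) *\<^sub>R axis 1 1"
    by (rule vec2_eqI) (simp_all add: uvec_def axis_def)
  have "gE c x / sqrt (gE c x) = sqrt (gE c x)" using gE_pos[OF assms] by (simp add: real_div_sqrt)
  then show "uvec c x \<theta> = cos \<theta> *\<^sub>R uvec c x 0 + sin \<theta> *\<^sub>R cJ c x (uvec c x 0)"
    unfolding 1 by (intro vec2_eqI) (simp_all add: uvec_def cJ_def axis_def)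
qed

lemma uvec_unit: "c \<in> A \<Longrightarrow> x \<in> chart_range c \<Longrightarrow> ip c x (uvec c x \<theta>) (uvec c x \<theta>) = 1"
proof -
  assume a: "c \<in> A" "x \<in> chart_range c"
  have "ip c x (uvec c x 0) (uvec c x 0) = 1"
    unfolding uvec_eq(2)[OF a] using gE_pos[OF a] by (simp add: ip_def axis_def field_simps)
  then show ?thesis
    unfolding uvec_eq(1)[OF a, of \<theta>]
    by (simp add: ip_add_left ip_add_right ip_scale_left ip_scale_right ip_cJ_self[OF a]
        ip_sym[of c x "cJ c x (uvec c x 0)" "uvec c x 0"] ip_cJ_cJ[OF a]
          power2_eq_square[symmetric])
qed

lemma uvec_rotate:
  assumes "c \<in> A" "x \<in> chart_range c"
  shows "uvec c x (\<theta> + \<theta>') = cos \<theta>' *\<^sub>R uvec c x \<theta> + sin \<theta>' *\<^sub>R cJ c x (uvec c x \<theta>)"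
proof -
  note e = uvec_eq(1)[OF assms]
  show ?thesis
    unfolding e[of "\<theta> + \<theta>'"] e[of \<theta>] cJ_add cJ_scale cJ_cJ[OF assms] cos_add sin_add
    by (simp add: algebra_simps)
qed

lemma cJ_uvec:
  assumes "c \<in> A" "x \<in> chart_range c"
  shows "cJ c x (uvec c x \<theta>) = uvec c x (\<theta> + pi / 2)"
  using uvec_rotate[OF assms, of \<theta> "pi / 2"] by simp

lemma uvec_nonzero: "c \<in> A \<Longrightarrow> x \<in> chart_range c \<Longrightarrow> uvec c x \<theta> \<noteq> 0"
  using uvec_unit[of c x \<theta>] by (auto simp: ip_def)

lemma ip_uvec:
  assumes "c \<in> A" "x \<in> chart_range c"
  shows "ip c x (uvec c x \<theta>) (uvec c x \<theta>') = cos (\<theta> - \<theta>')"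
    and "ip c x (uvec c x \<theta>) (cJ c x (uvec c x \<theta>')) = sin (\<theta> - \<theta>')"
proof -
  have e: "uvec c x \<theta> = cos (\<theta> - \<theta>') *\<^sub>R uvec c x \<theta>' + sin (\<theta> - \<theta>') *\<^sub>R cJ c x (uvec c x \<theta>')"
    using uvec_rotate[OF assms, of \<theta>' "\<theta> - \<theta>'"] by simp
  show "ip c x (uvec c x \<theta>) (uvec c x \<theta>') = cos (\<theta> - \<theta>')"
    "ip c x (uvec c x \<theta>) (cJ c x (uvec c x \<theta>')) = sin (\<theta> - \<theta>')"
    unfolding e
    by (simp_all add: ip_add_left ip_scale_left uvec_unit[OF assms] ip_cJ_self[OF assms]
      ip_cJ_cJ[OF assms]
       ip_sym[of c x "cJ c x (uvec c x \<theta>')" "uvec c x \<theta>'"])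
qed

lemma uvec_inj:
  assumes "c \<in> A" "x \<in> chart_range c" "uvec c x \<theta> = uvec c x \<theta>'" "\<bar>\<theta> - \<theta>'\<bar> < 2 * pi"
  shows "\<theta> = \<theta>'"
proof -
  have "cos (\<theta> - \<theta>') = 1" using ip_uvec(1)[OF assms(1,2), of \<theta> \<theta>'] uvec_unit[OF assms(1,2)]
    assms(3) by simp
  then obtain n :: int where n: "\<theta> - \<theta>' = of_int n * 2 * pi"
    using cos_one_2pi_int by blast
  then have "\<bar>of_int n * (2 * pi)\<bar> < 1 * (2 * pi)" using assms(4) by (simp add: mult.assoc)
  then have "\<bar>real_of_int n\<bar> < 1" by (simp add: abs_mult)
  then have "n = 0" by linarith
  then show ?thesis using n by simp
qed

lemma uvec_surj:
  assumes "c \<in> A" "x \<in> chart_range c" "ip c x y y = 1"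
  shows "\<exists>\<theta>. y = uvec c x \<theta>"
proof -
  let ?n = "uvec c x 0"
  let ?a = "ip c x y ?n" and ?b = "ip c x y (cJ c x ?n)"
  have d: "y = ?a *\<^sub>R ?n + ?b *\<^sub>R cJ c x ?n"
    by (rule unit_decomposition[OF assms(1,2) uvec_unit[OF assms(1,2)]])
  have "ip c x y y = ?a * ip c x ?n y + ?b * ip c x (cJ c x ?n) y"
    by (subst (1) d) (simp add: ip_add_left ip_scale_left)
  then have "?a\<^sup>2 + ?b\<^sup>2 = 1"
    using assms(3) by (simp add: power2_eq_square ip_sym[of c x ?n y] ip_sym[of c x "cJ c x ?n" y])
  then obtain t where "?a = cos t" "?b = sin t" using sincos_total_2pi by metis
  then show ?thesis using d uvec_eq(1)[OF assms(1,2), of t] by metis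
qed

lemma uvec_differentiable:
  assumes "c \<in> A" "x \<in> chart_range c"
  shows "(\<lambda>z. uvec c (fst z) (snd z)) differentiable (at (x, \<theta>))"
proof -
  have f: "(\<lambda>z. gE c (fst z)) differentiable (at (x, \<theta>))" "(\<lambda>z. gF c (fst z)) differentiable (at
    (x, \<theta>))"
    "(\<lambda>z. gD c (fst z)) differentiable (at (x, \<theta>))"
    by (rule differentiable_chain[OF differentiable_fst[OF differentiable_ident]],
        simp add: gEFG_differentiable[OF assms])+
  have s: "(\<lambda>z. sqrt (gE c (fst z))) differentiable (at (x, \<theta>))" "(\<lambda>z. sqrt (gD c (fst z)))
    differentiable (at (x, \<theta>))"
    using gE_pos[OF assms] gD_pos[OF assms] f by (auto intro: differentiable_sqrt)
  have n: "sqrt (gE c x) \<noteq> 0" "sqrt (gD c x) \<noteq> 0"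
    using gE_pos[OF assms] gD_pos[OF assms] by auto
  have t: "(\<lambda>z::(real^2)\<times>real. snd z) differentiable (at (x, \<theta>))"
    by (rule differentiable_snd[OF differentiable_ident])
  show ?thesis
    unfolding uvec_def
    by (intro differentiable_vector2 differentiable_diff differentiable_divide differentiable_mult
        differentiable_cos differentiable_sin f s t) (use n in simp_all)
qed

text \<open>The angle of a vector in the half plane centred at the direction \<open>\<theta>0\<close>.\<close>

definition angle :: "('m, real^2) chart \<Rightarrow> real \<Rightarrow> real^2 \<Rightarrow> real^2 \<Rightarrow> real" where
  "angle c \<theta>0 x y = \<theta>0 + arcsin (ip c x y (cJ c x (uvec c x \<theta>0)) / sqrt (ip c x y y))"

lemma angle_uvec:
  assumes "c \<in> A" "x \<in> chart_range c" "0 < r" "\<bar>\<theta> - \<theta>0\<bar> \<le> pi / 2"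
  shows "angle c \<theta>0 x (r *\<^sub>R uvec c x \<theta>) = \<theta>"
proof -
  have "ip c x (r *\<^sub>R uvec c x \<theta>) (r *\<^sub>R uvec c x \<theta>) = r\<^sup>2"
    by (simp add: ip_scale_left ip_scale_right uvec_unit[OF assms(1,2)] power2_eq_square)
  then have "angle c \<theta>0 x (r *\<^sub>R uvec c x \<theta>) = \<theta>0 + arcsin (sin (\<theta> - \<theta>0))"
    using assms(3) unfolding angle_def by (simp only: ip_scale_left ip_uvec[OF assms(1,2)]) simp
  also have "arcsin (sin (\<theta> - \<theta>0)) = \<theta> - \<theta>0"
    using assms(4) unfolding abs_le_iff by (intro arcsin_sin) linarith+
  finally show ?thesis by simp
qed

lemma polar_decomposition:
  assumes "c \<in> A" "x \<in> chart_range c" "0 < ip c x y (uvec c x \<theta>0)"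
  shows "y = sqrt (ip c x y y) *\<^sub>R uvec c x (angle c \<theta>0 x y)"
proof -
  have y0: "y \<noteq> 0" using assms(3) by (auto simp: ip_def)
  define r where "r = sqrt (ip c x y y)"
  have r: "0 < r" "r * r = ip c x y y" using ip_pos[OF assms(1,2) y0] by (simp_all add: r_def)
  have "ip c x ((1 / r) *\<^sub>R y) ((1 / r) *\<^sub>R y) = 1"
    using r ip_pos[OF assms(1,2) y0] by (simp add: ip_scale_left ip_scale_right)
  from uvec_surj[OF assms(1,2) this] obtain \<theta> where \<theta>: "(1 / r) *\<^sub>R y = uvec c x \<theta>" ..
  then have y: "y = r *\<^sub>R uvec c x \<theta>" using r by (simp flip: \<theta>)
  then have "0 < r * cos (\<theta> - \<theta>0)" using assms(3)
    by (simp add: ip_scale_left ip_uvec[OF assms(1,2)])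
  then have cp: "0 < cos (\<theta> - \<theta>0)" using r by (simp add: zero_less_mult_iff)
  define s where "s = arcsin (sin (\<theta> - \<theta>0))"
  have s: "sin s = sin (\<theta> - \<theta>0)" "- (pi / 2) \<le> s" "s \<le> pi / 2"
    using arcsin[of "sin (\<theta> - \<theta>0)"] by (simp_all add: s_def)
  \<comment> \<open>The arcsine recovers the angle only up to its supplement; the positive cosine,
    that is, the half plane condition, excludes the supplement.\<close>
  have "cos s = cos (\<theta> - \<theta>0)"
  proof -
    have "0 \<le> cos s" using s by (intro cos_ge_zero) auto
    moreover have "(cos s)\<^sup>2 = (cos (\<theta> - \<theta>0))\<^sup>2" using s(1) by (simp add: cos_squared_eq)
    ultimately show ?thesis using cp by (simp add: power2_eq_iff)
  qed
  then have "uvec c x (\<theta>0 + s) = uvec c x (\<theta>0 + (\<theta> - \<theta>0))"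
    unfolding uvec_rotate[OF assms(1,2)] s(1) by simp
  moreover have "ip c x y (cJ c x (uvec c x \<theta>0)) = r * sin (\<theta> - \<theta>0)"
    unfolding y by (simp add: ip_scale_left ip_uvec[OF assms(1,2)])
  then have "angle c \<theta>0 x y = \<theta>0 + s"
    unfolding angle_def r_def[symmetric] using r by (simp add: s_def)
  ultimately have "uvec c x (angle c \<theta>0 x y) = uvec c x \<theta>" by simp
  then have "y = r *\<^sub>R uvec c x (angle c \<theta>0 x y)" by (rule ssubst) (rule y)
  then show ?thesis unfolding r_def .
qed

lemma ip_differentiable:
  assumes "c \<in> A" "x \<in> chart_range c" "X differentiable (at w)" "Y differentiable (at w)"
    "Z differentiable (at w)" "X w = x"
  shows "(\<lambda>w. ip c (X w) (Y w) (Z w)) differentiable (at w)"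
proof -
  have f: "(\<lambda>w. gE c (X w)) differentiable (at w)" "(\<lambda>w. gF c (X w)) differentiable (at w)"
    "(\<lambda>w. gG c (X w)) differentiable (at w)"
    using gEFG_differentiable[OF assms(1,2)] assms(3,6)
    by (auto intro: differentiable_chain[of X w])
  show ?thesis
    unfolding ip_def
    by (intro differentiable_add differentiable_mult f differentiable_vec_nth assms)
qed

lemma angle_differentiable:
  assumes "c \<in> A" "x \<in> chart_range c" "0 < ip c x y (uvec c x \<theta>0)"
    "X differentiable (at w)" "Y differentiable (at w)" "X w = x" "Y w = y"
  shows "(\<lambda>w. angle c \<theta>0 (X w) (Y w)) differentiable (at w)"
proof -
  have y0: "y \<noteq> 0" using assms(3) by (auto simp: ip_def)
  define n where "n = uvec c x \<theta>0"
  define r where "r = sqrt (ip c x y y)"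
  have r: "0 < r" "r\<^sup>2 = ip c x y y" using ip_pos[OF assms(1,2) y0] by (simp_all add: r_def)
  \<comment> \<open>Pythagoras in the orthonormal basis \<open>n\<close>, \<open>cJ c x n\<close>.
    The positive component along \<open>n\<close> keeps the argument of the arcsine strictly between
    -1 and 1, where it is differentiable.\<close>
  have "ip c x y y = (ip c x y n)\<^sup>2 + (ip c x y (cJ c x n))\<^sup>2"
  proof -
    have d: "y = ip c x y n *\<^sub>R n + ip c x y (cJ c x n) *\<^sub>R cJ c x n"
      by (rule unit_decomposition[OF assms(1,2)]) (simp add: n_def uvec_unit[OF assms(1,2)])
    have "ip c x y y = ip c x y n * ip c x n y + ip c x y (cJ c x n) * ip c x (cJ c x n) y"
      by (subst (1) d) (simp add: ip_add_left ip_scale_left)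
    then show ?thesis by (simp add: power2_eq_square ip_sym[of c x n y] ip_sym[of c x "cJ c x n" y])
  qed
  moreover have "0 < (ip c x y n)\<^sup>2" using assms(3) by (simp add: n_def)
  ultimately have "(ip c x y (cJ c x n))\<^sup>2 < r\<^sup>2" using r by simp
  then have "\<bar>ip c x y (cJ c x n)\<bar> < r" 
    using power2_less_imp_less[of "\<bar>ip c x y (cJ c x n)\<bar>" r] r(1) by simp
  then have bd: "- 1 < ip c x y (cJ c x n) / r" "ip c x y (cJ c x n) / r < 1"
    using r(1) by (simp_all add: field_simps)
  have X0: "\<theta> differentiable (at w) \<Longrightarrow> (\<lambda>w. uvec c (X w) (\<theta> w)) differentiable (at w)" for \<theta>
    using differentiable_chain[of "\<lambda>w. (X w, \<theta> w)" w "\<lambda>z. uvec c (fst z) (snd z)"]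
      uvec_differentiable[OF assms(1,2)] assms(4,6) by simp
  \<comment> \<open>The rotated direction is again of the form \<open>uvec\<close>, whose
    differentiability is known. The identity needs a point of the chart range, hence the detour
    through a neighbourhood.\<close>
  have J: "cJ c (X v) (uvec c (X v) \<theta>0) = uvec c (X v) (\<theta>0 + pi / 2)" if "X v \<in> chart_range c" for v
    using cJ_uvec[OF assms(1) that] by simp
  have ev: "\<forall>\<^sub>F v in nhds w. X v \<in> chart_range c"
    using differentiable_imp_tendsto_nhds[OF assms(4)] open_chart_range[OF assms(1)] assms(2,6)
    by (auto elim: topological_tendstoD)
  have "(\<lambda>w. \<theta>0 + arcsin (ip c (X w) (Y w) (uvec c (X w) (\<theta>0 + pi / 2)) / sqrt (ip c (X w) (Y w)
    (Y w)))) differentiable (at w)"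
    by (intro differentiable_add differentiable_const differentiable_arcsin differentiable_divide
        ip_differentiable[OF assms(1,2)] differentiable_sqrt X0 assms)
      (use bd r cJ_uvec[OF assms(1,2)] assms(6,7) ip_pos[OF assms(1,2) y0]
        in \<open>simp_all add: n_def r_def\<close>)
  then show ?thesis
    by (rule differentiable_eventually_eq)
      (use ev in \<open>eventually_elim, simp add: angle_def J\<close>)
qed

end

section \<open>The unit tangent bundle\<close>

lemma linear_axis2:
  fixes L :: "real^2 \<Rightarrow> 'b::real_vector"
  assumes "linear L"
  shows "L y = (y $ 1) *\<^sub>R L (axis 1 1) + (y $ 2) *\<^sub>R L (axis 2 1)"
proof -
  have "y = (y $ 1) *\<^sub>R axis 1 1 + (y $ 2) *\<^sub>R axis 2 1"
    by (rule vec2_eqI) (simp_all add: axis_def)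
  then have "L y = L ((y $ 1) *\<^sub>R axis 1 1 + (y $ 2) *\<^sub>R axis 2 1)" by (rule arg_cong)
  then show ?thesis by (simp only: linear_add[OF assms] linear_cmul[OF assms])
qed

context surface
begin

abbreviation SM :: "('m tpoint, (real^2) \<times> real) atlas" where "SM \<equiv> sm_atlas A g"

text \<open>The parametrisation of the unit tangent bundle with an unrestricted angle. The charts
  \<open>sm_chart\<close> over one \<open>c\<close> are local inverses of it and differ only in the
  window of length \<open>2 * pi\<close> for the angle.\<close>

definition smp :: "('m, real^2) chart \<Rightarrow> real^2 \<Rightarrow> real \<Rightarrow> 'm tpoint" where
  "smp c x \<theta> = (chart_inv c x, coord_vec A c (chart_inv c x) (uvec c x \<theta>))"

lemma fst_smp: "fst (smp c x \<theta>) = chart_inv c x"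
  by (simp add: smp_def)

lemma snd_smp_tangent:
  "c \<in> A \<Longrightarrow> x \<in> chart_range c \<Longrightarrow> snd (smp c x \<theta>) \<in> tangent_space A (chart_inv c x)"
  by (simp add: smp_def coord_vec_tangent chart_inv_charts_at)

lemma snd_smp_coord: "c \<in> A \<Longrightarrow> x \<in> chart_range c \<Longrightarrow> snd (smp c x \<theta>) c = uvec c x \<theta>"
  by (simp add: smp_def coord_vec_coord chart_inv_charts_at)

lemma smp_eqI:
  assumes "c \<in> charts_at A p" "v \<in> tangent_space A p" "v c = uvec c (snd c p) \<theta>"
  shows "(p, v) = smp c (snd c p) \<theta>"
  using tangent_eq_coord_vec[OF assms(2,1)] assms(3)
  by (simp add: smp_def chart_inv_snd_at[OF assms(1)])

lemma rotate_smp: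
  assumes "c \<in> A" "x \<in> chart_range c"
  shows "rotate_fiber A g \<theta>' (smp c x \<theta>) = smp c x (\<theta> + \<theta>')"
proof -
  note c = chart_inv_charts_at[OF assms]
  have "rotJ A g (chart_inv c x) (snd (smp c x \<theta>)) =
      coord_vec A c (chart_inv c x) (cJ c x (uvec c x \<theta>))"
    using rotJ_coord[OF c snd_smp_tangent[OF assms]]
    by (simp add: snd_smp_coord[OF assms] snd_chart_inv[OF assms(2)])
  then show ?thesis
    by (simp add: rotate_fiber_def fst_smp) (simp add: smp_def coord_vec_vcomb[OF c, symmetric]
      uvec_rotate[OF assms])
qed

lemma sm_param_eq:
  assumes "c \<in> A" "x \<in> chart_range c"
  shows "sm_param A g c (x, \<theta>) = smp c x \<theta>"
proof -
  note c = chart_inv_charts_at[OF assms]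
  let ?p = "chart_inv c x"
  let ?e = "coord_vec A c ?p (axis 1 1)"
  have "g ?p ?e ?e = gE c x"
    using metric_coord_vec[OF assms] by (simp add: ip_def axis_def)
  moreover have "(\<lambda>d. ?e d /\<^sub>R r) = coord_vec A c ?p ((1 / r) *\<^sub>R axis 1 1)" for r
    using coord_vec_vcomb[OF c, of "1 / r" "axis 1 1" 0 0]
    by (simp add: vcomb_def inverse_eq_divide)
  ultimately have "(?p, \<lambda>d. ?e d /\<^sub>R sqrt (g ?p ?e ?e)) = smp c x 0"
    by (simp add: smp_def uvec_eq(2)[OF assms])
  then show ?thesis
    using rotate_smp[OF assms, of \<theta> 0] by (simp add: sm_param_def Let_def)
qed

lemma smp_inj:
  assumes "c \<in> A" "x \<in> chart_range c" "x' \<in> chart_range c" "smp c x \<theta> = smp c x' \<theta>'"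
    "\<bar>\<theta> - \<theta>'\<bar> < 2 * pi"
  shows "x = x' \<and> \<theta> = \<theta>'"
proof -
  have "chart_inv c x = chart_inv c x'" using assms(4) by (simp add: smp_def)
  then have x: "x = x'" using snd_chart_inv assms(2,3) by metis
  then have "uvec c x \<theta> = uvec c x \<theta>'"
    using assms(4) snd_smp_coord[OF assms(1,2)] by metis
  then show ?thesis using uvec_inj[OF assms(1,2)] assms(5) x by blast
qed

lemma sm_chart_domain: "sm_param A g c ` (chart_range c \<times> {a - pi<..<a + pi}) =
  fst (sm_chart A g c a)"
  by (simp add: sm_chart_def Let_def)

lemma sm_param_inj:
  assumes "c \<in> A"
  shows "inj_on (sm_param A g c) (chart_range c \<times> {a - pi<..<a + pi})"
proof (rule inj_onI, clarsimp)
  fix x \<theta> x' \<theta>'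
  assume *: "x \<in> chart_range c" "x' \<in> chart_range c" "a - pi < \<theta>" "\<theta> < a + pi" "a - pi < \<theta>'" "\<theta>' <
    a + pi"
    "sm_param A g c (x, \<theta>) = sm_param A g c (x', \<theta>')"
  then have "\<bar>\<theta> - \<theta>'\<bar> < 2 * pi" by linarith
  then show "x = x' \<and> \<theta> = \<theta>'"
    using * by (intro smp_inj[OF assms]) (simp_all add: sm_param_eq[OF assms])
qed

lemma sm_chart_snd:
  assumes "c \<in> A" "x \<in> chart_range c" "a - pi < \<theta>" "\<theta> < a + pi"
  shows "snd (sm_chart A g c a) (smp c x \<theta>) = (x, \<theta>)"
  using inv_into_f_f[OF sm_param_inj[OF assms(1), of a], of "(x, \<theta>)"] assms
  by (simp add: sm_chart_def Let_def sm_param_eq)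

lemma sm_chart_fst:
  assumes "c \<in> A"
  shows "u \<in> fst (sm_chart A g c a) \<longleftrightarrow>
    (\<exists>x \<theta>. x \<in> chart_range c \<and> a - pi < \<theta> \<and> \<theta> < a + pi \<and> u = smp c x \<theta>)"
proof -
  have "u \<in> fst (sm_chart A g c a) \<longleftrightarrow>
      (\<exists>x \<theta>. x \<in> chart_range c \<and> a - pi < \<theta> \<and> \<theta> < a + pi \<and> u = sm_param A g c (x, \<theta>))"
    unfolding sm_chart_domain[symmetric] image_iff by (simp add: Bex_def)
  then show ?thesis using sm_param_eq[OF assms] by metis
qed

lemma sm_chart_range:
  assumes "c \<in> A"
  shows "chart_range (sm_chart A g c a) = chart_range c \<times> {a - pi<..<a + pi}"
  unfolding chart_range_def[of "sm_chart A g c a"]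
proof (intro subset_antisym subsetI, elim imageE)
  fix y u assume y: "y = snd (sm_chart A g c a) u" and "u \<in> fst (sm_chart A g c a)"
  then obtain x \<theta> where "x \<in> chart_range c" "a - pi < \<theta>" "\<theta> < a + pi" "u = smp c x \<theta>"
    using sm_chart_fst[OF assms] by auto
  then show "y \<in> chart_range c \<times> {a - pi<..<a + pi}" unfolding y
    using sm_chart_snd[OF assms] by simp
next
  fix z assume "z \<in> chart_range c \<times> {a - pi<..<a + pi}"
  then obtain x \<theta> where z: "z = (x, \<theta>)" and *: "x \<in> chart_range c" "\<theta> \<in> {a - pi<..<a + pi}"
    by blast
  then have "smp c x \<theta> \<in> fst (sm_chart A g c a)" using sm_chart_fst[OF assms] by fastforce
  then show "z \<in> snd (sm_chart A g c a) ` fst (sm_chart A g c a)"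
    unfolding z using sm_chart_snd[OF assms, of x a \<theta>] *
    by (metis greaterThanLessThan_iff image_eqI)
qed

lemma sm_chart_inj_on:
  assumes "c \<in> A"
  shows "inj_on (snd (sm_chart A g c a)) (fst (sm_chart A g c a))"
  unfolding sm_chart_def Let_def by (simp add: inj_on_inv_into)

lemma sm_chart_inv:
  assumes "c \<in> A" "x \<in> chart_range c" "a - pi < \<theta>" "\<theta> < a + pi"
  shows "chart_inv (sm_chart A g c a) (x, \<theta>) = smp c x \<theta>"
proof -
  have "smp c x \<theta> \<in> fst (sm_chart A g c a)" using sm_chart_fst[OF assms(1)] assms by auto
  then show ?thesis
    using inv_into_f_f[OF sm_chart_inj_on[OF assms(1)]] sm_chart_snd[OF assms]
    by (metis chart_inv_def)
qed

lemma sm_charts_at_iff: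
  "C \<in> charts_at SM u \<longleftrightarrow> (\<exists>c a x \<theta>. c \<in> A \<and> C = sm_chart A g c a \<and> x \<in> chart_range c \<and>
     a - pi < \<theta> \<and> \<theta> < a + pi \<and> u = smp c x \<theta>)"
proof -
  have "C \<in> charts_at SM u \<longleftrightarrow> (\<exists>c a. c \<in> A \<and> C = sm_chart A g c a \<and> u \<in> fst (sm_chart A g c a))"
    by (auto simp: charts_at_iff sm_atlas_def)
  then show ?thesis using sm_chart_fst by blast
qed

lemma sm_charts_atE:
  assumes "C \<in> charts_at SM u"
  obtains c a x \<theta> where "c \<in> A" "C = sm_chart A g c a" "x \<in> chart_range c" "a - pi < \<theta>" "\<theta> < a + pi"
    "u = smp c x \<theta>"
  using assms sm_charts_at_iff by blast

lemma sm_charts_atI: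
  "c \<in> A \<Longrightarrow> x \<in> chart_range c \<Longrightarrow> sm_chart A g c \<theta> \<in> charts_at SM (smp c x \<theta>)"
  unfolding sm_charts_at_iff
  by (intro exI[of _ c] exI[of _ \<theta>] exI[of _ x]) simp

lemma smp_in_bundle:
  assumes "c \<in> A" "x \<in> chart_range c"
  shows "smp c x \<theta> \<in> unit_tangent_bundle A g"
  using charts_at_carrier[OF chart_inv_charts_at[OF assms]] snd_smp_tangent[OF assms, of \<theta>]
    metric_coord_vec[OF assms] uvec_unit[OF assms]
  by (simp add: unit_tangent_bundle_def smp_def)

lemma bundle_smp:
  assumes "u \<in> unit_tangent_bundle A g" "c \<in> charts_at A (fst u)"
  shows "\<exists>\<theta>. u = smp c (snd c (fst u)) \<theta>"
proof -
  obtain p v where u: "u = (p, v)" by (cases u)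
  have v: "v \<in> tangent_space A p" "g p v v = 1" and c: "c \<in> charts_at A p"
    using assms by (auto simp: unit_tangent_bundle_def u)
  have "c \<in> A" "snd c p \<in> chart_range c" using c by (auto simp: charts_at_iff snd_in_chart_range)
  moreover have "ip c (snd c p) (v c) (v c) = 1" using metric_coord[OF c v(1) v(1)] v(2) by simp
  ultimately obtain \<theta> where "v c = uvec c (snd c p) \<theta>" using uvec_surj by blast
  then show ?thesis using smp_eqI[OF c v(1)] unfolding u fst_conv by blast
qed

lemma carrier_SM: "carrier SM = unit_tangent_bundle A g"
proof (rule set_eqI)
  fix u
  show "u \<in> carrier SM \<longleftrightarrow> u \<in> unit_tangent_bundle A g"
  proof
    assume "u \<in> carrier SM"
    then obtain C where "C \<in> charts_at SM u" unfolding carrier_iff by blast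
    then show "u \<in> unit_tangent_bundle A g" by (rule sm_charts_atE) (simp add: smp_in_bundle)
  next
    assume u: "u \<in> unit_tangent_bundle A g"
    then have "fst u \<in> carrier A" by (auto simp: unit_tangent_bundle_def)
    then obtain c where c: "c \<in> charts_at A (fst u)" unfolding carrier_iff by blast
    then have "c \<in> A" "snd c (fst u) \<in> chart_range c"
      by (auto simp: charts_at_iff snd_in_chart_range)
    then show "u \<in> carrier SM"
      using bundle_smp[OF u c] sm_charts_atI charts_at_carrier by metis
  qed
qed

text \<open>A change of chart sends \<open>(x, \<theta>)\<close> to the new base coordinates and the
  angle of the transported unit vector. Measuring this angle in the half plane around
  \<open>\<theta>1\<close> fixes its branch near the given point.\<close>

lemma smp_transition:
  assumes "c \<in> A" "x0 \<in> chart_range c" "d \<in> A" "x1 \<in> chart_range d" "smp c x0 \<theta>0 = smp d x1 \<theta>1"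
  obtains T where "T differentiable (at (x0, \<theta>0))" "T (x0, \<theta>0) = (x1, \<theta>1)"
    "\<forall>\<^sub>F z in nhds (x0, \<theta>0). fst z \<in> chart_range c \<and> fst (T z) = transition c d (fst z) \<and>
       fst (T z) \<in> chart_range d \<and> smp c (fst z) (snd z) = smp d (fst (T z)) (snd (T z))"
proof -
  let ?p = "chart_inv c x0" and ?t = "transition c d"
  let ?S = "snd c ` (fst c \<inter> fst d)"
  have p: "?p = chart_inv d x1" using assms(5) by (simp add: smp_def)
  have cd: "c \<in> charts_at A ?p" "d \<in> charts_at A ?p"
    using chart_inv_charts_at assms(1-4) p by metis+
  have x0: "snd c ?p = x0" and x1: "snd d ?p = x1"
    using snd_chart_inv assms(2,4) p by metis+
  have S: "open ?S" "smooth_on ?t ?S" using smooth_A assms(1,3) by (auto simp: smooth_atlas_def)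
  have x0S: "x0 \<in> ?S" using cd x0 by (force simp: charts_at_iff)
  have tS: "?t differentiable (at x)" if "x \<in> ?S" for x
    using smooth_on_differentiable[OF S(2,1) that] .
  have t0: "?t x0 = x1" using transition_apply[OF cd(1), of d] x0 x1 by simp
  \<comment> \<open>The derivative of the transition map applied to the unit vector. Since the
    direction moves with \<open>z\<close>, it is split along the axes, which leaves products of
    differentiable functions.\<close>
  define W where "W z = (uvec c (fst z) (snd z) $ 1) *\<^sub>R frechet_derivative ?t (at (fst z)) (axis
    1 1)
     + (uvec c (fst z) (snd z) $ 2) *\<^sub>R frechet_derivative ?t (at (fst z)) (axis 2 1)" for z
  have W: "W z = frechet_derivative ?t (at (fst z)) (uvec c (fst z) (snd z))" if "fst z \<in> ?S" for z
    unfolding W_def by (rule linear_axis2[OF linear_frechet[OF tS[OF that]], symmetric])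
  have snd_d: "snd (smp c x \<theta>) d = W (x, \<theta>)" "?t x \<in> chart_range d" "chart_inv d (?t x) =
    chart_inv c x"
     "d \<in> charts_at A (chart_inv c x)" if xS: "x \<in> ?S" for x \<theta>
  proof -
    obtain q where q: "q \<in> fst c" "q \<in> fst d" "x = snd c q" using xS by blast
    then have cq: "c \<in> charts_at A q" "d \<in> charts_at A q" using assms(1,3)
      by (auto simp: charts_at_iff)
    then have q': "chart_inv c x = q" "?t x = snd d q"
      by (simp_all add: q(3) chart_inv_snd_at transition_apply)
    show "d \<in> charts_at A (chart_inv c x)" using cq q' by simp
    show "?t x \<in> chart_range d" "chart_inv d (?t x) = chart_inv c x"
      using cq q' by (simp_all add: chart_inv_snd_at charts_at_iff snd_in_chart_range)
    have x: "x \<in> chart_range c" using q by (auto simp: chart_range_def)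
    have "snd (smp c x \<theta>) \<in> tangent_space A q" using snd_smp_tangent[OF assms(1) x] q' by simp
    from tangent_transition[OF this cq] show "snd (smp c x \<theta>) d = W (x, \<theta>)"
      using W[of "(x, \<theta>)"] xS snd_smp_coord[OF assms(1) x, of \<theta>] unfolding q(3) by simp
  qed
  have W0: "W (x0, \<theta>0) = uvec d x1 \<theta>1"
    using snd_d(1)[OF x0S, of \<theta>0] assms(5) snd_smp_coord[OF assms(3,4)] by simp
  have dW: "W differentiable (at (x0, \<theta>0))"
  proof -
    have "(\<lambda>z. frechet_derivative ?t (at (fst z)) e) differentiable (at (x0, \<theta>0))" for e
      by (rule differentiable_chain[OF differentiable_fst[OF differentiable_ident]])
        (use smooth_on_differentiable[OF smooth_on_frechet[OF S(2)] S(1) x0S] in simp)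
    moreover have "(\<lambda>z. uvec c (fst z) (snd z)) differentiable (at (x0, \<theta>0))"
      by (rule uvec_differentiable[OF assms(1,2)])
    ultimately show ?thesis
      unfolding W_def[abs_def] by (intro differentiable_add differentiable_scaleR
        differentiable_vec_nth)
  qed
  have dt: "(\<lambda>z::(real^2)\<times>real. ?t (fst z)) differentiable (at (x0, \<theta>0))"
    by (rule differentiable_chain[OF differentiable_fst[OF differentiable_ident]]) (use tS[OF x0S]
      in simp)
  have pos0: "0 < ip d x1 (uvec d x1 \<theta>1) (uvec d x1 \<theta>1)" using uvec_unit[OF assms(3,4)] by simp
  define T where "T z = (?t (fst z), angle d \<theta>1 (?t (fst z)) (W z))" for z
  have "(\<lambda>z. angle d \<theta>1 (?t (fst z)) (W z)) differentiable (at (x0, \<theta>0))"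
    by (rule angle_differentiable[OF assms(3,4) pos0 dt dW]) (simp_all add: t0 W0)
  then have dT: "T differentiable (at (x0, \<theta>0))"
    unfolding T_def[abs_def] using dt by (rule differentiable_Pair[rotated])
  have T0: "T (x0, \<theta>0) = (x1, \<theta>1)"
    using angle_uvec[OF assms(3,4), of 1 \<theta>1 \<theta>1] by (simp add: T_def t0 W0)
  have evS: "\<forall>\<^sub>F z in nhds (x0, \<theta>0). fst z \<in> ?S"
    by (rule topological_tendstoD[OF _ S(1)])
      (use differentiable_imp_tendsto_nhds[OF differentiable_fst[OF differentiable_ident], of
        "(x0, \<theta>0)"] x0S in auto)
  have du: "(\<lambda>z::(real^2)\<times>real. uvec d (?t (fst z)) \<theta>1) differentiable (at (x0, \<theta>0))"
    using differentiable_chain[of "\<lambda>z. (?t (fst z), \<theta>1)" "(x0, \<theta>0)" "\<lambda>z. uvec d (fst z) (snd z)"]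
      uvec_differentiable[OF assms(3,4), of \<theta>1] dt by (simp add: t0)
  have "(\<lambda>z. ip d (?t (fst z)) (W z) (uvec d (?t (fst z)) \<theta>1)) differentiable (at (x0, \<theta>0))"
    by (rule ip_differentiable[OF assms(3,4) dt dW du]) (simp add: t0)
  from order_tendstoD(1)[OF differentiable_imp_tendsto_nhds[OF this], of 0]
  have evpos: "\<forall>\<^sub>F z in nhds (x0, \<theta>0). 0 < ip d (?t (fst z)) (W z) (uvec d (?t (fst z)) \<theta>1)"
    using pos0 by (simp add: t0 W0)
  have "\<forall>\<^sub>F z in nhds (x0, \<theta>0). fst z \<in> chart_range c \<and> fst (T z) = transition c d (fst z) \<and>
       fst (T z) \<in> chart_range d \<and> smp c (fst z) (snd z) = smp d (fst (T z)) (snd (T z))"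
    using evS evpos
  proof eventually_elim
    case (elim z)
    let ?x = "fst z"
    have x: "?x \<in> chart_range c" using elim(1) by (auto simp: chart_range_def)
    note sd = snd_d[OF elim(1)]
    let ?u = "smp c ?x (snd z)"
    have v: "snd ?u \<in> tangent_space A (chart_inv c ?x)" by (rule snd_smp_tangent[OF assms(1) x])
    have sd1: "snd d (chart_inv c ?x) = ?t ?x" using sd(3) snd_chart_inv[OF sd(2)] by metis
    \<comment> \<open>The length of the vector does not depend on the chart, so the radius in the
      polar decomposition over \<open>d\<close> is 1.\<close>
    have "g (chart_inv c ?x) (snd ?u) (snd ?u) = 1"
      using metric_coord_vec[OF assms(1) x] uvec_unit[OF assms(1) x] by (simp add: smp_def)
    then have "ip d (?t ?x) (W z) (W z) = 1"
      using metric_coord[OF sd(4) v v] sd(1)[of "snd z"] sd1 by simp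
    then have "W z = uvec d (?t ?x) (angle d \<theta>1 (?t ?x) (W z))"
      using polar_decomposition[OF assms(3) sd(2) elim(2)] by simp
    then have "snd ?u d = uvec d (snd d (chart_inv c ?x)) (snd (T z))"
      using sd(1)[of "snd z"] sd1 by (simp add: T_def)
    from smp_eqI[OF sd(4) v this] have "?u = smp d (?t ?x) (snd (T z))"
      unfolding sd1 by (metis fst_smp prod.collapse)
    then show ?case using x sd(2) by (simp add: T_def)
  qed
  with dT T0 show ?thesis by (rule that)
qed

lemma eventually_in_interval:
  fixes x :: "'x::real_normed_vector"
  shows "(a::real) < \<theta> \<Longrightarrow> \<theta> < b \<Longrightarrow> \<forall>\<^sub>F z in nhds (x, \<theta>). a < snd z \<and> snd z < b"
  using differentiable_imp_tendsto_nhds[OF differentiable_snd[OF differentiable_ident], of "(x, \<theta>)"]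
  by (auto intro!: eventually_conj order_tendstoD)

text \<open>Two charts of the bundle may have different angle windows. Near a common point both
  angles stay inside their windows, and there the transition map is the map \<open>T\<close> of
  \<open>smp_transition\<close>.\<close>

lemma diff_atlas_SM: "diff_atlas SM"
proof
  fix C assume "C \<in> SM"
  then show "inj_on (snd C) (fst C)" using sm_chart_inj_on by (auto simp: sm_atlas_def)
next
  fix u C D assume "C \<in> charts_at SM u" "D \<in> charts_at SM u"
  then obtain c a x \<theta> d b y \<eta> where C: "c \<in> A" "C = sm_chart A g c a" "x \<in> chart_range c"
      "a - pi < \<theta>" "\<theta> < a + pi" "u = smp c x \<theta>"
    and D: "d \<in> A" "D = sm_chart A g d b" "y \<in> chart_range d" "b - pi < \<eta>" "\<eta> < b + pi" "u =
      smp d y \<eta>"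
    by (elim sm_charts_atE) blast
  have eq: "smp c x \<theta> = smp d y \<eta>" using C(6) D(6) by simp
  obtain T where T: "T differentiable (at (x, \<theta>))" "T (x, \<theta>) = (y, \<eta>)"
    and ev: "\<forall>\<^sub>F z in nhds (x, \<theta>). fst z \<in> chart_range c \<and> fst (T z) = transition c d (fst z) \<and>
       fst (T z) \<in> chart_range d \<and> smp c (fst z) (snd z) = smp d (fst (T z)) (snd (T z))"
    by (rule smp_transition[OF C(1,3) D(1,3) eq])
  have u: "snd C u = (x, \<theta>)" using C sm_chart_snd by simp
  have e1: "\<forall>\<^sub>F z in nhds (x, \<theta>). a - pi < snd z \<and> snd z < a + pi"
    by (rule eventually_in_interval[OF C(4,5)])
  have "\<forall>\<^sub>F z in nhds (x, \<theta>). b - pi < snd (T z) \<and> snd (T z) < b + pi"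
    using differentiable_imp_tendsto_nhds[OF differentiable_snd[OF T(1)]] T(2) D(4,5)
    by (auto intro!: eventually_conj order_tendstoD)
  with ev e1 have main: "\<forall>\<^sub>F z in nhds (x, \<theta>). z \<in> chart_range C \<and> chart_inv C z \<in> fst D \<and>
     transition C D z = T z"
  proof eventually_elim
    case (elim z)
    have z: "chart_inv C z = smp c (fst z) (snd z)"
      using sm_chart_inv[OF C(1), of "fst z" a "snd z"] elim C(2) by simp
    have "transition C D z = snd D (smp d (fst (T z)) (snd (T z)))"
      using elim z by (simp add: transition_def)
    also have "\<dots> = (fst (T z), snd (T z))"
      unfolding D(2) by (rule sm_chart_snd[OF D(1)]) (use elim in auto)
    finally have "transition C D z = T z" by simp
    moreover have "chart_inv C z \<in> fst D"
      unfolding z D(2) using sm_chart_fst[OF D(1)] elim by blast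
    moreover have "z \<in> chart_range C"
      unfolding C(2) sm_chart_range[OF C(1)] using elim by (cases z) simp
    ultimately show ?case by simp
  qed
  show "\<forall>\<^sub>F z in nhds (snd C u). z \<in> chart_range C \<and> chart_inv C z \<in> fst D"
    unfolding u using main by eventually_elim simp
  have "\<forall>\<^sub>F z in nhds (x, \<theta>). transition C D z = T z"
    using main by eventually_elim simp
  then show "transition C D differentiable (at (snd C u))"
    unfolding u by (rule differentiable_eventually_eq[OF T(1)])
qed

sublocale SM: diff_atlas SM
  by (rule diff_atlas_SM)

text \<open>Rotation of the fibre is a translation of the angle in every chart. This makes the
  coordinates of \<open>V\<close> constant, so that brackets with \<open>V\<close> reduce to
  derivatives in the angle.\<close>

lemma vertical_velocity:
  assumes "C \<in> charts_at SM u"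
  shows "\<forall>\<^sub>F t in nhds 0. rotate_fiber A g t u \<in> fst C \<and> snd C (rotate_fiber A g t u) =
    snd C u + (0, t)"
proof -
  obtain c a x \<theta> where C: "c \<in> A" "C = sm_chart A g c a" "x \<in> chart_range c"
      "a - pi < \<theta>" "\<theta> < a + pi" "u = smp c x \<theta>"
    using assms by (rule sm_charts_atE)
  have "((\<lambda>t. \<theta> + t) \<longlongrightarrow> \<theta> + 0) (nhds (0::real))" 
    by (rule differentiable_imp_tendsto_nhds) simp
  then have "\<forall>\<^sub>F t in nhds 0. a - pi < \<theta> + t \<and> \<theta> + t < a + pi"
    using C by (intro eventually_conj order_tendstoD) auto
  then show ?thesis
  proof eventually_elim
    case (elim t)
    have "rotate_fiber A g t u = smp c x (\<theta> + t)" using rotate_smp C by simp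
    moreover have "smp c x (\<theta> + t) \<in> fst C" unfolding C(2) using sm_chart_fst[OF C(1)] elim C(3)
      by blast
    ultimately show ?case using sm_chart_snd[OF C(1,3)] elim C by simp
  qed
qed

lemma rotate_fiber_0: "C \<in> charts_at SM u \<Longrightarrow> rotate_fiber A g 0 u = u"
  by (elim sm_charts_atE) (simp add: rotate_smp)

lemma rotate_fiber_curve:
  assumes "C \<in> charts_at SM u"
  shows "((snd C \<circ> (\<lambda>t. rotate_fiber A g t u)) has_vector_derivative (0, 1)) (at 0)"
proof (rule has_vector_derivative_eventually_eq)
  show "((\<lambda>t. snd C u + (0, t)) has_vector_derivative (0, 1)) (at 0)"
    unfolding has_vector_derivative_def by (auto intro!: derivative_eq_intros)
  show "\<forall>\<^sub>F t in nhds 0. (snd C \<circ> (\<lambda>t. rotate_fiber A g t u)) t = snd C u + (0, t)"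
    using vertical_velocity[OF assms] by eventually_elim simp
qed

lemma diff_curve_rotate:
  assumes "u \<in> carrier SM"
  shows "diff_curve SM (\<lambda>t. rotate_fiber A g t u) 0"
proof -
  obtain C0 where C0: "C0 \<in> charts_at SM u" using assms unfolding carrier_iff by blast
  have *: "(\<forall>\<^sub>F t in nhds 0. rotate_fiber A g t u \<in> fst C) \<and>
      (snd C \<circ> (\<lambda>t. rotate_fiber A g t u)) differentiable (at 0)" if "C \<in> charts_at SM u" for C
  proof
    show "\<forall>\<^sub>F t in nhds 0. rotate_fiber A g t u \<in> fst C"
      using vertical_velocity[OF that] by eventually_elim simp
    show "(snd C \<circ> (\<lambda>t. rotate_fiber A g t u)) differentiable (at 0)"
      using rotate_fiber_curve[OF that] by (rule differentiableI_vector)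
  qed
  show ?thesis
    unfolding diff_curve_def rotate_fiber_0[OF C0] using * assms by blast
qed

lemma vertical_tangent: "u \<in> carrier SM \<Longrightarrow> vertical_field A g u \<in> tangent_space SM u"
proof -
  assume u: "u \<in> carrier SM"
  then obtain C where C: "C \<in> charts_at SM u" unfolding carrier_iff by blast
  show ?thesis
    using velocity_tangent[OF diff_atlas_SM diff_curve_rotate[OF u]]
    unfolding vertical_field_def rotate_fiber_0[OF C] .
qed

lemma vertical_coord: "C \<in> charts_at SM u \<Longrightarrow> vertical_field A g u C = (0, 1)"
  using vector_derivative_at[OF rotate_fiber_curve] rotate_fiber_0[of C u]
  by (simp add: vertical_field_def velocity_def)

section \<open>The geodesic vector field\<close>

text \<open>The derivative of the metric coefficients in the direction \<open>b\<close>, as a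
  bilinear form in \<open>y\<close> and \<open>z\<close>.\<close>

definition dip :: "('m, real^2) chart \<Rightarrow> real^2 \<Rightarrow> real^2 \<Rightarrow> real^2 \<Rightarrow> real^2 \<Rightarrow> real" where
  "dip c x b y z = frechet_derivative (gE c) (at x) b * y $ 1 * z $ 1
     + frechet_derivative (gF c) (at x) b * (y $ 1 * z $ 2 + y $ 2 * z $ 1)
     + frechet_derivative (gG c) (at x) b * y $ 2 * z $ 2"

lemma ip_has_derivative:
  assumes "c \<in> A" "X w \<in> chart_range c" "(X has_derivative X') (at w)" "(Y has_derivative Y') (at
    w)"
    "(Z has_derivative Z') (at w)"
  shows "((\<lambda>w. ip c (X w) (Y w) (Z w)) has_derivative
    (\<lambda>b. dip c (X w) (X' b) (Y w) (Z w) + ip c (X w) (Y' b) (Z w) + ip c (X w) (Y w) (Z' b)))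
      (at w)"
proof -
  have g: "((\<lambda>w. f (X w)) has_derivative (\<lambda>b. frechet_derivative f (at (X w)) (X' b))) (at w)"
    if "f differentiable (at (X w))" for f :: "real^2 \<Rightarrow> real"
    by (rule has_derivative_compose[OF assms(3) frechet_has_derivative[OF that]])
  note gs = gEFG_differentiable(1-3)[OF assms(1,2), THEN g]
  have n: "((\<lambda>w. Y w $ i) has_derivative (\<lambda>b. Y' b $ i)) (at w)"
    "((\<lambda>w. Z w $ i) has_derivative (\<lambda>b. Z' b $ i)) (at w)" for i
    using assms(4,5) by (auto intro: bounded_linear.has_derivative[OF bounded_linear_vec_nth])
  show ?thesis
    unfolding ip_def dip_def
    by (rule derivative_eq_intros gs n refl)+ (auto simp: algebra_simps)
qed

definition spray :: "('m, real^2) chart \<Rightarrow> real^2 \<Rightarrow> real^2 \<Rightarrow> real^2" where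
  "spray c x v = (\<chi> k. \<Sum>i\<in>UNIV. \<Sum>j\<in>UNIV. christoffel A g c x k i j * (v $ i) * (v $ j))"

text \<open>Koszul's formula on the diagonal. Pairing with \<open>w\<close> multiplies the
  Christoffel symbols by the metric matrix and so cancels \<open>matrix_inv\<close>; only first
  derivatives of the metric remain.\<close>

lemma spray_koszul:
  assumes "c \<in> A" "x \<in> chart_range c"
  shows "ip c x (spray c x v) w = dip c x v v w - dip c x w v v / 2"
proof -
  let ?M = "metric_matrix A g c x"
  define dg where "dg = (\<lambda>i a b. frechet_derivative (\<lambda>y. metric_matrix A g c y $ a $ b) (at x)
    (axis i 1))"
  \<comment> \<open>The Christoffel symbols of the first kind, contracted twice with
    \<open>v\<close>.\<close>
  define t :: "real^2" where "t = (\<chi> m. (\<Sum>i\<in>UNIV. \<Sum>j\<in>UNIV. (dg i j m + dg j i m - dg m i j) * v $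
    i * v $ j) / 2)"
  have M: "?M $ 1 $ 1 = gE c x" "?M $ 1 $ 2 = gF c x" "?M $ 2 $ 1 = gF c x" "?M $ 2 $ 2 = gG c x"
    using metric_matrix_sym[OF assms, of 2 1] by (simp_all add: gE_def gF_def gG_def)
  have "det ?M \<noteq> 0" using gD_pos[OF assms] by (simp add: det_2 M gD_def)
  then have "invertible ?M" by (simp add: invertible_det_nz)
  then have inv: "?M ** matrix_inv ?M = mat 1"
    unfolding invertible_def matrix_inv_def by (rule someI2_ex) simp
  have "spray c x v = matrix_inv ?M *v t"
    by (rule vec2_eqI)
       (simp_all add: spray_def christoffel_def Let_def dg_def[symmetric]
         t_def matrix_vector_mult_def sum_2 field_simps)
  then have Ms: "?M *v spray c x v = t"
    by (simp add: matrix_vector_mul_assoc inv)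
  have "gE c x * spray c x v $ 1 + gF c x * spray c x v $ 2 = t $ 1"
    "gF c x * spray c x v $ 1 + gG c x * spray c x v $ 2 = t $ 2"
    unfolding Ms[symmetric] by (simp_all add: matrix_vector_mult_def sum_2 M)
  then have "ip c x (spray c x v) w = t $ 1 * w $ 1 + t $ 2 * w $ 2"
    by (simp add: ip_def algebra_simps flip: distrib_left distrib_right)
  moreover have "frechet_derivative (gE c) (at x) b = b $ 1 * dg 1 1 1 + b $ 2 * dg 2 1 1"
    "frechet_derivative (gF c) (at x) b = b $ 1 * dg 1 1 2 + b $ 2 * dg 2 1 2"
    "frechet_derivative (gG c) (at x) b = b $ 1 * dg 1 2 2 + b $ 2 * dg 2 2 2" for b
    using linear_axis2[OF linear_frechet[OF gEFG_differentiable(1)[OF assms]], of b]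
      linear_axis2[OF linear_frechet[OF gEFG_differentiable(2)[OF assms]], of b]
      linear_axis2[OF linear_frechet[OF gEFG_differentiable(3)[OF assms]], of b]
    by (simp_all add: dg_def gE_def[abs_def] gF_def[abs_def] gG_def[abs_def])
  moreover have "dg i 2 1 = dg i 1 2" for i
  proof -
    have "\<forall>\<^sub>F y in nhds x. metric_matrix A g c y $ 2 $ 1 = metric_matrix A g c y $ 1 $ 2"
      unfolding eventually_nhds using open_chart_range[OF assms(1)] assms metric_matrix_sym by blast
    from frechet_eventually_eq[OF this] show ?thesis by (simp add: dg_def)
  qed
  ultimately show ?thesis
    by (simp add: dip_def t_def sum_2 field_simps)
qed

lemma ip_nondegenerate:
  assumes "c \<in> A" "x \<in> chart_range c" "\<And>w. ip c x y w = ip c x z w"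
  shows "y = z"
proof -
  have "ip c x (y + (-1) *\<^sub>R z) (y - z) = 0"
    unfolding ip_add_left ip_scale_left using assms(3)[of "y - z"] by simp
  then have "ip c x (y - z) (y - z) = 0" by simp
  then show ?thesis using ip_pos[OF assms(1,2), of "y - z"] by force
qed

lemma overlap:
  assumes "c \<in> A" "d \<in> A"
  shows "open (snd c ` (fst c \<inter> fst d))" "smooth_on (transition c d) (snd c ` (fst c \<inter> fst d))"
  using smooth_A assms by (auto simp: smooth_atlas_def)

lemma overlap_charts_at:
  assumes "c \<in> A" "d \<in> A" "x \<in> snd c ` (fst c \<inter> fst d)"
  shows "c \<in> charts_at A (chart_inv c x)" "d \<in> charts_at A (chart_inv c x)" "x \<in> chart_range c"
    "snd c (chart_inv c x) = x" "snd d (chart_inv c x) =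
      transition c d x" "transition c d x \<in> chart_range d"
proof -
  obtain q where q: "q \<in> fst c" "q \<in> fst d" "x = snd c q" using assms(3) by blast
  then have "c \<in> charts_at A q" "d \<in> charts_at A q" using assms(1,2) by (auto simp: charts_at_iff)
  then show "c \<in> charts_at A (chart_inv c x)" "d \<in> charts_at A (chart_inv c x)" "x \<in> chart_range c"
    "snd c (chart_inv c x) = x" "snd d (chart_inv c x) =
      transition c d x" "transition c d x \<in> chart_range d"
    using q by (simp_all add: chart_inv_snd_at transition_apply charts_at_iff snd_in_chart_range)
qed

lemma in_overlap: "c \<in> charts_at A p \<Longrightarrow> d \<in> charts_at A p \<Longrightarrow> snd c p \<in> snd c ` (fst c \<inter> fst d)"
  by (simp add: charts_at_iff)

lemma tangent_coord_change:
  assumes "c \<in> A" "d \<in> A" "x \<in> snd c ` (fst c \<inter> fst d)" "v \<in> tangent_space A (chart_inv c x)"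
  shows "v d = frechet_derivative (transition c d) (at x) (v c)"
  using tangent_transition[OF assms(4) overlap_charts_at(1,2)[OF assms(1-3)]]
  by (simp add: overlap_charts_at(4)[OF assms(1-3)])

lemma ip_transition:
  assumes "c \<in> A" "d \<in> A" "x \<in> snd c ` (fst c \<inter> fst d)"
  shows "ip c x v w = ip d (transition c d x) (frechet_derivative (transition c d) (at x) v)
     (frechet_derivative (transition c d) (at x) w)"
proof -
  let ?p = "chart_inv c x"
  note o = overlap_charts_at[OF assms]
  let ?v = "coord_vec A c ?p v" and ?w = "coord_vec A c ?p w"
  have t: "?v \<in> tangent_space A ?p" "?w \<in> tangent_space A ?p" using coord_vec_tangent[OF o(1)]
    by auto
  have "ip c x v w = ip d (transition c d x) (?v d) (?w d)"
    using metric_coord[OF o(1) t] metric_coord[OF o(2) t]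
    by (simp add: coord_vec_coord[OF o(1)] o(4,5))
  then show ?thesis
    using tangent_coord_change[OF assms t(1)] tangent_coord_change[OF assms t(2)]
    by (simp add: coord_vec_coord[OF o(1)])
qed

definition hess :: "('m, real^2) chart \<Rightarrow> ('m, real^2) chart \<Rightarrow> real^2 \<Rightarrow> real^2 \<Rightarrow> real^2 \<Rightarrow> real^2"
  where
  "hess c d x v b = frechet_derivative (\<lambda>y. frechet_derivative (transition c d) (at y) v) (at x) b"

text \<open>The transformation law of the Christoffel symbols. Differentiating the invariance of the
  metric relates the forms \<open>dip\<close> of both charts through \<open>hess\<close>; in
  Koszul's combination the terms with \<open>hess c d x v w\<close> cancel because second
  derivatives commute, and only \<open>hess c d x v v\<close> is left.\<close>

lemma christoffel_transition:
  assumes "c \<in> A" "d \<in> A" "x \<in> snd c ` (fst c \<inter> fst d)"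
  defines "L \<equiv> frechet_derivative (transition c d) (at x)"
  shows "L (spray c x v) = spray d (transition c d x) (L v) + hess c d x v v"
proof -
  let ?t = "transition c d" and ?S = "snd c ` (fst c \<inter> fst d)"
  note o = overlap_charts_at[OF assms(1-3)]
  note S = overlap[OF assms(1,2)]
  have td: "(?t has_derivative L) (at x)"
    unfolding L_def by (rule frechet_has_derivative[OF smooth_on_differentiable[OF S(2,1)
      assms(3)]])
  have hd: "((\<lambda>y. frechet_derivative ?t (at y) v) has_derivative (\<lambda>b. hess c d x v b)) (at x)" for v
    unfolding hess_def
    by (rule frechet_has_derivative[OF smooth_on_differentiable[OF smooth_on_frechet[OF S(2)] S(1)
      assms(3)]])
  have sym: "hess c d x v w = hess c d x w v" for v w
    unfolding hess_def by (rule second_derivative_symmetric[OF S(2,1) assms(3)])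
  have dip: "dip c x b v w = dip d (?t x) (L b) (L v) (L w) + ip d (?t x) (hess c d x v b) (L w)
      + ip d (?t x) (L v) (hess c d x w b)" for b v w
  proof -
    have "((\<lambda>y. ip c y v w) has_derivative (\<lambda>b. dip c x b v w)) (at x)"
      using ip_has_derivative[OF assms(1) o(3) has_derivative_ident has_derivative_const
        has_derivative_const, of v w]
      by (simp add: ip_def)
    moreover have "((\<lambda>y. ip c y v w) has_derivative (\<lambda>b. dip d (?t x) (L b) (L v) (L w)
        + ip d (?t x) (hess c d x v b) (L w) + ip d (?t x) (L v) (hess c d x w b))) (at x)"
    proof (rule has_derivative_eventually_eq)
      show "((\<lambda>y. ip d (?t y) (frechet_derivative ?t (at y) v) (frechet_derivative ?t (at y) w))
        has_derivative
         (\<lambda>b. dip d (?t x) (L b) (L v) (L w)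
        + ip d (?t x) (hess c d x v b) (L w) + ip d (?t x) (L v) (hess c d x w b))) (at x)"
        using ip_has_derivative[OF assms(2) o(6) td hd hd, of v w] by (simp add: L_def)
      show "\<forall>\<^sub>F y in nhds x. ip c y v w =
          ip d (?t y) (frechet_derivative ?t (at y) v) (frechet_derivative ?t (at y) w)"
        unfolding eventually_nhds using S(1) assms(3) ip_transition[OF assms(1,2)] by blast
    qed
    ultimately have "(\<lambda>b. dip c x b v w) = (\<lambda>b. dip d (?t x) (L b) (L v) (L w)
        + ip d (?t x) (hess c d x v b) (L w) + ip d (?t x) (L v) (hess c d x w b))"
      by (rule has_derivative_unique)
    from fun_cong[OF this, of b] show ?thesis .
  qed
  have L: "ip d (?t x) (L (spray c x v)) (L w) =
      ip d (?t x) (spray d (?t x) (L v) + hess c d x v v) (L w)" for w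
  proof -
    have "ip d (?t x) (L (spray c x v)) (L w) = dip c x v v w - dip c x w v v / 2"
      using ip_transition[OF assms(1-3), of "spray c x v" w] spray_koszul[OF assms(1) o(3)]
      by (simp add: L_def)
    also have "\<dots> = dip d (?t x) (L v) (L v) (L w) - dip d (?t x) (L w) (L v) (L v) / 2
        + ip d (?t x) (hess c d x v v) (L w)"
      unfolding dip[of v v w] dip[of w v v] using sym[of w v]
        ip_sym[of d "?t x" "hess c d x v w" "L v"] by (simp add: field_simps)
    also have "\<dots> = ip d (?t x) (spray d (?t x) (L v) + hess c d x v v) (L w)"
      using spray_koszul[OF assms(2) o(6)] by (simp add: ip_add_left)
    finally show ?thesis .
  qed
  show ?thesis
  proof (rule ip_nondegenerate[OF assms(2) o(6)])
    fix w
    \<comment> \<open>\<open>L\<close> is onto, with the derivative of the reverse transition map as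
      right inverse, so testing against vectors \<open>L w\<close> is enough.\<close>
    have "L (frechet_derivative (transition d c) (at (?t x)) w) = w"
      using transition_cocycle[OF o(2,1,2), of w] transition_self[OF o(2)]
      by (simp add: L_def o(4,5))
    then show "ip d (?t x) (L (spray c x v)) w =
      ip d (?t x) (spray d (?t x) (L v) + hess c d x v v) w"
      using L by metis
  qed
qed

text \<open>The geodesic field is prescribed through base coordinates and vector components, whereas
  tangent vectors of the bundle are read in \<open>(x, \<theta>)\<close>. In the chart
  \<open>d\<close> a unit vector is the derivative of the transition map at \<open>x\<close> applied
  to \<open>uvec c x \<theta>\<close>; since \<open>x\<close> moves too, the second claim contains
  \<open>hess\<close>.\<close>

lemma smp_dir_derivs:
  assumes c: "c \<in> A" "C = sm_chart A g c a" "x \<in> chart_range c" "a - pi < \<theta>" "\<theta> < a + pi" "u =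
    smp c x \<theta>"
    and d: "d \<in> charts_at A (fst u)" and \<xi>: "\<xi> \<in> tangent_space SM u"
  shows "dir_deriv SM (\<lambda>w. snd d (fst w)) u \<xi> = frechet_derivative (transition c d) (at x) (fst (\<xi>
    C))"
    and "dir_deriv SM (\<lambda>w. snd w d) u \<xi> = frechet_derivative (transition c d) (at x)
        (frechet_derivative (\<lambda>z. uvec c (fst z) (snd z)) (at (x, \<theta>)) (\<xi> C))
      + hess c d x (uvec c x \<theta>) (fst (\<xi> C))"
proof -
  let ?t = "transition c d" and ?S = "snd c ` (fst c \<inter> fst d)"
  have C: "C \<in> charts_at SM u" using c sm_charts_at_iff by blast
  have Cu: "snd C u = (x, \<theta>)" using sm_chart_snd c by simp
  have dA: "d \<in> A" using d by (simp add: charts_at_iff)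
  have "chart_inv c x \<in> fst c \<inter> fst d" using d chart_inv_in[OF c(3)]
    by (simp add: c(6) fst_smp charts_at_iff)
  then have xS: "x \<in> ?S" using snd_chart_inv[OF c(3)] by (metis imageI)
  note S = overlap[OF c(1) dA]
  have td: "(?t has_derivative frechet_derivative ?t (at x)) (at x)"
    by (rule frechet_has_derivative[OF smooth_on_differentiable[OF S(2,1) xS]])
  have f: "((\<lambda>z::(real^2)\<times>real. fst z) has_derivative fst) (at (x, \<theta>))"
    by (rule bounded_linear_imp_has_derivative[OF bounded_linear_fst])
  have ev: "\<forall>\<^sub>F z in nhds (x, \<theta>). fst z \<in> ?S \<and> a - pi < snd z \<and> snd z < a + pi"
  proof (intro eventually_conj[OF _ eventually_in_interval[OF c(4,5)]])
    show "\<forall>\<^sub>F z in nhds (x, \<theta>). fst z \<in> ?S"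
      by (rule topological_tendstoD[OF _ S(1)])
        (use differentiable_imp_tendsto_nhds[OF differentiable_fst[OF differentiable_ident], of
          "(x, \<theta>)"] xS in auto)
  qed
  have ci: "chart_inv C z = smp c (fst z) (snd z)"
    if "fst z \<in> ?S" "a - pi < snd z" "snd z < a + pi" for z
    using sm_chart_inv[OF c(1) overlap_charts_at(3)[OF c(1) dA that(1)] that(2,3)] c(2) by simp
  have "(((\<lambda>w. snd d (fst w)) \<circ> chart_inv C) has_derivative (\<lambda>b. frechet_derivative ?t (at x) (fst
    b))) (at (x, \<theta>))"
  proof (rule has_derivative_eventually_eq)
    show "((\<lambda>z. ?t (fst z)) has_derivative (\<lambda>b. frechet_derivative ?t (at x) (fst b))) (at (x, \<theta>))"
      using has_derivative_compose[OF f, of ?t "frechet_derivative ?t (at x)"] td by simp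
    show "\<forall>\<^sub>F z in nhds (x, \<theta>). ((\<lambda>w. snd d (fst w)) \<circ> chart_inv C) z = ?t (fst z)"
      using ev by eventually_elim (simp add: ci fst_smp transition_def)
  qed
  from SM.dir_deriv_coord[OF \<xi> C, of "\<lambda>w. snd d (fst w)"] this
  show "dir_deriv SM (\<lambda>w. snd d (fst w)) u \<xi> = frechet_derivative ?t (at x) (fst (\<xi> C))"
    unfolding Cu by (simp add: frechet_eqI differentiableI)
  let ?U = "\<lambda>z. uvec c (fst z) (snd z)"
  let ?U' = "frechet_derivative ?U (at (x, \<theta>))"
  let ?d = "\<lambda>z e. frechet_derivative ?t (at (fst z)) e"
  have U: "(?U has_derivative ?U') (at (x, \<theta>))"
    by (rule frechet_has_derivative[OF uvec_differentiable[OF c(1,3)]])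
  have Un: "((\<lambda>z. ?U z $ i) has_derivative (\<lambda>b. ?U' b $ i)) (at (x, \<theta>))" for i
    by (rule bounded_linear.has_derivative[OF bounded_linear_vec_nth U])
  have h: "((\<lambda>y. frechet_derivative ?t (at y) e) has_derivative hess c d x e) (at x)" for e
    using frechet_has_derivative[OF smooth_on_differentiable[OF smooth_on_frechet[OF S(2)] S(1)
      xS], of e]
    unfolding hess_def by simp
  have hd: "((\<lambda>z. ?d z e) has_derivative (\<lambda>b. hess c d x e (fst b))) (at (x, \<theta>))" for e
    using has_derivative_compose[OF f, of "\<lambda>y. frechet_derivative ?t (at y) e" "hess c d x e"] h
    by simp
  have tlin: "linear (frechet_derivative ?t (at y))" if "y \<in> ?S" for y
    by (rule linear_frechet[OF smooth_on_differentiable[OF S(2,1) that]])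
  \<comment> \<open>\<open>hess\<close> is built from one fixed direction \<open>n\<close> at a
    time; linearity in \<open>n\<close> is inherited from the derivatives of the transition map at
    nearby points.\<close>
  have hl: "hess c d x n b = n $ 1 *\<^sub>R hess c d x (axis 1 1) b + n $ 2 *\<^sub>R hess c d x (axis 2 1)
    b" for n b
  proof -
    have "((\<lambda>y. frechet_derivative ?t (at y) n) has_derivative
       (\<lambda>b. n $ 1 *\<^sub>R hess c d x (axis 1 1) b + n $ 2 *\<^sub>R hess c d x (axis 2 1) b)) (at x)"
    proof (rule has_derivative_eventually_eq)
      show "((\<lambda>y. n $ 1 *\<^sub>R frechet_derivative ?t (at y) (axis 1 1) + n $ 2 *\<^sub>R frechet_derivative
        ?t (at y) (axis 2 1))
         has_derivative (\<lambda>b. n $ 1 *\<^sub>R hess c d x (axis 1 1) b + n $ 2 *\<^sub>R hess c d x (axis 2 1)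
           b)) (at x)"
        by (intro has_derivative_add has_derivative_scaleR_right h)
      show "\<forall>\<^sub>F y in nhds x. frechet_derivative ?t (at y) n =
          n $ 1 *\<^sub>R frechet_derivative ?t (at y) (axis 1 1) + n $ 2 *\<^sub>R frechet_derivative ?t (at
            y) (axis 2 1)"
        unfolding eventually_nhds using S(1) xS linear_axis2[OF tlin] by blast
    qed
    from fun_cong[OF has_derivative_unique[OF h this], of b] show ?thesis .
  qed
  let ?D = "\<lambda>b. frechet_derivative ?t (at x) (?U' b) + hess c d x (uvec c x \<theta>) (fst b)"
  have "((\<lambda>z. ?U z $ 1 *\<^sub>R ?d z (axis 1 1) + ?U z $ 2 *\<^sub>R ?d z (axis 2 1)) has_derivative ?D) (at
    (x, \<theta>))"
  proof -
    have "((\<lambda>z. ?U z $ 1 *\<^sub>R ?d z (axis 1 1) + ?U z $ 2 *\<^sub>R ?d z (axis 2 1)) has_derivative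
      (\<lambda>b. (?U (x, \<theta>) $ 1 *\<^sub>R hess c d x (axis 1 1) (fst b) + ?U' b $ 1 *\<^sub>R ?d (x, \<theta>) (axis 1 1))
        + (?U (x, \<theta>) $ 2 *\<^sub>R hess c d x (axis 2 1) (fst b) + ?U' b $ 2 *\<^sub>R ?d (x, \<theta>) (axis 2 1))))
          (at (x, \<theta>))"
      by (intro has_derivative_add has_derivative_scaleR Un hd)
    moreover have "?D b = (?U (x, \<theta>) $ 1 *\<^sub>R hess c d x (axis 1 1) (fst b) + ?U' b $ 1 *\<^sub>R ?d (x,
      \<theta>) (axis 1 1))
        + (?U (x, \<theta>) $ 2 *\<^sub>R hess c d x (axis 2 1) (fst b) + ?U' b $ 2 *\<^sub>R ?d (x, \<theta>)
          (axis 2 1))" for b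
      using hl[of "uvec c x \<theta>" "fst b"] linear_axis2[OF tlin[OF xS], of "?U' b"] by simp
    ultimately show ?thesis by simp
  qed
  then have "(((\<lambda>w. snd w d) \<circ> chart_inv C) has_derivative ?D) (at (x, \<theta>))"
  proof (rule has_derivative_eventually_eq)
    show "\<forall>\<^sub>F z in nhds (x, \<theta>). ((\<lambda>w. snd w d) \<circ> chart_inv C) z =
        ?U z $ 1 *\<^sub>R ?d z (axis 1 1) + ?U z $ 2 *\<^sub>R ?d z (axis 2 1)"
      using ev
    proof eventually_elim
      case (elim z)
      note o = overlap_charts_at(3)[OF c(1) dA, of "fst z"]
      have "snd (smp c (fst z) (snd z)) d = frechet_derivative ?t (at (fst z)) (?U z)"
        using tangent_coord_change[OF c(1) dA _ snd_smp_tangent[OF c(1)]] elim o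
          snd_smp_coord[OF c(1)] by simp
      also have "\<dots> = ?U z $ 1 *\<^sub>R ?d z (axis 1 1) + ?U z $ 2 *\<^sub>R ?d z (axis 2 1)"
        by (rule linear_axis2[OF tlin]) (use elim in blast)
      finally show ?case using ci[of z] elim by simp
    qed
  qed
  from SM.dir_deriv_coord[OF \<xi> C, of "\<lambda>w. snd w d"] this
  show "dir_deriv SM (\<lambda>w. snd w d) u \<xi> = frechet_derivative ?t (at x) (?U' (\<xi> C))
      + hess c d x (uvec c x \<theta>) (fst (\<xi> C))"
    unfolding Cu by (simp add: frechet_eqI differentiableI)
qed

lemma uvec_theta_derivative:
  assumes "c \<in> A" "x \<in> chart_range c"
  shows "frechet_derivative (\<lambda>z. uvec c (fst z) (snd z)) (at (x, \<theta>)) (0, \<eta>) =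
    \<eta> *\<^sub>R cJ c x (uvec c x \<theta>)"
proof -
  have "((\<lambda>t. (x, \<theta> + t)) has_derivative (\<lambda>t. (0, t))) (at 0)"
    by (auto intro!: derivative_eq_intros)
  from has_derivative_compose[OF this, of "\<lambda>z. uvec c (fst z) (snd z)"]
  have 1: "((\<lambda>t. uvec c x (\<theta> + t)) has_derivative
     (\<lambda>t. frechet_derivative (\<lambda>z. uvec c (fst z) (snd z)) (at (x, \<theta>)) (0, t))) (at 0)"
    using frechet_has_derivative[OF uvec_differentiable[OF assms]] by simp
  have 2: "((\<lambda>t. uvec c x (\<theta> + t)) has_derivative (\<lambda>t. t *\<^sub>R cJ c x (uvec c x \<theta>))) (at 0)"
    unfolding uvec_rotate[OF assms] by (auto intro!: derivative_eq_intros)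
  show ?thesis using has_derivative_unique[OF 1 2] by meson
qed

text \<open>The definite description of the geodesic field is met exactly once. Its fibre component
  \<open>\<eta>\<close> has to solve \<open>?U' (?n, \<eta>) = - spray c x ?n\<close>, two equations
  for one number. They are solvable because both sides have the same component along
  \<open>?n\<close>, by constant length and Koszul's formula, and uniquely so because
  \<open>cJ c x ?n\<close> is nonzero. The conditions in the other charts follow from the
  transformation law of the Christoffel symbols.\<close>

lemma geodesic_field_properties:
  assumes "u \<in> carrier SM"
  shows "geodesic_field A g u \<in> tangent_space SM u"
    and "sm_chart A g c a \<in> charts_at SM u \<Longrightarrow> c \<in> A \<Longrightarrow>
      fst (geodesic_field A g u (sm_chart A g c a)) = snd u c"
proof -
  let ?P = "\<lambda>\<xi>. \<xi> \<in> tangent_space SM u \<and> (\<forall>c\<in>charts_at A (fst u).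
        dir_deriv SM (\<lambda>w. snd c (fst w)) u \<xi> = snd u c \<and>
        dir_deriv SM (\<lambda>w. snd w c) u \<xi> = - spray c (snd c (fst u)) (snd u c))"
  obtain C where CC: "C \<in> charts_at SM u" using assms unfolding carrier_iff by blast
  then obtain c a x \<theta> where c: "c \<in> A" "C = sm_chart A g c a" "x \<in> chart_range c"
      "a - pi < \<theta>" "\<theta> < a + pi" "u = smp c x \<theta>"
    by (rule sm_charts_atE)
  let ?U' = "frechet_derivative (\<lambda>z. uvec c (fst z) (snd z)) (at (x, \<theta>))"
  let ?n = "uvec c x \<theta>"
  have Ul: "linear ?U'" by (rule linear_frechet[OF uvec_differentiable[OF c(1,3)]])
  have dec: "?U' (n, \<eta>) = ?U' (n, 0) + \<eta> *\<^sub>R cJ c x ?n" for n \<eta>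
    using linear_add[OF Ul, of "(n, 0)" "(0, \<eta>)"] uvec_theta_derivative[OF c(1,3)] by simp
  have n1: "ip c x ?n ?n = 1" by (rule uvec_unit[OF c(1,3)])
  have "ip c x (?U' (?n, 0)) ?n = - dip c x ?n ?n ?n / 2"
  proof -
    have f: "((\<lambda>z::(real^2)\<times>real. fst z) has_derivative fst) (at (x, \<theta>))"
      by (rule bounded_linear_imp_has_derivative[OF bounded_linear_fst])
    have U: "((\<lambda>z. uvec c (fst z) (snd z)) has_derivative ?U') (at (x, \<theta>))"
      by (rule frechet_has_derivative[OF uvec_differentiable[OF c(1,3)]])
    \<comment> \<open>The squared length of \<open>uvec\<close> is constant; its derivative in the
      direction \<open>(?n, 0)\<close> gives the component of \<open>?U' (?n, 0)\<close> along
      \<open>?n\<close>.\<close>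
    have 1: "((\<lambda>z. ip c (fst z) (uvec c (fst z) (snd z)) (uvec c (fst z) (snd z))) has_derivative
       (\<lambda>b. dip c x (fst b) ?n ?n + ip c x (?U' b) ?n + ip c x ?n (?U' b))) (at (x, \<theta>))"
      using ip_has_derivative[OF c(1) _ f U U] c(3) by simp
    have "\<forall>\<^sub>F z in nhds (x, \<theta>). fst z \<in> chart_range c"
      by (rule topological_tendstoD[OF _ open_chart_range[OF c(1)]])
        (use differentiable_imp_tendsto_nhds[OF differentiable_fst[OF differentiable_ident], of
          "(x, \<theta>)"] c(3) in auto)
    then have "\<forall>\<^sub>F z in nhds (x, \<theta>). ip c (fst z) (uvec c (fst z) (snd z)) (uvec c (fst z) (snd
      z)) = 1"
      by eventually_elim (rule uvec_unit[OF c(1)])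
    then have 2: "((\<lambda>z. ip c (fst z) (uvec c (fst z) (snd z)) (uvec c (fst z) (snd z)))
      has_derivative
       (\<lambda>b. 0)) (at (x, \<theta>))"
      by (rule has_derivative_eventually_eq[OF has_derivative_const])
    have "dip c x ?n ?n ?n + ip c x (?U' (?n, 0)) ?n + ip c x ?n (?U' (?n, 0)) = 0"
      using fun_cong[OF has_derivative_unique[OF 1 2], of "(?n, 0)"] by simp
    then show ?thesis using ip_sym[of c x ?n "?U' (?n, 0)"] by simp
  qed
  then have perp: "ip c x (- spray c x ?n - ?U' (?n, 0)) ?n = 0"
  proof -
    have "ip c x (- spray c x ?n - ?U' (?n, 0)) ?n =
      - ip c x (spray c x ?n) ?n - ip c x (?U' (?n, 0)) ?n"
      by (simp add: ip_def algebra_simps)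
    then show ?thesis
      using spray_koszul[OF c(1,3), of ?n ?n] \<open>ip c x (?U' (?n, 0)) ?n = - dip c x ?n ?n ?n / 2\<close>
      by simp
  qed
  define \<eta> where "\<eta> = ip c x (- spray c x ?n - ?U' (?n, 0)) (cJ c x ?n)"
  have "- spray c x ?n - ?U' (?n, 0) = \<eta> *\<^sub>R cJ c x ?n"
    using unit_decomposition[OF c(1,3) n1, of "- spray c x ?n - ?U' (?n, 0)"] perp
    by (simp add: \<eta>_def)
  then have U\<eta>: "?U' (?n, \<eta>) = - spray c x ?n"
    unfolding dec[of ?n \<eta>] by (simp add: algebra_simps)
  have cu: "snd u c = ?n" "snd c (fst u) = x"
    using c snd_smp_coord by (simp_all add: fst_smp snd_chart_inv)
  have cc: "c \<in> charts_at A (fst u)" using chart_inv_charts_at[OF c(1,3)] c(6)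
    by (simp add: fst_smp)
  have id: "frechet_derivative (transition c c) (at x) = (\<lambda>e. e)" using transition_self[OF cc] cu
    by simp
  let ?\<xi> = "coord_vec SM C u (?n, \<eta>)"
  have \<xi>: "?\<xi> \<in> tangent_space SM u" "?\<xi> C = (?n, \<eta>)"
    using SM.coord_vec_tangent[OF CC] SM.coord_vec_coord[OF CC] by auto
  have P\<xi>: "?P ?\<xi>"
  proof (intro conjI ballI \<xi>(1))
    fix d assume d: "d \<in> charts_at A (fst u)"
    have dA: "d \<in> A" using d by (simp add: charts_at_iff)
    have xS: "x \<in> snd c ` (fst c \<inter> fst d)" using in_overlap[OF cc d] cu by simp
    have "snd u \<in> tangent_space A (chart_inv c x)" using snd_smp_tangent[OF c(1,3)] c(6) by simp
    from tangent_coord_change[OF c(1) dA xS this]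
    have ud: "snd u d = frechet_derivative (transition c d) (at x) ?n" using cu by simp
    have td: "snd d (fst u) = transition c d x"
      using overlap_charts_at(5)[OF c(1) dA xS] c(6) by (simp add: fst_smp)
    show "dir_deriv SM (\<lambda>w. snd d (fst w)) u ?\<xi> = snd u d"
      using smp_dir_derivs(1)[OF c d \<xi>(1)] \<xi>(2) ud by simp
    show "dir_deriv SM (\<lambda>w. snd w d) u ?\<xi> = - spray d (snd d (fst u)) (snd u d)"
    proof -
      have "linear (frechet_derivative (transition c d) (at x))"
        using linear_transition[OF cc d] cu by simp
      then have "frechet_derivative (transition c d) (at x) (- spray c x ?n) =
         - frechet_derivative (transition c d) (at x) (spray c x ?n)" by (rule linear_neg)
      then show ?thesis
        using smp_dir_derivs(2)[OF c d \<xi>(1)] \<xi>(2) ud U\<eta> christoffel_transition[OF c(1) dA xS, of ?n]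
        by (simp add: td)
    qed
  qed
  have uniq: "\<zeta> = ?\<xi>" if "?P \<zeta>" for \<zeta>
  proof -
    have \<zeta>: "\<zeta> \<in> tangent_space SM u" using that by blast
    have f: "fst (\<zeta> C) = ?n"
      using that smp_dir_derivs(1)[OF c cc \<zeta>] cc cu by (simp add: id)
    have eq: "?U' (\<zeta> C) = ?U' (?n, \<eta>)"
      using that P\<xi> smp_dir_derivs(2)[OF c cc \<zeta>] smp_dir_derivs(2)[OF c cc \<xi>(1)] cc f \<xi>(2)
      by (simp add: id)
    have "\<zeta> C = (?n, snd (\<zeta> C))" using f by (metis prod.collapse)
    then have "?U' (\<zeta> C) = ?U' (?n, 0) + snd (\<zeta> C) *\<^sub>R cJ c x ?n"
      using dec[of ?n "snd (\<zeta> C)"] by (rule ssubst)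
    then have "snd (\<zeta> C) *\<^sub>R cJ c x ?n = \<eta> *\<^sub>R cJ c x ?n"
      using eq unfolding dec[of ?n \<eta>] by auto
    then have "snd (\<zeta> C) = \<eta>"
      using cJ_uvec[OF c(1,3)] uvec_nonzero[OF c(1,3)] by simp
    with f have "\<zeta> C = ?\<xi> C" using \<xi>(2) by (metis prod.collapse)
    then show ?thesis by (rule SM.tangent_eqI[OF \<zeta> \<xi>(1) CC])
  qed
  have "geodesic_field A g u = ?\<xi>"
    unfolding geodesic_field_def spray_def[symmetric]
  proof (rule the_equality)
    show "?P ?\<xi>" by (rule P\<xi>)
    show "\<zeta> = ?\<xi>" if "?P \<zeta>" for \<zeta> using that by (rule uniq)
  qed
  then have PG: "?P (geodesic_field A g u)" using P\<xi> by simp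
  then show G: "geodesic_field A g u \<in> tangent_space SM u" by blast
  fix c a assume CC: "sm_chart A g c a \<in> charts_at SM u" and cA: "c \<in> A"
  from CC have "u \<in> fst (sm_chart A g c a)" by (simp add: charts_at_iff)
  then obtain x \<theta> where c: "x \<in> chart_range c" "a - pi < \<theta>" "\<theta> < a + pi" "u = smp c x \<theta>"
    using sm_chart_fst[OF cA] by blast
  have cc: "c \<in> charts_at A (fst u)" using chart_inv_charts_at[OF cA c(1)] c(4)
    by (simp add: fst_smp)
  have x: "snd c (fst u) = x" using c by (simp add: fst_smp snd_chart_inv)
  have "frechet_derivative (transition c c) (at x) = (\<lambda>e. e)" using transition_self[OF cc] x by simp
  then show "fst (geodesic_field A g u (sm_chart A g c a)) = snd u c"
    using smp_dir_derivs(1)[OF cA refl c cc G] PG cc by simp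
qed

end

section \<open>The thermostat flow and its differential\<close>

locale thermostat_system = surface A g
  for A :: "('m, real^2) atlas" and g :: "'m metric" +
  fixes lam :: "'m tpoint \<Rightarrow> real" and \<phi> :: "real \<Rightarrow> 'm tpoint \<Rightarrow> 'm tpoint"
  assumes lam_smooth: "smooth_map SM euclid_atlas lam"
    and flow: "thermostat_flow A g lam \<phi>"
begin

abbreviation X :: "'m tpoint \<Rightarrow> 'm sm_tangent" where "X \<equiv> geodesic_field A g"
abbreviation V :: "'m tpoint \<Rightarrow> 'm sm_tangent" where "V \<equiv> vertical_field A g"
abbreviation H :: "'m tpoint \<Rightarrow> 'm sm_tangent" where "H \<equiv> horizontal_field A g"
abbreviation F :: "'m tpoint \<Rightarrow> 'm sm_tangent" where "F \<equiv> thermostat_field A g lam"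

lemma field_tangent: "u \<in> carrier SM \<Longrightarrow> F u \<in> tangent_space SM u"
  unfolding thermostat_field_def
  by (intro SM.tangent_vcomb geodesic_field_properties(1) vertical_tangent)

lemma field_eq: "F u C = X u C + lam u *\<^sub>R V u C"
  by (simp add: thermostat_field_def vcomb_def)

section \<open>The flow as a map of time and position, in coordinates\<close>

lemma flow_smooth: "smooth_map (product_atlas euclid_atlas SM) SM (\<lambda>(t, p). \<phi> t p)"
  and flow_0: "p \<in> carrier SM \<Longrightarrow> \<phi> 0 p = p"
  and flow_add: "p \<in> carrier SM \<Longrightarrow> \<phi> (s + t) p = \<phi> s (\<phi> t p)"
  and flow_velocity: "p \<in> carrier SM \<Longrightarrow> velocity SM (\<lambda>s. \<phi> s p) t = F (\<phi> t p)"
  using flow by (auto simp: thermostat_flow_def is_flow_def)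

lemma product_chart:
  assumes "C \<in> charts_at SM p"
  defines "K \<equiv> (UNIV \<times> fst C, map_prod (\<lambda>x::real. x) (snd C))"
  shows "K \<in> charts_at (product_atlas euclid_atlas SM) (t, p)"
    "chart_range K = UNIV \<times> chart_range C"
    "z \<in> chart_range C \<Longrightarrow> chart_inv K (s, z) = (s, chart_inv C z)"
proof -
  have C: "C \<in> SM" "p \<in> fst C" using assms by (simp_all add: charts_at_iff)
  then show "K \<in> charts_at (product_atlas euclid_atlas SM) (t, p)"
    unfolding charts_at_iff product_atlas_def euclid_atlas_def K_def by force
  show "chart_range K = UNIV \<times> chart_range C"
    unfolding chart_range_def K_def by (auto simp: map_prod_surj_on)
  have inj: "inj_on (snd K) (fst K)"
    using SM.chart_inj[OF C(1)] unfolding K_def by (auto simp: inj_on_def)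
  assume z: "z \<in> chart_range C"
  then have "(s, chart_inv C z) \<in> fst K" "snd K (s, chart_inv C z) = (s, z)"
    using chart_inv_in[OF z] snd_chart_inv[OF z] by (auto simp: K_def)
  then show "chart_inv K (s, z) = (s, chart_inv C z)"
    using inv_into_f_f[OF inj] unfolding chart_inv_def[of K] by metis
qed

lemma flow_carrier: "p \<in> carrier SM \<Longrightarrow> \<phi> t p \<in> carrier SM"
proof -
  assume "p \<in> carrier SM"
  then obtain C where "C \<in> charts_at SM p" unfolding carrier_iff by blast
  from charts_at_carrier[OF product_chart(1)[OF this]]
  show ?thesis using flow_smooth unfolding smooth_map_def by fast
qed

text \<open>Joint smoothness in time and position near one point. It is the source of all second
  derivatives taken on the bundle.\<close>

lemma flow_coord:
  assumes "C \<in> charts_at SM p" "D \<in> charts_at SM (\<phi> t p)"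
  obtains W where "open W" "(t, snd C p) \<in> W" "\<And>s z. (s, z) \<in> W \<Longrightarrow> z \<in> chart_range C"
    "\<And>s z. (s, z) \<in> W \<Longrightarrow> \<phi> s (chart_inv C z) \<in> fst D"
    "smooth_on (\<lambda>q. snd D (\<phi> (fst q) (chart_inv C (snd q)))) W"
proof -
  let ?K = "((UNIV :: real set) \<times> fst C, map_prod (\<lambda>x::real. x) (snd C))"
  note K = product_chart[OF assms(1)]
  have K1: "?K \<in> charts_at (product_atlas euclid_atlas SM) (t, p)" by (rule K(1))
  have "\<exists>W. open W \<and> snd ?K (t, p) \<in> W \<and> W \<subseteq> chart_range ?K \<and>
        (\<lambda>(t, p). \<phi> t p) ` chart_inv ?K ` W \<subseteq> fst D \<and> smooth_on (snd D \<circ> (\<lambda>(t, p). \<phi> t p)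
          \<circ> chart_inv ?K) W"
  proof -
    have "D \<in> charts_at SM (case (t, p) of (t, p) \<Rightarrow> \<phi> t p)" using assms(2) by simp
    from bspec[OF bspec[OF conjunct2[OF bspec[OF flow_smooth[unfolded smooth_map_def]
        charts_at_carrier[OF K1]]] K1] this]
    show ?thesis .
  qed
  then obtain W where W: "open W" "snd ?K (t, p) \<in> W" "W \<subseteq> chart_range ?K"
    "(\<lambda>(t, p). \<phi> t p) ` chart_inv ?K ` W \<subseteq> fst D" "smooth_on (snd D \<circ> (\<lambda>(t, p). \<phi> t p) \<circ> chart_inv
      ?K) W"
    by (elim exE conjE) (rule that)
  have z: "z \<in> chart_range C" if "(s, z) \<in> W" for s z using W(3) K(2) that by auto
  have "\<phi> s (chart_inv C z) \<in> fst D" if "(s, z) \<in> W" for s z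
    using W(4) K(3)[OF z[OF that], of s] that by force
  moreover have "smooth_on (\<lambda>q. snd D (\<phi> (fst q) (chart_inv C (snd q)))) W"
  proof (rule smooth_on_cong[OF W(1,5)])
    fix q assume "q \<in> W"
    then show "snd D (\<phi> (fst q) (chart_inv C (snd q))) =
      (snd D \<circ> (\<lambda>(t, p). \<phi> t p) \<circ> chart_inv ?K) q"
      using z[of "fst q" "snd q"] K(3)[of "snd q" "fst q"] by simp
  qed
  ultimately show ?thesis using that W(1,2) z by simp
qed

lemma slice_has_derivative:
  "((\<lambda>z. (t, z)) has_derivative (\<lambda>e. (0, e))) (at z)"
  "((\<lambda>s. (s, z)) has_derivative (\<lambda>h. (h, 0))) (at t)"
  by (auto intro!: derivative_eq_intros)

lemma open_slices:
  fixes t :: "'x::real_normed_vector" and z :: "'y::real_normed_vector"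
  assumes "open W" "(t, z) \<in> W"
  shows "\<forall>\<^sub>F y in nhds z. (t, y) \<in> W" "\<forall>\<^sub>F s in nhds t. (s, z) \<in> W"
  by (rule topological_tendstoD[OF differentiable_imp_tendsto_nhds[OF differentiableI[OF
    slice_has_derivative(1)]] assms],
      rule topological_tendstoD[OF differentiable_imp_tendsto_nhds[OF differentiableI[OF
        slice_has_derivative(2)]] assms])

lemma flow_diff_at:
  assumes "p \<in> carrier SM"
  shows "diff_at SM SM (\<phi> t) p"
proof -
  have "(\<forall>\<^sub>F z in nhds (snd C p). z \<in> chart_range C \<and> \<phi> t (chart_inv C z) \<in> fst D) \<and>
        (snd D \<circ> \<phi> t \<circ> chart_inv C) differentiable (at (snd C p))"
    if C: "C \<in> charts_at SM p" and D: "D \<in> charts_at SM (\<phi> t p)" for C D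
  proof -
    obtain W where W: "open W" "(t, snd C p) \<in> W" "\<And>s z. (s, z) \<in> W \<Longrightarrow> z \<in> chart_range C"
      "\<And>s z. (s, z) \<in> W \<Longrightarrow> \<phi> s (chart_inv C z) \<in> fst D"
      "smooth_on (\<lambda>q. snd D (\<phi> (fst q) (chart_inv C (snd q)))) W"
      by (rule flow_coord[OF C D]) (rule that)
    have "\<forall>\<^sub>F z in nhds (snd C p). z \<in> chart_range C \<and> \<phi> t (chart_inv C z) \<in> fst D"
      using open_slices(1)[OF W(1,2)] by eventually_elim (use W(3,4) in blast)
    moreover have "(\<lambda>z. snd D (\<phi> t (chart_inv C z))) differentiable (at (snd C p))"
      using differentiable_chain[of "\<lambda>z. (t, z)" "snd C p" "\<lambda>q. snd D (\<phi> (fst q) (chart_inv C (snd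
        q)))"]
        smooth_on_differentiable[OF W(5,1,2)] differentiableI[OF slice_has_derivative(1)] by simp
    ultimately show ?thesis by (simp add: comp_def)
  qed
  then show ?thesis using assms flow_carrier unfolding diff_at_def by blast
qed

lemma flow_diff_curve:
  assumes "p \<in> carrier SM"
  shows "diff_curve SM (\<lambda>s. \<phi> s p) t"
proof -
  obtain C where C: "C \<in> charts_at SM p" using assms unfolding carrier_iff by blast
  have "(\<forall>\<^sub>F s in nhds t. \<phi> s p \<in> fst D) \<and> (snd D \<circ> (\<lambda>s. \<phi> s p)) differentiable (at t)"
    if D: "D \<in> charts_at SM (\<phi> t p)" for D
  proof -
    obtain W where W: "open W" "(t, snd C p) \<in> W" "\<And>s z. (s, z) \<in> W \<Longrightarrow> z \<in> chart_range C"
      "\<And>s z. (s, z) \<in> W \<Longrightarrow> \<phi> s (chart_inv C z) \<in> fst D"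
      "smooth_on (\<lambda>q. snd D (\<phi> (fst q) (chart_inv C (snd q)))) W"
      by (rule flow_coord[OF C D]) (rule that)
    have "\<forall>\<^sub>F s in nhds t. \<phi> s p \<in> fst D"
      using open_slices(2)[OF W(1,2)]
    proof eventually_elim
      case (elim s) then show ?case using W(4)[OF elim] by (simp add: SM.chart_inv_snd_at[OF C])
    qed
    moreover have "(\<lambda>s. snd D (\<phi> s p)) differentiable (at t)"
      using differentiable_chain[of "\<lambda>s. (s, snd C p)" t "\<lambda>q. snd D (\<phi> (fst q) (chart_inv C (snd
        q)))"]
        smooth_on_differentiable[OF W(5,1,2)] differentiableI[OF slice_has_derivative(2)]
      by (simp add: SM.chart_inv_snd_at[OF C])
    ultimately show ?thesis by (simp add: comp_def)
  qed
  then show ?thesis using assms flow_carrier unfolding diff_curve_def by blast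
qed

section \<open>The differential of the flow and its inverse transpose\<close>

definition dphi :: "real \<Rightarrow> 'm tpoint \<Rightarrow> 'm sm_tangent \<Rightarrow> 'm sm_tangent" where
  "dphi t u = differential SM SM (\<phi> t) u"

lemma dphi_tangent:
  "u \<in> carrier SM \<Longrightarrow> w \<in> tangent_space SM u \<Longrightarrow> dphi t u w \<in> tangent_space SM (\<phi> t u)"
  unfolding dphi_def by (rule differential_tangent[OF diff_atlas_SM diff_atlas_SM flow_diff_at])

lemma dphi_vcomb:
  "u \<in> carrier SM \<Longrightarrow> w \<in> tangent_space SM u \<Longrightarrow> w' \<in> tangent_space SM u \<Longrightarrow>
    dphi t u (vcomb a w b w') = vcomb a (dphi t u w) b (dphi t u w')"
  unfolding dphi_def by (rule differential_vcomb[OF diff_atlas_SM flow_diff_at])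

lemma dphi_add:
  assumes "u \<in> carrier SM" "w \<in> tangent_space SM u"
  shows "dphi (s + t) u w = dphi s (\<phi> t u) (dphi t u w)"
proof -
  note f = flow_diff_at[OF assms(1)] and g = flow_diff_at[OF flow_carrier[OF assms(1)]]
  have "differential SM SM (\<phi> (s + t)) u w = differential SM SM (\<lambda>q. \<phi> s (\<phi> t q)) u w"
    by (rule diff_at_cong(2)[OF diff_atlas_SM diff_at_compose(1)[OF diff_atlas_SM diff_atlas_SM f
      g] _ assms(2)])
      (rule flow_add)
  also have "\<dots> = dphi s (\<phi> t u) (dphi t u w)"
    unfolding dphi_def by (rule diff_at_compose(2)[OF diff_atlas_SM diff_atlas_SM f g assms(2)])
  finally show ?thesis by (simp add: dphi_def)
qed

lemma dphi_0:
  assumes "u \<in> carrier SM" "w \<in> tangent_space SM u"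
  shows "dphi 0 u w = w"
  using diff_at_cong(2)[OF diff_atlas_SM SM.diff_at_id[OF assms(1)] _ assms(2), of "\<phi> 0"]
    flow_0 SM.differential_id[OF assms(2,1)] by (simp add: dphi_def)

lemma flow_inverse:
  assumes "u \<in> carrier SM"
  shows "\<phi> (- t) (\<phi> t u) = u" "\<phi> t (\<phi> (- t) u) = u"
  using flow_add[OF assms, of "- t" t] flow_add[OF assms, of t "- t"] flow_0[OF assms] by simp_all

lemma dphi_inverse:
  assumes "u \<in> carrier SM" "w \<in> tangent_space SM u"
  shows "dphi (- t) (\<phi> t u) (dphi t u w) = w"
  using dphi_add[OF assms, of "- t" t] dphi_0[OF assms] by simp

lemma dphi_inverse':
  assumes "u \<in> carrier SM" "w \<in> tangent_space SM (\<phi> t u)"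
  shows "dphi t u (dphi (- t) (\<phi> t u) w) = w" "dphi (- t) (\<phi> t u) w \<in> tangent_space SM u"
  using dphi_inverse[OF flow_carrier[OF assms(1)] assms(2), of "- t"]
    dphi_tangent[OF flow_carrier[OF assms(1)] assms(2), of "- t"] flow_inverse[OF assms(1)]
      by simp_all

text \<open>The curve \<open>\<phi> t (\<phi> s u)\<close> in \<open>s\<close> is also
  \<open>\<phi> (t + s) u\<close>. Its velocity at \<open>s = 0\<close> is the left side by the
  chain rule and the right side by the flow equation.\<close>

lemma dphi_field:
  assumes "u \<in> carrier SM"
  shows "dphi t u (F u) = F (\<phi> t u)"
proof -
  have "velocity SM (\<lambda>s. \<phi> t (\<phi> s u)) 0 = dphi t u (F u)"
    using velocity_compose[OF diff_atlas_SM flow_diff_curve[OF assms], where t = 0 and B = SM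
      and f = "\<phi> t"]
      flow_diff_at[OF assms] flow_velocity[OF assms, of 0] flow_0[OF assms] by (simp add: dphi_def)
  moreover have "velocity SM (\<lambda>s. \<phi> t (\<phi> s u)) 0 = velocity SM (\<lambda>s. \<phi> s u) t"
  proof
    fix D
    show "velocity SM (\<lambda>s. \<phi> t (\<phi> s u)) 0 D = velocity SM (\<lambda>s. \<phi> s u) t D"
    proof (cases "D \<in> charts_at SM (\<phi> t u)")
      case True
      have "(snd D \<circ> (\<lambda>s. \<phi> s u)) differentiable (at t)"
        using flow_diff_curve[OF assms, of t] True unfolding diff_curve_def by blast
      then have "((snd D \<circ> (\<lambda>s. \<phi> s u)) has_vector_derivative vector_derivative (snd D \<circ> (\<lambda>s. \<phi> s
        u)) (at t)) (at (t + 0))"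
        by (simp add: vector_derivative_works)
      moreover have "((\<lambda>s. t + s) has_vector_derivative 1) (at 0)"
        by (auto intro!: derivative_eq_intros)
      ultimately have "((snd D \<circ> (\<lambda>s. \<phi> s u)) \<circ> (\<lambda>s. t + s) has_vector_derivative
          1 *\<^sub>R vector_derivative (snd D \<circ> (\<lambda>s. \<phi> s u)) (at t)) (at 0)"
        by (intro vector_diff_chain_at)
      moreover have "(snd D \<circ> (\<lambda>s. \<phi> s u)) \<circ> (\<lambda>s. t + s) = snd D \<circ> (\<lambda>s. \<phi> t (\<phi> s u))"
        by (auto simp: flow_add[OF assms])
      ultimately show ?thesis
        using True by (simp add: velocity_def vector_derivative_at flow_0[OF assms])
    next
      case False
      then show ?thesis by (simp add: velocity_def flow_0[OF assms])
    qed
  qed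
  ultimately show ?thesis using flow_velocity[OF assms] by simp
qed

text \<open>The inverse inside \<open>inv_transpose\<close> is only chosen by
  \<open>inv_into\<close>; injectivity of the differential identifies it with the differential of
  the reverse flow.\<close>

lemma inv_transpose_flow:
  assumes "u \<in> carrier SM" "w \<in> tangent_space SM (\<phi> t u)"
  shows "inv_transpose SM (\<phi> t) u \<xi> w = \<xi> (dphi (- t) (\<phi> t u) w)"
proof -
  have "inj_on (dphi t u) (tangent_space SM u)"
    by (rule inj_on_inverseI[where g = "dphi (- t) (\<phi> t u)"]) (rule dphi_inverse[OF assms(1)])
  then have "inv_into (tangent_space SM u) (dphi t u) w = dphi (- t) (\<phi> t u) w"
    using inv_into_f_f[of "dphi t u" "tangent_space SM u"] dphi_inverse'[OF assms] by metis
  then show ?thesis using assms(2) by (simp add: inv_transpose_def dphi_def)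
qed

lemma inv_transpose_cotangent:
  assumes "u \<in> carrier SM" "\<xi> \<in> cotangent_space SM u"
  shows "inv_transpose SM (\<phi> t) u \<xi> \<in> cotangent_space SM (\<phi> t u)"
proof -
  let ?q = "\<phi> t u"
  have "inv_transpose SM (\<phi> t) u \<xi> (vcomb a v b w) =
      a * inv_transpose SM (\<phi> t) u \<xi> v + b * inv_transpose SM (\<phi> t) u \<xi> w"
    if "v \<in> tangent_space SM ?q" "w \<in> tangent_space SM ?q" for a b v w
  proof -
    have "\<xi> (vcomb a (dphi (- t) ?q v) b (dphi (- t) ?q w)) =
      a * \<xi> (dphi (- t) ?q v) + b * \<xi> (dphi (- t) ?q w)"
      using assms(2) dphi_inverse'(2)[OF assms(1)] that unfolding cotangent_space_def by blast
    then show ?thesis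
      using inv_transpose_flow[OF assms(1)] that SM.tangent_vcomb[OF that]
        dphi_vcomb[OF flow_carrier[OF assms(1)] that] by simp
  qed
  moreover have "inv_transpose SM (\<phi> t) u \<xi> v = 0" if "v \<notin> tangent_space SM ?q" for v
    using that by (simp add: inv_transpose_def)
  ultimately show ?thesis unfolding cotangent_space_def by blast
qed

text \<open>The vertical direction along the orbit of \<open>u\<close>, transported back to \<open>u\<close>.\<close>

definition W :: "'m tpoint \<Rightarrow> real \<Rightarrow> 'm sm_tangent" where
  "W u t = dphi (- t) (\<phi> t u) (V (\<phi> t u))"

lemma W_tangent: "u \<in> carrier SM \<Longrightarrow> W u t \<in> tangent_space SM u"
  unfolding W_def by (rule dphi_inverse'(2)) (auto intro: vertical_tangent flow_carrier)

lemma dphi_W: "u \<in> carrier SM \<Longrightarrow> dphi t u (W u t) = V (\<phi> t u)"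
  unfolding W_def by (rule dphi_inverse'(1)) (auto intro: vertical_tangent flow_carrier)

lemma W_0: "u \<in> carrier SM \<Longrightarrow> W u 0 = V u"
  using dphi_W[of u 0] dphi_0[OF _ W_tangent, of u 0] flow_0[of u] by simp

text \<open>The group law lets the curves \<open>W\<close> at different base points of one orbit be
  compared: transport by \<open>\<phi> s\<close> only shifts their time.\<close>

lemma W_flow:
  assumes "u \<in> carrier SM"
  shows "dphi s u (W u (s + t)) = W (\<phi> s u) t"
proof -
  have c: "\<phi> s u \<in> carrier SM" by (rule flow_carrier[OF assms])
  have t: "dphi s u (W u (s + t)) \<in> tangent_space SM (\<phi> s u)"
    by (rule dphi_tangent[OF assms W_tangent[OF assms]])
  have "dphi t (\<phi> s u) (dphi s u (W u (s + t))) = V (\<phi> t (\<phi> s u))"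
    using dphi_add[OF assms W_tangent[OF assms], of t s "s + t"] dphi_W[OF assms, of "s + t"]
      flow_add[OF assms, of t s] by (simp add: add.commute)
  then have "dphi (- t) (\<phi> t (\<phi> s u)) (V (\<phi> t (\<phi> s u))) = dphi s u (W u (s + t))"
    using dphi_inverse[OF c t, of t] by simp
  then show ?thesis by (simp add: W_def)
qed

text \<open>Vectors along the orbit are compared at the fixed point \<open>u\<close>, in one chart
  \<open>C0\<close>. In coordinates their transport is the space derivative of the jointly smooth
  flow along the smooth curve \<open>(- r, y r)\<close>. Both the continuity of \<open>W\<close> and
  the smoothness of transported covectors rest on this.\<close>

lemma push_coord:
  assumes u: "u \<in> carrier SM" and C0: "C0 \<in> charts_at SM u" and C: "C \<in> charts_at SM (\<phi> s u)"
  obtains \<epsilon> where "0 < \<epsilon>" "\<And>r. r \<in> {s - \<epsilon><..<s + \<epsilon>} \<Longrightarrow> \<phi> r u \<in> fst C"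
    "\<And>e. smooth_on (\<lambda>r. dphi (- r) (\<phi> r u) (coord_vec SM C (\<phi> r u) e) C0) {s - \<epsilon><..<s + \<epsilon>}"
proof -
  let ?q = "\<phi> s u"
  let ?\<Psi> = "\<lambda>q. snd C0 (\<phi> (fst q) (chart_inv C (snd q)))"
  let ?\<Theta> = "\<lambda>q. snd C (\<phi> (fst q) (chart_inv C0 (snd q)))"
  have C0': "C0 \<in> charts_at SM (\<phi> (- s) ?q)" using C0 flow_inverse(1)[OF u] by simp
  obtain W1 where W1: "open W1" "(- s, snd C ?q) \<in> W1" "\<And>s z. (s, z) \<in> W1 \<Longrightarrow> z \<in> chart_range C"
      "\<And>s z. (s, z) \<in> W1 \<Longrightarrow> \<phi> s (chart_inv C z) \<in> fst C0" "smooth_on ?\<Psi> W1"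
    by (rule flow_coord[OF C C0']) (rule that)
  obtain W2 where W2: "open W2" "(s, snd C0 u) \<in> W2" "\<And>s z. (s, z) \<in> W2 \<Longrightarrow> z \<in> chart_range C0"
      "\<And>s z. (s, z) \<in> W2 \<Longrightarrow> \<phi> s (chart_inv C0 z) \<in> fst C" "smooth_on ?\<Theta> W2"
    by (rule flow_coord[OF C0 C]) (rule that)
  have inv0: "chart_inv C0 (snd C0 u) = u" by (rule SM.chart_inv_snd_at[OF C0])
  define y where "y r = snd C (\<phi> r u)" for r
  have y: "y r = ?\<Theta> (r, snd C0 u)" for r by (simp add: y_def inv0)
  have dy: "y differentiable (at s)"
    using differentiable_chain[of "\<lambda>r. (r, snd C0 u)" s ?\<Theta>]
      smooth_on_differentiable[OF W2(5,1,2)] differentiableI[OF slice_has_derivative(2)]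
    unfolding y[abs_def] by simp
  have "\<forall>\<^sub>F r in nhds s. (- r, y r) \<in> W1"
  proof (rule topological_tendstoD[OF differentiable_imp_tendsto_nhds W1(1)])
    show "(\<lambda>r. (- r, y r)) differentiable (at s)"
      by (intro differentiable_Pair differentiable_minus differentiable_ident dy)
    show "(- s, y s) \<in> W1" unfolding y_def by (rule W1(2))
  qed
  with open_slices(2)[OF W2(1,2)] have "\<forall>\<^sub>F r in nhds s. (r, snd C0 u) \<in> W2 \<and> (- r, y r) \<in> W1"
    by eventually_elim simp
  then obtain \<epsilon> where \<epsilon>: "0 < \<epsilon>" "\<And>r. dist r s < \<epsilon> \<Longrightarrow> (r, snd C0 u) \<in> W2 \<and> (- r, y r) \<in> W1"
    unfolding eventually_nhds_metric by blast
  let ?I = "{s - \<epsilon><..<s + \<epsilon>}"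
  have I: "(r, snd C0 u) \<in> W2" "(- r, y r) \<in> W1" if "r \<in> ?I" for r
    using \<epsilon>(2)[of r] that by (auto simp: dist_real_def abs_less_iff)
  have inC: "\<phi> r u \<in> fst C" if "r \<in> ?I" for r using W2(4)[OF I(1)[OF that]] inv0 by simp
  have CSM: "C \<in> SM" using C by (simp add: charts_at_iff)
  have val: "dphi (- r) (\<phi> r u) (coord_vec SM C (\<phi> r u) e) C0 =
      frechet_derivative ?\<Psi> (at (- r, y r)) (0, e)" if "r \<in> ?I" for r e
  proof -
    have Cr: "C \<in> charts_at SM (\<phi> r u)" using CSM inC[OF that] by (simp add: charts_at_iff)
    have C0r: "C0 \<in> charts_at SM (\<phi> (- r) (\<phi> r u))" using C0 flow_inverse(1)[OF u] by simp
    have "dphi (- r) (\<phi> r u) (coord_vec SM C (\<phi> r u) e) C0 =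
       frechet_derivative (snd C0 \<circ> \<phi> (- r) \<circ> chart_inv C) (at (y r)) e"
      unfolding dphi_def y_def
      using differential_coord[OF diff_atlas_SM flow_diff_at[OF flow_carrier[OF u]]
          SM.coord_vec_tangent[OF Cr] Cr C0r] SM.coord_vec_coord[OF Cr] by simp
    also have "snd C0 \<circ> \<phi> (- r) \<circ> chart_inv C = (\<lambda>z. ?\<Psi> (- r, z))" by auto
    also have "frechet_derivative (\<lambda>z. ?\<Psi> (- r, z)) (at (y r)) e =
      frechet_derivative ?\<Psi> (at (- r, y r)) (0, e)"
      using frechet_chain[OF differentiableI[OF slice_has_derivative(1)], of ?\<Psi> "- r" "y r"]
        smooth_on_differentiable[OF W1(5,1) I(2)[OF that]] frechet_eqI[OF slice_has_derivative(1),
          of "- r" "y r"]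
      by simp
    finally show ?thesis .
  qed
  have sy: "smooth_on y ?I"
    unfolding y[abs_def]
    by (rule smooth_on_compose[OF _ W2(1) _ W2(5)])
      (use I in \<open>auto intro!: smooth_on_Pair smooth_on_ident smooth_on_const\<close>)
  have "smooth_on (\<lambda>r. dphi (- r) (\<phi> r u) (coord_vec SM C (\<phi> r u) e) C0) ?I" for e
  proof (rule smooth_on_cong)
    show "smooth_on (\<lambda>r. frechet_derivative ?\<Psi> (at (- r, y r)) (0, e)) ?I"
    proof (rule smooth_on_compose[OF _ W1(1) _ smooth_on_frechet[OF W1(5)]])
      show "smooth_on (\<lambda>r. (- r, y r)) ?I"
        by (intro smooth_on_Pair sy smooth_on_bounded_linear)
          (auto intro: bounded_linear_minus bounded_linear_ident)
    qed (use I in auto)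
  qed (use val in auto)
  with \<epsilon>(1) inC show ?thesis by (rule that)
qed

text \<open>The Lie derivative of \<open>V\<close> along \<open>F\<close>. In coordinates
  \<open>W u r\<close> is the angular derivative \<open>?G2\<close> of the flow at
  \<open>(- r, ?y r)\<close>. The time part of its derivative is, by symmetry of second derivatives,
  minus the angular derivative of \<open>F\<close>; the space part vanishes because the flow at time
  0 is the identity.\<close>

lemma W_coord_derivative:
  assumes u: "u \<in> carrier SM" and C: "C \<in> charts_at SM u"
  shows "(\<lambda>z. F (chart_inv C z) C) differentiable (at (snd C u))"
    and "((\<lambda>r. W u r C) has_vector_derivative
      - frechet_derivative (\<lambda>z. F (chart_inv C z) C) (at (snd C u)) (0, 1)) (at 0)"
proof -
  let ?z0 = "snd C u"
  let ?\<Psi> = "\<lambda>q. snd C (\<phi> (fst q) (chart_inv C (snd q)))"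
  have C0: "C \<in> charts_at SM (\<phi> 0 u)" using C flow_0[OF u] by simp
  obtain Q where Q: "open Q" "(0, ?z0) \<in> Q" "\<And>s z. (s, z) \<in> Q \<Longrightarrow> z \<in> chart_range C"
      "\<And>s z. (s, z) \<in> Q \<Longrightarrow> \<phi> s (chart_inv C z) \<in> fst C" "smooth_on ?\<Psi> Q"
    by (rule flow_coord[OF C C0]) (rule that)
  have CSM: "C \<in> SM" using C by (simp add: charts_at_iff)
  have car: "chart_inv C z \<in> carrier SM" "C \<in> charts_at SM (chart_inv C z)" if "z \<in> chart_range C"
    for z
    using chart_inv_in[OF that] CSM charts_at_carrier[of C SM "chart_inv C z"]
    by (auto simp: charts_at_iff)
  have \<Psi>d: "?\<Psi> differentiable (at q)" if "q \<in> Q" for q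
    by (rule smooth_on_differentiable[OF Q(5,1) that])
  \<comment> \<open>Near \<open>?z0\<close> the coordinates of \<open>F\<close> are the time
    derivative of the flow at time 0; the differentiability of \<open>F\<close> comes from
    here.\<close>
  have part1: "frechet_derivative ?\<Psi> (at (0, z)) (1, 0) = F (chart_inv C z) C" if "(0, z) \<in> Q" for z
  proof -
    note z = Q(3)[OF that]
    have 1: "((\<lambda>s. ?\<Psi> (s, z)) has_derivative (\<lambda>h. frechet_derivative ?\<Psi> (at (0, z)) (h, 0))) (at 0)"
      by (rule has_derivative_compose[OF slice_has_derivative(2) frechet_has_derivative[OF \<Psi>d[OF
        that]]])
    have 2: "(\<lambda>h. frechet_derivative ?\<Psi> (at (0, z)) (h, 0)) =
      (\<lambda>h. h *\<^sub>R frechet_derivative ?\<Psi> (at (0, z)) (1, 0))"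
    proof
      show "frechet_derivative ?\<Psi> (at (0, z)) (h, 0) =
        h *\<^sub>R frechet_derivative ?\<Psi> (at (0, z)) (1, 0)" for h
        using linear_cmul[OF linear_frechet[OF \<Psi>d[OF that]], of h "(1, 0)"] by simp
    qed
    have "((snd C \<circ> (\<lambda>s. \<phi> s (chart_inv C z))) has_vector_derivative
        frechet_derivative ?\<Psi> (at (0, z)) (1, 0)) (at 0)"
      using 1 unfolding 2 has_vector_derivative_def comp_def by simp
    from vector_derivative_at[OF this] show ?thesis
      using fun_cong[OF flow_velocity[OF car(1)[OF z], of 0], of C] car(2)[OF z]
      by (simp add: velocity_def flow_0[OF car(1)[OF z]])
  qed
  have evO: "\<forall>\<^sub>F z in nhds ?z0. (0, z) \<in> Q" by (rule open_slices(1)[OF Q(1,2)])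
  let ?G1 = "\<lambda>q. frechet_derivative ?\<Psi> (at q) (1, 0)"
    and ?G2 = "\<lambda>q. frechet_derivative ?\<Psi> (at q) (0, 0, 1)"
  have G1d: "?G1 differentiable (at (0, ?z0))" and G2d: "?G2 differentiable (at (0, ?z0))"
    using smooth_on_differentiable[OF smooth_on_frechet[OF Q(5)] Q(1,2)] by blast+
  have FG: "\<forall>\<^sub>F z in nhds ?z0. F (chart_inv C z) C = ?G1 (0, z)"
    using evO by eventually_elim (simp add: part1)
  have G1s: "((\<lambda>z. ?G1 (0, z)) has_derivative (\<lambda>e. frechet_derivative ?G1 (at (0, ?z0)) (0, e)))
    (at ?z0)"
    by (rule has_derivative_compose[OF slice_has_derivative(1) frechet_has_derivative[OF G1d]])
  note Fder = has_derivative_eventually_eq[OF G1s FG]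
  then show "(\<lambda>z. F (chart_inv C z) C) differentiable (at ?z0)" by (rule differentiableI)
  have sym: "frechet_derivative ?G2 (at (0, ?z0)) (1, 0) =
    frechet_derivative ?G1 (at (0, ?z0)) (0, 0, 1)"
    by (rule second_derivative_symmetric[OF Q(5,1,2)])
  have G2z: "frechet_derivative ?G2 (at (0, ?z0)) (0, e) = 0" for e
  proof -
    have 1: "((\<lambda>z. ?G2 (0, z)) has_derivative (\<lambda>e. frechet_derivative ?G2 (at (0, ?z0)) (0, e)))
      (at ?z0)"
      by (rule has_derivative_compose[OF slice_has_derivative(1) frechet_has_derivative[OF G2d]])
    have const: "?G2 (0, z) = (0, 1)" if zQ: "(0, z) \<in> Q" for z
    proof -
      have 1: "((\<lambda>y. ?\<Psi> (0, y)) has_derivative (\<lambda>e. frechet_derivative ?\<Psi> (at (0, z)) (0, e))) (at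
        z)"
        by (rule has_derivative_compose[OF slice_has_derivative(1) frechet_has_derivative[OF \<Psi>d[OF
          zQ]]])
      have 2: "((\<lambda>y. ?\<Psi> (0, y)) has_derivative (\<lambda>e. e)) (at z)"
      proof (rule has_derivative_eventually_eq[OF has_derivative_ident])
        show "\<forall>\<^sub>F y in nhds z. ?\<Psi> (0, y) = y"
          using open_slices(1)[OF Q(1) zQ]
        proof eventually_elim
          case (elim y)
          then show ?case using flow_0[OF car(1)[OF Q(3)[OF elim]]] snd_chart_inv[OF Q(3)[OF
            elim]] by simp
        qed
      qed
      from fun_cong[OF has_derivative_unique[OF 1 2], of "(0, 1)"] show ?thesis .
    qed
    have 2: "((\<lambda>z. ?G2 (0, z)) has_derivative (\<lambda>e. 0)) (at ?z0)"
    proof (rule has_derivative_eventually_eq[OF has_derivative_const[of "(0, 1)"]])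
      show "\<forall>\<^sub>F z in nhds ?z0. ?G2 (0, z) = (0, 1)"
        using evO by eventually_elim (rule const)
    qed
    from fun_cong[OF has_derivative_unique[OF 1 2], of e] show ?thesis .
  qed
  let ?y = "\<lambda>r. snd C (\<phi> r u)"
  have dy: "?y differentiable (at 0)"
    using flow_diff_curve[OF u, of 0] C0 unfolding diff_curve_def by (auto simp: comp_def)
  obtain y' where y': "(?y has_derivative y') (at 0)" using dy unfolding differentiable_def by blast
  have y0: "?y 0 = ?z0" using flow_0[OF u] by simp
  have pair: "((\<lambda>r. (- r, ?y r)) has_derivative (\<lambda>h. (- h, y' h))) (at 0)"
    by (intro has_derivative_Pair has_derivative_minus has_derivative_ident y')
  have "((\<lambda>r. ?G2 (- r, ?y r)) has_derivative (\<lambda>h. frechet_derivative ?G2 (at (0, ?z0)) (- h, y'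
    h))) (at 0)"
    using has_derivative_compose[OF pair, of ?G2] frechet_has_derivative[OF G2d] y0 by simp
  moreover have "frechet_derivative ?G2 (at (0, ?z0)) (- h, y' h) =
      h *\<^sub>R - frechet_derivative ?G1 (at (0, ?z0)) (0, 0, 1)" for h
  proof -
    have l: "linear (frechet_derivative ?G2 (at (0, ?z0)))" by (rule linear_frechet[OF G2d])
    have "(- h, y' h) = (- h) *\<^sub>R (1, 0) + (0, y' h)" by simp
    then show ?thesis
      using linear_add[OF l, of "(- h) *\<^sub>R (1, 0)" "(0, y' h)"] linear_cmul[OF l, of "- h" "(1,
        0)"] G2z sym by simp
  qed
  ultimately have "((\<lambda>r. ?G2 (- r, ?y r)) has_vector_derivative - frechet_derivative ?G1 (at (0,
    ?z0)) (0, 0, 1)) (at 0)"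
    by (simp add: has_vector_derivative_def)
  moreover have "\<forall>\<^sub>F r in nhds 0. W u r C = ?G2 (- r, ?y r)"
  proof -
    have "\<forall>\<^sub>F r in nhds 0. (- r, ?y r) \<in> Q"
      by (rule topological_tendstoD[OF differentiable_imp_tendsto_nhds Q(1)])
        (use dy Q(2) y0 in auto)
    moreover have "\<forall>\<^sub>F r in nhds 0. \<phi> r u \<in> fst C"
      using flow_diff_curve[OF u, of 0] C0 unfolding diff_curve_def by blast
    ultimately show ?thesis
    proof eventually_elim
      case (elim r)
      have Cr: "C \<in> charts_at SM (\<phi> r u)" using CSM elim(2) by (simp add: charts_at_iff)
      have C0r: "C \<in> charts_at SM (\<phi> (- r) (\<phi> r u))" using C flow_inverse(1)[OF u] by simp
      have "W u r C = frechet_derivative (snd C \<circ> \<phi> (- r) \<circ> chart_inv C) (at (?y r)) (0, 1)"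
        unfolding dphi_def W_def
        using differential_coord[OF diff_atlas_SM flow_diff_at[OF flow_carrier[OF u]]
          vertical_tangent[OF flow_carrier[OF u]] Cr C0r] vertical_coord[OF Cr] by simp
      also have "snd C \<circ> \<phi> (- r) \<circ> chart_inv C = (\<lambda>z. ?\<Psi> (- r, z))" by auto
      also have "frechet_derivative (\<lambda>z. ?\<Psi> (- r, z)) (at (?y r)) (0, 1) = ?G2 (- r, ?y r)"
        using frechet_chain[OF differentiableI[OF slice_has_derivative(1)], of ?\<Psi> "- r" "?y r"]
          \<Psi>d[OF elim(1)] frechet_eqI[OF slice_has_derivative(1), of "- r" "?y r"]
        by simp
      finally show ?case .
    qed
  qed
  ultimately have "((\<lambda>r. W u r C) has_vector_derivative - frechet_derivative ?G1 (at (0, ?z0)) (0,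
    0, 1)) (at 0)"
    by (rule has_vector_derivative_eventually_eq)
  then show "((\<lambda>r. W u r C) has_vector_derivative
      - frechet_derivative (\<lambda>z. F (chart_inv C z) C) (at ?z0) (0, 1)) (at 0)"
    using frechet_eqI[OF Fder] by simp
qed

section \<open>The moving frame and its dual\<close>

lemma lam_coord_differentiable:
  assumes "C \<in> charts_at SM u"
  shows "(lam \<circ> chart_inv C) differentiable (at (snd C u))"
proof -
  have E: "(UNIV :: real set, \<lambda>x. x) \<in> charts_at euclid_atlas (lam u)"
    by (simp add: charts_at_iff euclid_atlas_def)
  obtain O' where "open O'" "snd C u \<in> O'" "smooth_on (snd (UNIV :: real set, \<lambda>x. x) \<circ> lam \<circ>
    chart_inv C) O'"
    using bspec[OF bspec[OF conjunct2[OF bspec[OF lam_smooth[unfolded smooth_map_def]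
      charts_at_carrier[OF assms]]] assms] E] by (elim exE conjE) (rule that)
  from smooth_on_differentiable[OF this(3,1,2)] show ?thesis by (simp add: comp_def)
qed

definition lamV :: "'m tpoint \<Rightarrow> real" where
  "lamV u = dir_deriv SM lam u (V u)"

lemma lamV_coord:
  assumes "C \<in> charts_at SM u"
  shows "lamV u = frechet_derivative (lam \<circ> chart_inv C) (at (snd C u)) (0, 1)"
  using SM.dir_deriv_coord[OF vertical_tangent[OF charts_at_carrier[OF assms]] assms
      lam_coord_differentiable[OF assms]] vertical_coord[OF assms] by (simp add: lamV_def)

text \<open>In every chart \<open>V\<close> is constant, so \<open>H = [V, X]\<close> is the derivative of \<open>X = F - lam V\<close>
  in the fibre direction.\<close>

lemma horizontal_coord:
  assumes C: "C \<in> charts_at SM u"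
  shows "H u C = frechet_derivative (\<lambda>z. F (chart_inv C z) C) (at (snd C u)) (0, 1) - lamV u *\<^sub>R V
    u C"
    and "((\<lambda>z. X (chart_inv C z) C) has_derivative frechet_derivative (\<lambda>z. X (chart_inv C z) C)
      (at (snd C u))) (at (snd C u))"
    and "H u C = frechet_derivative (\<lambda>z. X (chart_inv C z) C) (at (snd C u)) (0, 1)"
proof -
  let ?z0 = "snd C u"
  have u: "u \<in> carrier SM" by (rule charts_at_carrier[OF C])
  have evV: "\<forall>\<^sub>F z in nhds ?z0. V (chart_inv C z) C = (0, 1)"
    using SM.transition_domain[OF C C]
    by eventually_elim (use C in \<open>auto simp: charts_at_iff intro!: vertical_coord\<close>)
  let ?F = "\<lambda>z. F (chart_inv C z) C" and ?l = "lam \<circ> chart_inv C"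
  have "((\<lambda>z. ?F z - ?l z *\<^sub>R (0, 1)) has_derivative
      (\<lambda>e. frechet_derivative ?F (at ?z0) e - frechet_derivative ?l (at ?z0) e *\<^sub>R (0, 1)))
        (at ?z0)"
    by (intro has_derivative_diff has_derivative_scaleR_left frechet_has_derivative
        W_coord_derivative(1)[OF u C] lam_coord_differentiable[OF C])
  moreover have "\<forall>\<^sub>F z in nhds ?z0. X (chart_inv C z) C = ?F z - ?l z *\<^sub>R (0, 1)"
    using evV by eventually_elim (simp add: field_eq)
  ultimately have X: "((\<lambda>z. X (chart_inv C z) C) has_derivative
      (\<lambda>e. frechet_derivative ?F (at ?z0) e - frechet_derivative ?l (at ?z0) e *\<^sub>R (0, 1)))
        (at ?z0)"
    by (rule has_derivative_eventually_eq)
  show "((\<lambda>z. X (chart_inv C z) C) has_derivative frechet_derivative (\<lambda>z. X (chart_inv C z) C) (at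
    ?z0)) (at ?z0)"
    by (rule frechet_has_derivative[OF differentiableI[OF X]])
  have "frechet_derivative (\<lambda>z. V (chart_inv C z) C) (at ?z0) = (\<lambda>e. 0)"
    using frechet_eventually_eq[OF evV] by simp
  then show H: "H u C = frechet_derivative (\<lambda>z. X (chart_inv C z) C) (at ?z0) (0, 1)"
    using C vertical_coord[OF C] by (simp add: horizontal_field_def lie_bracket_def)
  show "H u C = frechet_derivative ?F (at ?z0) (0, 1) - lamV u *\<^sub>R V u C"
    unfolding H frechet_eqI[OF X] lamV_coord[OF C] vertical_coord[OF C] ..
qed

text \<open>The Lie bracket \<open>[F, V]\<close> at \<open>u\<close>, obtained chart by chart as
  the initial velocity of the transported vertical vector.\<close>

definition Wd :: "'m tpoint \<Rightarrow> 'm sm_tangent" where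
  "Wd u = (\<lambda>C. vector_derivative (\<lambda>r. W u r C) (at 0))"

lemma Wd_coord:
  assumes "C \<in> charts_at SM u"
  shows "((\<lambda>r. W u r C) has_vector_derivative Wd u C) (at 0)"
    and "Wd u C = - frechet_derivative (\<lambda>z. F (chart_inv C z) C) (at (snd C u)) (0, 1)"
  using W_coord_derivative(2)[OF charts_at_carrier[OF assms] assms]
  by (simp_all add: Wd_def vector_derivative_at)

lemma Wd_outside: "u \<in> carrier SM \<Longrightarrow> C \<notin> charts_at SM u \<Longrightarrow> Wd u C = 0"
  using SM.tangent_outside[OF W_tangent] by (simp add: Wd_def)

lemma Wd_tangent:
  assumes "u \<in> carrier SM"
  shows "Wd u \<in> tangent_space SM u"
proof (rule tangent_spaceI)
  fix C D assume C: "C \<in> charts_at SM u" and D: "D \<in> charts_at SM u"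
  let ?L = "frechet_derivative (transition C D) (at (snd C u))"
  have L: "bounded_linear ?L"
    using SM.linear_transition[OF C D] by (simp add: linear_conv_bounded_linear)
  have "((\<lambda>r. ?L (W u r C)) has_vector_derivative ?L (Wd u C)) (at 0)"
    by (rule bounded_linear.has_vector_derivative[OF L Wd_coord(1)[OF C]])
  then have "((\<lambda>r. W u r D) has_vector_derivative ?L (Wd u C)) (at 0)"
    using SM.tangent_transition[OF W_tangent[OF assms] C D] by presburger
  then show "Wd u D = ?L (Wd u C)"
    using vector_derivative_at unfolding Wd_def by blast
qed (rule Wd_outside[OF assms])

text \<open>From \<open>X = F - lam V\<close> it follows that
  \<open>[V, X] = [V, F] - V(lam) V\<close>, and \<open>Wd u\<close> is \<open>[F, V]\<close>. The
  sign of \<open>Wd u\<close> here produces the value -1 in \<open>beta_Wd\<close>.\<close>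

lemma Wd_eq:
  assumes "u \<in> carrier SM"
  shows "H u = vcomb (- 1) (Wd u) (- lamV u) (V u)"
proof
  fix C
  show "H u C = vcomb (- 1) (Wd u) (- lamV u) (V u) C"
  proof (cases "C \<in> charts_at SM u")
    case True
    then show ?thesis
      using horizontal_coord(1)[OF True] Wd_coord(2)[OF True] by (simp add: vcomb_def)
  next
    case False
    then show ?thesis
      using Wd_outside[OF assms False] SM.tangent_outside[OF vertical_tangent[OF assms] False]
      by (simp add: horizontal_field_def lie_bracket_def vcomb_def)
  qed
qed

lemma horizontal_tangent: "u \<in> carrier SM \<Longrightarrow> H u \<in> tangent_space SM u"
  by (simp only: Wd_eq) (intro SM.tangent_vcomb Wd_tangent vertical_tangent)

text \<open>The base part of \<open>X\<close> is \<open>uvec\<close> and \<open>V\<close> is the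
  angular direction. Hence the base part of \<open>H = [V, X]\<close> is the angular derivative of
  \<open>uvec\<close>, which is its rotation by a right angle, and the base parts of
  \<open>F\<close> and \<open>H\<close> are orthonormal.\<close>

lemma frame_coord:
  assumes c: "c \<in> A" "C = sm_chart A g c a" "x \<in> chart_range c" "a - pi < \<theta>" "\<theta> < a + pi" "u =
    smp c x \<theta>"
  shows "fst (F u C) = uvec c x \<theta>" "fst (H u C) = cJ c x (uvec c x \<theta>)" "V u C = (0, 1)"
proof -
  have C: "C \<in> charts_at SM u" using c sm_charts_at_iff by blast
  have u: "u \<in> carrier SM" by (rule charts_at_carrier[OF C])
  have Cu: "snd C u = (x, \<theta>)" using sm_chart_snd c by simp
  show V: "V u C = (0, 1)" by (rule vertical_coord[OF C])
  show "fst (F u C) = uvec c x \<theta>"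
    using geodesic_field_properties(2)[OF u] C c snd_smp_coord[OF c(1,3)] V by (simp add: field_eq)
  have "((\<lambda>z. fst (X (chart_inv C z) C)) has_derivative
      (\<lambda>e. fst (frechet_derivative (\<lambda>z. X (chart_inv C z) C) (at (x, \<theta>)) e))) (at (x, \<theta>))"
    using bounded_linear.has_derivative[OF bounded_linear_fst horizontal_coord(2)[OF C]]
    unfolding Cu .
  moreover have "((\<lambda>z. fst (X (chart_inv C z) C)) has_derivative
      frechet_derivative (\<lambda>z. uvec c (fst z) (snd z)) (at (x, \<theta>))) (at (x, \<theta>))"
  proof (rule has_derivative_eventually_eq[OF frechet_has_derivative[OF uvec_differentiable[OF
    c(1,3)]]])
    have "\<forall>\<^sub>F z in nhds (x, \<theta>). z \<in> chart_range C \<and> chart_inv C z \<in> fst C"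
      using SM.transition_domain[OF C C] unfolding Cu .
    then show "\<forall>\<^sub>F z in nhds (x, \<theta>). fst (X (chart_inv C z) C) = uvec c (fst z) (snd z)"
    proof eventually_elim
      case (elim z)
      then have z: "fst z \<in> chart_range c" "a - pi < snd z" "snd z < a + pi"
        using sm_chart_range[OF c(1), of a] c(2) by (auto simp: mem_Times_iff)
      have i: "chart_inv C z = smp c (fst z) (snd z)"
        using sm_chart_inv[OF c(1) z] c(2) by simp
      have "C \<in> charts_at SM (chart_inv C z)" using elim C by (simp add: charts_at_iff)
      then have "fst (X (chart_inv C z) C) = snd (chart_inv C z) c"
        using geodesic_field_properties(2)[OF charts_at_carrier] c(1,2) by blast
      then show ?case using snd_smp_coord[OF c(1) z(1)] i by simp
    qed
  qed
  ultimately have "(\<lambda>e. fst (frechet_derivative (\<lambda>z. X (chart_inv C z) C) (at (x, \<theta>)) e)) =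
      frechet_derivative (\<lambda>z. uvec c (fst z) (snd z)) (at (x, \<theta>))"
    by (rule has_derivative_unique)
  from fun_cong[OF this, of "(0, 1)"] show "fst (H u C) = cJ c x (uvec c x \<theta>)"
    using uvec_theta_derivative[OF c(1,3), of \<theta> 1] horizontal_coord(3)[OF C] Cu by simp
qed

section \<open>Covectors in the frame (F, H, V)\<close>

lemma cotangent_vcomb:
  "\<xi> \<in> cotangent_space SM u \<Longrightarrow> v \<in> tangent_space SM u \<Longrightarrow> w \<in> tangent_space SM u \<Longrightarrow>
    \<xi> (vcomb a v b w) = a * \<xi> v + b * \<xi> w"
  unfolding cotangent_space_def by blast

lemma cotangent_outside: "\<xi> \<in> cotangent_space SM u \<Longrightarrow> v \<notin> tangent_space SM u \<Longrightarrow> \<xi> v = 0"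
  unfolding cotangent_space_def by blast

definition frame_sum :: "'m tpoint \<Rightarrow> real \<Rightarrow> real \<Rightarrow> real \<Rightarrow> 'm sm_tangent" where
  "frame_sum u p q r = vcomb 1 (vcomb p (F u) q (H u)) r (V u)"

lemma cotangent_frame_sum:
  assumes "u \<in> carrier SM" "\<xi> \<in> cotangent_space SM u"
  shows "\<xi> (frame_sum u p q r) = p * \<xi> (F u) + q * \<xi> (H u) + r * \<xi> (V u)"
  using assms cotangent_vcomb[OF assms(2)] field_tangent horizontal_tangent vertical_tangent
    SM.tangent_vcomb
  by (simp add: frame_sum_def)

lemma dual_frame:
  assumes u: "u \<in> carrier SM"
  shows "\<exists>al be ps. be \<in> cotangent_space SM u \<and> ps \<in> cotangent_space SM u \<and>
    be (F u) = 0 \<and> be (H u) = 1 \<and> be (V u) = 0 \<and> ps (F u) = 0 \<and> ps (H u) = 0 \<and> ps (V u) = 1 \<and>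
    (\<forall>z\<in>tangent_space SM u. z = frame_sum u (al z) (be z) (ps z))"
proof -
  obtain C where CC: "C \<in> charts_at SM u" using u unfolding carrier_iff by blast
  then obtain c a x \<theta> where c: "c \<in> A" "C = sm_chart A g c a" "x \<in> chart_range c"
      "a - pi < \<theta>" "\<theta> < a + pi" "u = smp c x \<theta>"
    by (rule sm_charts_atE)
  let ?n = "uvec c x \<theta>" and ?T = "tangent_space SM u"
  note fr = frame_coord[OF c]
  have n1: "ip c x ?n ?n = 1" by (rule uvec_unit[OF c(1,3)])
  have n2: "ip c x ?n (cJ c x ?n) = 0" "ip c x (cJ c x ?n) ?n =
    0" "ip c x (cJ c x ?n) (cJ c x ?n) = 1"
    using ip_cJ_self[OF c(1,3)] ip_cJ_cJ[OF c(1,3)] n1 ip_sym[of c x "cJ c x ?n" ?n] by simp_all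
  define al0 where "al0 y = ip c x (fst y) ?n" for y :: "(real^2) \<times> real"
  define be0 where "be0 y = ip c x (fst y) (cJ c x ?n)" for y :: "(real^2) \<times> real"
  \<comment> \<open>The frame is triangular: \<open>F\<close> and \<open>H\<close> have orthonormal
    base parts and \<open>V\<close> has none. The component along \<open>V\<close> is therefore the
    angle component after the contributions of \<open>F\<close> and \<open>H\<close> have been
    removed.\<close>
  define ps0 where "ps0 y = snd y - al0 y * snd (F u C) - be0 y * snd (H u C)" for y
  have lin: "al0 (p *\<^sub>R y + q *\<^sub>R z) = p * al0 y + q * al0 z" "be0 (p *\<^sub>R y + q *\<^sub>R z) =
    p * be0 y + q * be0 z"
    "ps0 (p *\<^sub>R y + q *\<^sub>R z) = p * ps0 y + q * ps0 z" for p q y z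
    by (simp_all add: al0_def be0_def ps0_def ip_add_left ip_scale_left algebra_simps)
  define al where "al z = al0 (z C)" for z :: "'m sm_tangent"
  define be where "be z = (if z \<in> ?T then be0 (z C) else 0)" for z
  define ps where "ps z = (if z \<in> ?T then ps0 (z C) else 0)" for z
  have T: "F u \<in> ?T" "H u \<in> ?T" "V u \<in> ?T"
    using field_tangent horizontal_tangent vertical_tangent u by auto
  have "be \<in> cotangent_space SM u" "ps \<in> cotangent_space SM u"
    unfolding cotangent_space_def be_def ps_def
    using SM.tangent_vcomb by (auto simp: lin fun_cong[OF vcomb_def])
  moreover have "be (F u) = 0" "be (H u) = 1" "be (V u) = 0" "ps (F u) = 0" "ps (H u) =
    0" "ps (V u) = 1"
    using T fr by (simp_all add: be_def ps_def be0_def ps0_def al0_def n1 n2)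
      (simp_all add: ip_def)
  moreover have "z = frame_sum u (al z) (be z) (ps z)" if z: "z \<in> ?T" for z
  proof (rule SM.tangent_eqI[OF z _ CC])
    show "frame_sum u (al z) (be z) (ps z) \<in> ?T"
      unfolding frame_sum_def by (intro SM.tangent_vcomb T)
    have "fst (z C) = al z *\<^sub>R ?n + be z *\<^sub>R cJ c x ?n"
      using unit_decomposition[OF c(1,3) n1, of "fst (z C)"] z
      by (simp add: al_def be_def al0_def be0_def)
    then show "z C = frame_sum u (al z) (be z) (ps z) C"
      using fr z by (intro prod_eqI) (simp_all add: frame_sum_def vcomb_def ps_def ps0_def al_def
        be_def)
  qed
  ultimately show ?thesis by blast
qed

abbreviation beta :: "'m tpoint \<Rightarrow> 'm sm_covector" where "beta u \<equiv> coframe_beta A g u"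

text \<open>In the coframe dual to \<open>(X, H, V)\<close> this is the covector psi minus
  \<open>lam\<close> times alpha; the correction makes it vanish on \<open>F\<close>, so that it
  lies in Sigma. The existential \<open>al\<close> records that \<open>beta\<close> and
  \<open>psi\<close> determine a tangent vector up to a multiple of \<open>F\<close>.\<close>

definition psi :: "'m tpoint \<Rightarrow> 'm sm_covector" where
  "psi u = (SOME ps. ps \<in> cotangent_space SM u \<and> ps (F u) = 0 \<and> ps (H u) = 0 \<and> ps (V u) = 1 \<and>
     (\<exists>al. \<forall>z\<in>tangent_space SM u. z = frame_sum u (al z) (beta u z) (ps z)))"

lemma field_X: "X u = vcomb 1 (F u) (- lam u) (V u)"
  by (auto simp: vcomb_def field_eq)

text \<open>Resolves the definite description of \<open>coframe_beta\<close>: a covector is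
  determined by its values on the frame, and since \<open>X = F - lam V\<close>, vanishing on
  \<open>X\<close> and \<open>V\<close> amounts to vanishing on \<open>F\<close> and
  \<open>V\<close>.\<close>

lemma coframe:
  assumes u: "u \<in> carrier SM"
  shows "beta u \<in> cotangent_space SM u" "psi u \<in> cotangent_space SM u"
    "beta u (F u) = 0" "beta u (H u) = 1" "beta u (V u) = 0"
    "psi u (F u) = 0" "psi u (H u) = 0" "psi u (V u) = 1"
    "z \<in> tangent_space SM u \<Longrightarrow> \<exists>k. z = frame_sum u k (beta u z) (psi u z)"
proof -
  obtain al be ps where be: "be \<in> cotangent_space SM u" "be (F u) = 0" "be (H u) = 1" "be (V u) = 0"
    and ps: "ps \<in> cotangent_space SM u" "ps (F u) = 0" "ps (H u) = 0" "ps (V u) = 1"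
    and rep: "\<And>z. z \<in> tangent_space SM u \<Longrightarrow> z = frame_sum u (al z) (be z) (ps z)"
    using dual_frame[OF u] by blast
  have X: "\<xi> (X u) = \<xi> (F u) - lam u * \<xi> (V u)" if "\<xi> \<in> cotangent_space SM u" for \<xi>
    unfolding field_X using cotangent_vcomb[OF that field_tangent[OF u] vertical_tangent[OF u]]
    by simp
  have b: "beta u = be"
    unfolding coframe_beta_def
  proof (rule the_equality)
    show "be \<in> cotangent_space SM u \<and> be (X u) = 0 \<and> be (H u) = 1 \<and> be (V u) = 0"
      using be X[OF be(1)] by simp
  next
    fix \<xi> assume \<xi>: "\<xi> \<in> cotangent_space SM u \<and> \<xi> (X u) = 0 \<and> \<xi> (H u) = 1 \<and> \<xi> (V u) = 0"
    then have F0: "\<xi> (F u) = 0" using X[of \<xi>] by simp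
    show "\<xi> = be"
    proof
      fix z
      show "\<xi> z = be z"
      proof (cases "z \<in> tangent_space SM u")
        case True
        have "\<xi> z = \<xi> (frame_sum u (al z) (be z) (ps z))" using rep[OF True] by simp
        also have "\<dots> = be z" using cotangent_frame_sum[OF u conjunct1[OF \<xi>]] \<xi> F0 by simp
        finally show ?thesis .
      next
        case False
        then show ?thesis using cotangent_outside \<xi> be(1) by metis
      qed
    qed
  qed
  have "psi u \<in> cotangent_space SM u \<and> psi u (F u) = 0 \<and> psi u (H u) = 0 \<and> psi u (V u) = 1 \<and>
     (\<exists>al. \<forall>z\<in>tangent_space SM u. z = frame_sum u (al z) (beta u z) (psi u z))"
    unfolding psi_def by (rule someI[of _ ps]) (use ps rep b in blast)
  then show "beta u \<in> cotangent_space SM u" "psi u \<in> cotangent_space SM u"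
    "beta u (F u) = 0" "beta u (H u) = 1" "beta u (V u) = 0"
    "psi u (F u) = 0" "psi u (H u) = 0" "psi u (V u) = 1"
    "z \<in> tangent_space SM u \<Longrightarrow> \<exists>k. z = frame_sum u k (beta u z) (psi u z)"
    using be b by blast+
qed

text \<open>\<open>beta u\<close> and \<open>psi u\<close> span Sigma. The formula holds for every
  \<open>z\<close>, because covectors are 0 outside the tangent space.\<close>

lemma covector_expand:
  assumes u: "u \<in> carrier SM" and \<xi>: "\<xi> \<in> cotangent_space SM u" "\<xi> (F u) = 0"
  shows "\<xi> z = \<xi> (H u) * beta u z + \<xi> (V u) * psi u z"
proof (cases "z \<in> tangent_space SM u")
  case True
  obtain k where k: "z = frame_sum u k (beta u z) (psi u z)" using coframe(9)[OF u True] by blast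
  have "\<xi> z = \<xi> (frame_sum u k (beta u z) (psi u z))" by (rule arg_cong[OF k])
  also have "\<dots> = \<xi> (H u) * beta u z + \<xi> (V u) * psi u z"
    using cotangent_frame_sum[OF u \<xi>(1)] \<xi>(2) by simp
  finally show ?thesis .
next
  case False
  then show ?thesis 
    using cotangent_outside[OF \<xi>(1) False] cotangent_outside[OF coframe(1)[OF u] False]
      cotangent_outside[OF coframe(2)[OF u] False] by simp
qed

lemma W_functional_continuous:
  assumes u: "u \<in> carrier SM" and \<xi>: "\<xi> \<in> cotangent_space SM u"
  shows "isCont (\<lambda>t. \<xi> (W u t)) s"
proof -
  obtain C0 where C0: "C0 \<in> charts_at SM u" using u unfolding carrier_iff by blast
  obtain C where C: "C \<in> charts_at SM (\<phi> s u)" using flow_carrier[OF u] unfolding carrier_iff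
    by blast
  obtain \<epsilon> where \<epsilon>: "0 < \<epsilon>" "\<And>r. r \<in> {s - \<epsilon><..<s + \<epsilon>} \<Longrightarrow> \<phi> r u \<in> fst C"
    "\<And>e. smooth_on (\<lambda>r. dphi (- r) (\<phi> r u) (coord_vec SM C (\<phi> r u) e) C0) {s - \<epsilon><..<s + \<epsilon>}"
    by (rule push_coord[OF u C0 C]) (rule that)
  let ?I = "{s - \<epsilon><..<s + \<epsilon>}"
  have l: "bounded_linear (\<lambda>e. \<xi> (coord_vec SM C0 u e))"
    using SM.cotangent_coord(1)[OF \<xi> C0] by (simp add: linear_conv_bounded_linear)
  have "smooth_on (\<lambda>t. \<xi> (coord_vec SM C0 u (dphi (- t) (\<phi> t u) (coord_vec SM C (\<phi> t u) (0, 1))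
    C0))) ?I"
    by (rule smooth_on_linear[OF _ l \<epsilon>(3)]) simp
  then have "smooth_on (\<lambda>t. \<xi> (W u t)) ?I"
  proof (rule smooth_on_cong[rotated])
    fix r assume "r \<in> ?I"
    then have Cr: "C \<in> charts_at SM (\<phi> r u)" using \<epsilon>(2) C by (simp add: charts_at_iff)
    have "V (\<phi> r u) = coord_vec SM C (\<phi> r u) (0, 1)"
      using SM.tangent_eq_coord_vec[OF vertical_tangent[OF flow_carrier[OF u]] Cr]
        vertical_coord[OF Cr] by simp
    then show "\<xi> (W u r) = \<xi> (coord_vec SM C0 u (dphi (- r) (\<phi> r u) (coord_vec SM C (\<phi> r u) (0,
      1)) C0))"
      using SM.cotangent_coord(2)[OF \<xi> C0 W_tangent[OF u, of r]] by (simp add: W_def)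
  qed simp
  from smooth_on_differentiable[OF this] show ?thesis
    using \<epsilon>(1) differentiable_imp_continuous_within[of "\<lambda>t. \<xi> (W u t)" s UNIV] by simp
qed

lemma W_functional_derivative:
  assumes u: "u \<in> carrier SM" and \<xi>: "\<xi> \<in> cotangent_space SM u"
  shows "((\<lambda>t. \<xi> (W u t)) has_real_derivative \<xi> (Wd u)) (at 0)"
proof -
  obtain C0 where C0: "C0 \<in> charts_at SM u" using u unfolding carrier_iff by blast
  have l: "bounded_linear (\<lambda>e. \<xi> (coord_vec SM C0 u e))"
    using SM.cotangent_coord(1)[OF \<xi> C0] by (simp add: linear_conv_bounded_linear)
  have "((\<lambda>t. \<xi> (coord_vec SM C0 u (W u t C0))) has_vector_derivative \<xi> (coord_vec SM C0 u (Wd u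
    C0))) (at 0)"
    by (rule bounded_linear.has_vector_derivative[OF l Wd_coord(1)[OF C0]])
  then show ?thesis
    using SM.cotangent_coord(2)[OF \<xi> C0 W_tangent[OF u]] SM.cotangent_coord(2)[OF \<xi> C0
      Wd_tangent[OF u]]
    by (simp add: has_real_derivative_iff_has_vector_derivative)
qed

lemma beta_Wd:
  assumes "u \<in> carrier SM"
  shows "beta u (Wd u) = - 1"
  using cotangent_vcomb[OF coframe(1)[OF assms] Wd_tangent[OF assms] vertical_tangent[OF assms],
    of "- 1" "- lamV u"]
    coframe(4,5)[OF assms] Wd_eq[OF assms] by simp

end

section \<open>Limits of transported lines\<close>

lemma nonvanishing_sign:
  fixes f :: "real \<Rightarrow> real"
  assumes "p \<le> q" "\<And>x. isCont f x" "\<And>x. p \<le> x \<Longrightarrow> x \<le> q \<Longrightarrow> f x \<noteq> 0"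
  shows "0 < f p \<longleftrightarrow> 0 < f q"
proof
  assume "0 < f p"
  show "0 < f q"
  proof (rule ccontr)
    assume "\<not> 0 < f q"
    then obtain x where "p \<le> x" "x \<le> q" "f x = 0"
      using IVT2[of f q 0 p] \<open>0 < f p\<close> assms(1,2) by auto
    then show False using assms(3) by blast
  qed
next
  assume "0 < f q"
  show "0 < f p"
  proof (rule ccontr)
    assume "\<not> 0 < f p"
    then obtain x where "p \<le> x" "x \<le> q" "f x = 0"
      using IVT[of f p 0 q] \<open>0 < f q\<close> assms(1,2) by auto
    then show False using assms(3) by blast
  qed
qed

lemma mono_bounded_converges_at_top:
  fixes m :: "real \<Rightarrow> real"
  assumes mono: "\<And>s t. 0 < s \<Longrightarrow> s < t \<Longrightarrow> m s \<le> m t" and bd: "\<And>t. 0 < t \<Longrightarrow> m t \<le> B"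
  shows "\<exists>L. (m \<longlongrightarrow> L) at_top"
proof -
  have bdd: "bdd_above (m ` {0<..})" using bd by (intro bdd_aboveI[of _ B]) auto
  define L where "L = (SUP t\<in>{0<..}. m t)"
  have up: "m t \<le> L" if "0 < t" for t
    unfolding L_def using that by (intro cSUP_upper bdd) simp
  have "(m \<longlongrightarrow> L) at_top"
  proof (rule order_tendstoI)
    fix a assume "a < L"
    then obtain t0 where t0: "0 < t0" "a < m t0"
      unfolding L_def using less_cSUP_iff[OF _ bdd, of a] by auto
    show "\<forall>\<^sub>F t in at_top. a < m t"
      using eventually_gt_at_top[of t0]
      by eventually_elim (use t0 mono in \<open>meson less_le_trans\<close>)
  next
    fix a assume "L < a"
    show "\<forall>\<^sub>F t in at_top. m t < a"
      using eventually_gt_at_top[of 0]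
      by eventually_elim (use up \<open>L < a\<close> in \<open>meson le_less_trans\<close>)
  qed
  then show ?thesis ..
qed

text \<open>The plane curve \<open>(a, b)\<close> meets every line through the origin at most once, and it crosses
  the axis \<open>b = 0\<close> downwards at time \<open>0\<close>. Hence its slope \<open>a / b\<close> is increasing for positive times
  and stays below its value at time \<open>-1\<close>.\<close>

lemma slope_converges:
  fixes a b :: "real \<Rightarrow> real"
  assumes cont: "\<And>t. isCont a t" "\<And>t. isCont b t" and 0: "a 0 = 1" "b 0 = 0"
    and der: "(b has_real_derivative - 1) (at 0)"
    and det: "\<And>s t. s \<noteq> t \<Longrightarrow> a s * b t - a t * b s \<noteq> 0"
  shows "\<exists>L. ((\<lambda>t. a t / b t) \<longlongrightarrow> L) at_top"
proof -
  have b0: "b t \<noteq> 0" if "t \<noteq> 0" for t using det[of 0 t] that 0 by simp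
  obtain d1 where d1: "0 < d1" "\<And>h. 0 < h \<Longrightarrow> h < d1 \<Longrightarrow> b (0 + h) < b 0"
    using DERIV_neg_dec_right[OF der] by auto
  obtain d2 where d2: "0 < d2" "\<And>h. 0 < h \<Longrightarrow> h < d2 \<Longrightarrow> b 0 < b (0 - h)"
    using DERIV_neg_dec_left[OF der] by auto
  have neg: "b t < 0" if "0 < t" for t
  proof -
    \<comment> \<open>At the small time \<open>h\<close> the derivative decides the sign of
      \<open>b\<close>; as \<open>b\<close> has no zero between \<open>h\<close> and
      \<open>t\<close>, the sign persists.\<close>
    define h where "h = min t (d1 / 2)"
    have h: "0 < h" "h < d1" "h \<le> t" using that d1(1) by (auto simp: h_def)
    have "b h < 0" using d1(2)[OF h(1,2)] 0 by simp
    moreover have "0 < b h \<longleftrightarrow> 0 < b t"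
      by (rule nonvanishing_sign[OF h(3) cont(2)]) (use h b0 in auto)
    ultimately show ?thesis using b0[of t] that
      by (metis less_irrefl linorder_neqE_linordered_idom order_less_asym)
  qed
  have pos: "0 < b (- 1)"
  proof -
    define h where "h = min 1 (d2 / 2)"
    have h: "0 < h" "h < d2" "h \<le> 1" using d2(1) by (auto simp: h_def)
    have "0 < b (- h)" using d2(2)[OF h(1,2)] 0 by simp
    moreover have "0 < b (- 1) \<longleftrightarrow> 0 < b (- h)"
      by (rule nonvanishing_sign[OF _ cont(2)]) (use h b0 in auto)
    ultimately show ?thesis by simp
  qed
  let ?m = "\<lambda>t. a t / b t"
  have "?m t \<le> ?m (- 1)" if "0 < t" for t
  proof -
    \<comment> \<open>The determinant with time -1. It starts at \<open>b (- 1) > 0\<close> and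
      stays positive up to \<open>t\<close>; division by \<open>b (- 1) > 0\<close> and
      \<open>b t < 0\<close> turns this into the bound.\<close>
    let ?D = "\<lambda>r. a r * b (- 1) - a (- 1) * b r"
    have "0 < ?D 0 \<longleftrightarrow> 0 < ?D t"
    proof (rule nonvanishing_sign[of 0 t ?D])
      show "isCont ?D x" for x by (intro continuous_intros cont)
      show "?D x \<noteq> 0" if "0 \<le> x" for x using det[of x "- 1"] that by simp
    qed (use that in simp)
    then have "0 < ?D t" using 0 pos by simp
    then show ?thesis using neg[OF that] pos by (simp add: field_simps)
  qed
  moreover have "?m s \<le> ?m t" if "0 < s" "s < t" for s t
  proof -
    \<comment> \<open>The determinant with the later time \<open>t\<close>, which starts at
      \<open>- b t > 0\<close> and cannot vanish on the way to \<open>s < t\<close>. Both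
      denominators being negative, its sign is that of the difference of the slopes.\<close>
    let ?E = "\<lambda>r. a t * b r - a r * b t"
    have "0 < ?E 0 \<longleftrightarrow> 0 < ?E s"
    proof (rule nonvanishing_sign[of 0 s ?E])
      show "isCont ?E x" for x by (intro continuous_intros cont)
      show "?E x \<noteq> 0" if "x \<le> s" for x using det[of t x] that \<open>s < t\<close> by simp
    qed (use that in simp)
    moreover have "b t < 0" "b s < 0" using neg that by auto
    ultimately show ?thesis using 0 by (simp add: field_simps)
  qed
  ultimately show ?thesis by (intro mono_bounded_converges_at_top[of ?m "?m (- 1)"])
qed

text \<open>Reversal of time changes the sign of the derivative of \<open>b\<close> at 0, so
  \<open>b\<close> is negated as well; the determinants and the slope then only change sign.\<close>

lemma slope_converges_at_bot:
  fixes a b :: "real \<Rightarrow> real"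
  assumes cont: "\<And>t. isCont a t" "\<And>t. isCont b t" and 0: "a 0 = 1" "b 0 = 0"
    and der: "(b has_real_derivative - 1) (at 0)"
    and det: "\<And>s t. s \<noteq> t \<Longrightarrow> a s * b t - a t * b s \<noteq> 0"
  shows "\<exists>L. ((\<lambda>t. a t / b t) \<longlongrightarrow> L) at_bot"
proof -
  have "\<exists>L. ((\<lambda>t. a (- t) / (- b (- t))) \<longlongrightarrow> L) at_top"
  proof (rule slope_converges)
    show "isCont (\<lambda>t. a (- t)) t" "isCont (\<lambda>t. - b (- t)) t" for t
      by (intro continuous_intros isCont_o2[OF _ cont(1)] isCont_o2[OF _ cont(2)])+
    show "((\<lambda>t. - b (- t)) has_real_derivative - 1) (at 0)"
    proof -
      have "((\<lambda>t. b (- t)) has_real_derivative - 1 * - 1) (at 0)"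
        by (rule DERIV_chain2[of b]) (use der in \<open>auto intro!: derivative_eq_intros\<close>)
      from DERIV_minus[OF this] show ?thesis by simp
    qed
    show "a (- s) * - b (- t) - a (- t) * - b (- s) \<noteq> 0" if "s \<noteq> t" for s t
      using det[of "- s" "- t"] that by simp
  qed (use 0 in simp_all)
  then obtain L where "((\<lambda>t. a (- t) / (- b (- t))) \<longlongrightarrow> L) at_top" ..
  from tendsto_minus[OF this] have "((\<lambda>t. a (- t) / b (- t)) \<longlongrightarrow> - L) at_top" by simp
  then show ?thesis unfolding filterlim_at_bot_mirror by blast
qed

section \<open>Convergence of lines in the projective topology\<close>

lemma line_of_scale:
  assumes "(r::real) \<noteq> 0"
  shows "line_of (\<lambda>v. r * \<xi> v) = line_of \<xi>"
proof (intro subset_antisym subsetI)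
  fix \<eta> assume "\<eta> \<in> line_of (\<lambda>v. r * \<xi> v)"
  then obtain s where "\<eta> = (\<lambda>v. (s * r) * \<xi> v)" by (auto simp: line_of_def mult.assoc)
  then show "\<eta> \<in> line_of \<xi>" by (auto simp: line_of_def)
next
  fix \<eta> assume "\<eta> \<in> line_of \<xi>"
  then obtain s where "\<eta> = (\<lambda>v. s * \<xi> v)" by (auto simp: line_of_def)
  then have "\<eta> = (\<lambda>v. (s / r) * (r * \<xi> v))" using assms by simp
  then show "\<eta> \<in> line_of (\<lambda>v. r * \<xi> v)" unfolding line_of_def by blast
qed

text \<open>\<open>line_of\<close> is the quotient map that defines the topology: an open set around
  the limit line has a relatively open preimage among the nonzero elements of \<open>S\<close>, and
  \<open>h\<close> eventually enters it.\<close>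

lemma limitin_line_of:
  assumes h: "(h \<longlongrightarrow> h0) Fl" and S: "\<forall>\<^sub>F t in Fl. h t \<in> S - {\<lambda>_. 0}" and h0: "h0 \<in> S - {\<lambda>_. 0}"
  shows "limitin (projective_topology S) (\<lambda>t. line_of (h t)) (line_of h0) Fl"
  unfolding limitin_def
proof (intro conjI allI impI)
  have "{\<xi> \<in> S - {\<lambda>_. 0}. line_of \<xi> \<in> projective_space S} = S - {\<lambda>_. 0}"
    by (auto simp: projective_space_def)
  then have "openin (projective_topology S) (projective_space S)"
    unfolding openin_projective_topology by simp
  moreover have "line_of h0 \<in> projective_space S"
    unfolding projective_space_def using h0 by (rule imageI)
  ultimately show "line_of h0 \<in> topspace (projective_topology S)"
    using openin_subset by blast
next
  fix U assume U: "openin (projective_topology S) U \<and> line_of h0 \<in> U"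
  then obtain O' where O': "open O'" "{\<xi> \<in> S - {\<lambda>_. 0}. line_of \<xi> \<in> U} = (S - {\<lambda>_. 0}) \<inter> O'"
    unfolding openin_projective_topology openin_open by (elim conjE exE) (rule that)
  then have "h0 \<in> O'" using U h0 by blast
  from topological_tendstoD[OF h O'(1) this] S show "\<forall>\<^sub>F t in Fl. line_of (h t) \<in> U"
    by eventually_elim (use O'(2) in blast)
qed

lemma limitin_compose_filterlim:
  "limitin T f l F2 \<Longrightarrow> filterlim h F2 F1 \<Longrightarrow> limitin T (\<lambda>t. f (h t)) l F1"
  unfolding limitin_def using eventually_compose_filterlim by blast

context thermostat_system
begin

text \<open>A line in Sigma is encoded by a tangent vector \<open>z\<close>, which matters only
  modulo \<open>F u\<close>. Transport of lines by the inverse transpose then becomes transport of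
  \<open>z\<close> by \<open>dphi\<close>.\<close>

definition annihilator :: "'m tpoint \<Rightarrow> 'm sm_tangent \<Rightarrow> 'm sm_covector set" where
  "annihilator u z = {\<xi> \<in> cotangent_space SM u. \<xi> (F u) = 0 \<and> \<xi> z = 0}"

lemma cotangent_comb:
  assumes "\<xi> \<in> cotangent_space SM u" "\<eta> \<in> cotangent_space SM u"
  shows "(\<lambda>w. p * \<xi> w + q * \<eta> w) \<in> cotangent_space SM u"
proof -
  have "p * \<xi> (vcomb a v b w) + q * \<eta> (vcomb a v b w) =
      a * (p * \<xi> v + q * \<eta> v) + b * (p * \<xi> w + q * \<eta> w)"
    if "v \<in> tangent_space SM u" "w \<in> tangent_space SM u" for a b v w
    using cotangent_vcomb[OF assms(1) that] cotangent_vcomb[OF assms(2) that]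
    by (simp add: algebra_simps)
  moreover have "p * \<xi> v + q * \<eta> v = 0" if "v \<notin> tangent_space SM u" for v
    using cotangent_outside[OF assms(1) that] cotangent_outside[OF assms(2) that] by simp
  ultimately show ?thesis unfolding cotangent_space_def by blast
qed

text \<open>In the basis \<open>beta u\<close>, \<open>psi u\<close> of Sigma, vanishing at
  \<open>z\<close> is a single linear equation, nontrivial by \<open>nz\<close>; the displayed
  covector is its standard solution.\<close>

lemma annihilator_line:
  assumes u: "u \<in> carrier SM" and nz: "beta u z \<noteq> 0 \<or> psi u z \<noteq> 0"
  shows "annihilator u z = line_of (\<lambda>w. beta u z * psi u w + (- psi u z) * beta u w)"
proof (intro subset_antisym subsetI)
  fix \<xi> assume "\<xi> \<in> annihilator u z"
  then have \<xi>: "\<xi> \<in> cotangent_space SM u" "\<xi> (F u) = 0" "\<xi> z = 0" by (auto simp: annihilator_def)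
  define p where "p = \<xi> (H u)"
  define q where "q = \<xi> (V u)"
  have e: "\<xi> w = p * beta u w + q * psi u w" for w
    unfolding p_def q_def by (rule covector_expand[OF u \<xi>(1,2)])
  have z: "p * beta u z + q * psi u z = 0" using e \<xi>(3) by metis
  have "\<exists>r. q = r * beta u z \<and> p = - (r * psi u z)"
  proof (cases "beta u z = 0")
    case True
    then show ?thesis using z nz by (intro exI[of _ "- p / psi u z"]) (simp add: field_simps)
  next
    case False
    then show ?thesis using z by (intro exI[of _ "q / beta u z"]) (simp add: field_simps)
  qed
  then obtain r where "q = r * beta u z" "p = - (r * psi u z)" by blast
  then have "\<xi> = (\<lambda>w. r * (beta u z * psi u w + (- psi u z) * beta u w))"
    using e by (auto simp: algebra_simps)
  then show "\<xi> \<in> line_of (\<lambda>w. beta u z * psi u w + (- psi u z) * beta u w)"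
    unfolding line_of_def by blast
next
  fix \<xi> assume "\<xi> \<in> line_of (\<lambda>w. beta u z * psi u w + (- psi u z) * beta u w)"
  then obtain r where r: "\<xi> = (\<lambda>w. r * (beta u z * psi u w + (- psi u z) * beta u w))"
    by (auto simp: line_of_def)
  then have "\<xi> = (\<lambda>w. (r * beta u z) * psi u w + (- r * psi u z) * beta u w)"
    by (auto simp: algebra_simps)
  then have "\<xi> \<in> cotangent_space SM u"
    by (rule ssubst) (rule cotangent_comb[OF coframe(2,1)[OF u]])
  then show "\<xi> \<in> annihilator u z"
    using r coframe(3,6)[OF u] by (simp add: annihilator_def)
qed

lemma Hstar_annihilator: "u \<in> carrier SM \<Longrightarrow> Hstar A g u = annihilator u (V u)"
  using annihilator_line[of u "V u"] coframe(5,8)[of u] line_of_scale[of "- 1" "beta u"]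
  by (simp add: Hstar_def)

lemma annihilator_eq_Hstar_iff:
  assumes u: "u \<in> carrier SM" and nz: "beta u z \<noteq> 0 \<or> psi u z \<noteq> 0"
  shows "annihilator u z = Hstar A g u \<longleftrightarrow> beta u z = 0"
proof
  assume eq: "annihilator u z = Hstar A g u"
  have "beta u \<in> Hstar A g u"
    unfolding Hstar_def line_of_def by (rule range_eqI[of _ _ 1]) simp
  then have "beta u \<in> annihilator u z" by (simp only: eq)
  then show "beta u z = 0" by (simp add: annihilator_def)
next
  assume "beta u z = 0"
  then show "annihilator u z = Hstar A g u"
    using annihilator_line[OF u nz] nz line_of_scale[of "- psi u z" "beta u"]
    by (simp add: Hstar_def)
qed

text \<open>The pullback of covectors under \<open>\<phi> t\<close>, written as the inverse
  transpose of the reverse flow so that the results on \<open>inv_transpose\<close> apply.\<close>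

definition pull :: "real \<Rightarrow> 'm tpoint \<Rightarrow> 'm sm_covector \<Rightarrow> 'm sm_covector" where
  "pull t u \<xi> = inv_transpose SM (\<phi> (- t)) (\<phi> t u) \<xi>"

lemma pull_cotangent:
  "u \<in> carrier SM \<Longrightarrow> \<xi> \<in> cotangent_space SM (\<phi> t u) \<Longrightarrow> pull t u \<xi> \<in> cotangent_space SM u"
  using inv_transpose_cotangent[OF flow_carrier, of u \<xi> t "- t"] flow_inverse(1)[of u t]
  by (simp add: pull_def)

lemma pull_apply:
  "u \<in> carrier SM \<Longrightarrow> w \<in> tangent_space SM u \<Longrightarrow> pull t u \<xi> w = \<xi> (dphi t u w)"
  using inv_transpose_flow[OF flow_carrier, of u w "- t" t] flow_inverse(1)[of u t]
  by (simp add: pull_def)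

lemma pull_field: "u \<in> carrier SM \<Longrightarrow> \<xi> (F (\<phi> t u)) = 0 \<Longrightarrow> pull t u \<xi> (F u) = 0"
  by (simp add: pull_apply field_tangent dphi_field)

lemma flow_push_annihilator:
  assumes u: "u \<in> carrier SM" and z: "z \<in> tangent_space SM u"
  shows "flow_push A g \<phi> t u (annihilator u z) = annihilator (\<phi> t u) (dphi t u z)"
proof (intro subset_antisym subsetI)
  let ?q = "\<phi> t u"
  have q: "?q \<in> carrier SM" by (rule flow_carrier[OF u])
  have dz: "dphi t u z \<in> tangent_space SM ?q" by (rule dphi_tangent[OF u z])
  {
    fix \<eta> assume "\<eta> \<in> flow_push A g \<phi> t u (annihilator u z)"
    then obtain \<xi> where \<xi>: "\<xi> \<in> cotangent_space SM u" "\<xi> (F u) = 0" "\<xi> z = 0"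
      and \<eta>: "\<eta> = inv_transpose SM (\<phi> t) u \<xi>" by (auto simp: flow_push_def annihilator_def)
    have "\<eta> (F ?q) = \<xi> (F u)"
      using inv_transpose_flow[OF u field_tangent[OF q]] dphi_inverse[OF u field_tangent[OF u], of
        t]
        dphi_field[OF u, of t] by (simp add: \<eta>)
    moreover have "\<eta> (dphi t u z) = \<xi> z"
      using inv_transpose_flow[OF u dz] dphi_inverse[OF u z, of t] by (simp add: \<eta>)
    ultimately show "\<eta> \<in> annihilator ?q (dphi t u z)"
      using inv_transpose_cotangent[OF u \<xi>(1)] \<xi> \<eta> by (simp add: annihilator_def)
  next
    fix \<eta> assume "\<eta> \<in> annihilator ?q (dphi t u z)"
    then have \<eta>: "\<eta> \<in> cotangent_space SM ?q" "\<eta> (F ?q) = 0" "\<eta> (dphi t u z) = 0"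
      by (auto simp: annihilator_def)
    have "pull t u \<eta> \<in> annihilator u z"
      using pull_cotangent[OF u \<eta>(1)] pull_field[OF u, of \<eta> t] pull_apply[OF u z] \<eta>
      by (simp add: annihilator_def)
    moreover have "inv_transpose SM (\<phi> t) u (pull t u \<eta>) = \<eta>"
    proof
      fix w
      show "inv_transpose SM (\<phi> t) u (pull t u \<eta>) w = \<eta> w"
      proof (cases "w \<in> tangent_space SM ?q")
        case True
        then show ?thesis
          using inv_transpose_flow[OF u True] pull_apply[OF u dphi_inverse'(2)[OF u True]]
            dphi_inverse'(1)[OF u True] by simp
      next
        case False
        then show ?thesis using cotangent_outside[OF \<eta>(1)] by (simp add: inv_transpose_def)
      qed
    qed
    ultimately show "\<eta> \<in> flow_push A g \<phi> t u (annihilator u z)" unfolding flow_push_def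
      by (metis imageI)
  }
qed

text \<open>If both components vanished, every covector of Sigma at \<open>\<phi> t u\<close> would
  kill the transported vector. Covectors at \<open>u\<close> keep their values under transport, so
  all of Sigma at \<open>u\<close> would kill \<open>z\<close>.\<close>

lemma transversal_component_flow:
  assumes u: "u \<in> carrier SM" and z: "z \<in> tangent_space SM u" and nz: "beta u z \<noteq> 0 \<or> psi u z \<noteq> 0"
  shows "beta (\<phi> t u) (dphi t u z) \<noteq> 0 \<or> psi (\<phi> t u) (dphi t u z) \<noteq> 0"
proof (rule ccontr)
  let ?q = "\<phi> t u"
  assume n: "\<not> ?thesis"
  have q: "?q \<in> carrier SM" by (rule flow_carrier[OF u])
  have "\<xi> z = 0" if \<xi>: "\<xi> \<in> cotangent_space SM u" "\<xi> (F u) = 0" for \<xi>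
  proof -
    let ?\<eta> = "inv_transpose SM (\<phi> t) u \<xi>"
    have \<eta>: "?\<eta> (dphi t u w) = \<xi> w" if "w \<in> tangent_space SM u" for w
      using inv_transpose_flow[OF u dphi_tangent[OF u that]] dphi_inverse[OF u that, of t] by simp
    have "?\<eta> (F ?q) = 0" using \<eta>[OF field_tangent[OF u]] dphi_field[OF u] \<xi>(2) by simp
    from covector_expand[OF q inv_transpose_cotangent[OF u \<xi>(1)] this, of "dphi t u z"]
    show ?thesis using n \<eta>[OF z] by simp
  qed
  then show False using nz coframe[OF u] by blast
qed

lemma W_transversal:
  assumes u: "u \<in> carrier SM"
  shows "beta u (W u t) \<noteq> 0 \<or> psi u (W u t) \<noteq> 0"
  using transversal_component_flow[OF flow_carrier[OF u, of t] vertical_tangent[OF flow_carrier[OF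
    u, of t]], of "- t"]
    coframe(8)[OF flow_carrier[OF u, of t]] flow_inverse(1)[OF u, of t] by (simp add: W_def)

lemma flow_push_Hstar:
  assumes u: "u \<in> carrier SM"
  shows "flow_push A g \<phi> (- t) (\<phi> t u) (Hstar A g (\<phi> t u)) = annihilator u (W u t)"
  using flow_push_annihilator[OF flow_carrier[OF u, of t] vertical_tangent[OF flow_carrier[OF u,
    of t]], of "- t"]
    Hstar_annihilator[OF flow_carrier[OF u, of t]] flow_inverse(1)[OF u] by (simp add: W_def)

lemma flow_push_Hstar_eq_iff:
  assumes u: "u \<in> carrier SM"
  shows "flow_push A g \<phi> (- t) (\<phi> t u) (Hstar A g (\<phi> t u)) = Hstar A g u \<longleftrightarrow> beta u (W u t) = 0"
  unfolding flow_push_Hstar[OF u] by (rule annihilator_eq_Hstar_iff[OF u W_transversal[OF u]])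

text \<open>The covector \<open>beta\<close> pulled back from \<open>\<phi> s u\<close> kills
  \<open>W u s\<close>, which is carried to \<open>V\<close>, and takes the value assumed nonzero at
  \<open>W u t\<close>. Lying in the span of \<open>beta u\<close> and \<open>psi u\<close>, it
  separates two vectors that a zero determinant would make dependent modulo
  \<open>F u\<close>.\<close>

lemma determinant_nonzero:
  assumes u: "u \<in> carrier SM" and nc: "beta (\<phi> s u) (W (\<phi> s u) (t - s)) \<noteq> 0"
  shows "psi u (W u s) * beta u (W u t) - psi u (W u t) * beta u (W u s) \<noteq> 0"
proof
  let ?q = "\<phi> s u"
  let ?\<xi> = "pull s u (beta ?q)"
  assume det: "psi u (W u s) * beta u (W u t) - psi u (W u t) * beta u (W u s) = 0"
  have q: "?q \<in> carrier SM" by (rule flow_carrier[OF u])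
  have e: "?\<xi> z = ?\<xi> (H u) * beta u z + ?\<xi> (V u) * psi u z" for z
    by (rule covector_expand[OF u pull_cotangent[OF u coframe(1)[OF q]]
        pull_field[OF u, where \<xi> = "beta ?q" and t = s, OF coframe(3)[OF q]]])
  define p where "p = ?\<xi> (H u)"
  define r where "r = ?\<xi> (V u)"
  have s: "p * beta u (W u s) + r * psi u (W u s) = 0"
    using e[of "W u s"] pull_apply[OF u W_tangent[OF u]] dphi_W[OF u] coframe(5)[OF q]
    by (simp add: p_def r_def)
  have t: "p * beta u (W u t) + r * psi u (W u t) = beta ?q (W ?q (t - s))"
    using e[of "W u t"] pull_apply[OF u W_tangent[OF u]] W_flow[OF u, of s "t - s"]
    by (simp add: p_def r_def)
  \<comment> \<open>With zero determinant, each component of \<open>W u s\<close> times the value at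
    \<open>W u t\<close> is a multiple of the value at \<open>W u s\<close>, which is 0. One of the
    two components is nonzero.\<close>
  have "beta u (W u s) * (p * beta u (W u t) + r * psi u (W u t)) =
      beta u (W u t) * (p * beta u (W u s) + r * psi u (W u s))"
    "psi u (W u s) * (p * beta u (W u t) + r * psi u (W u t)) =
      psi u (W u t) * (p * beta u (W u s) + r * psi u (W u s))"
    using det by algebra+
  then show False using s t nc W_transversal[OF u, of s] by auto
qed

lemma W_slope_converges:
  assumes u: "u \<in> carrier SM"
    and nc: "\<And>s t. t \<noteq> 0 \<Longrightarrow> beta (\<phi> s u) (W (\<phi> s u) t) \<noteq> 0"
  shows "\<exists>L. ((\<lambda>t. psi u (W u t) / beta u (W u t)) \<longlongrightarrow> L) at_top"
    and "\<exists>L. ((\<lambda>t. psi u (W u t) / beta u (W u t)) \<longlongrightarrow> L) at_bot"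
proof -
  have *: "\<And>t. isCont (\<lambda>t. psi u (W u t)) t" "\<And>t. isCont (\<lambda>t. beta u (W u t)) t"
    "psi u (W u 0) = 1" "beta u (W u 0) = 0"
    "((\<lambda>t. beta u (W u t)) has_real_derivative - 1) (at 0)"
    "\<And>s t. s \<noteq> t \<Longrightarrow> psi u (W u s) * beta u (W u t) - psi u (W u t) * beta u (W u s) \<noteq> 0"
    using W_functional_continuous[OF u coframe(1)[OF u]] W_functional_continuous[OF u
      coframe(2)[OF u]]
      W_functional_derivative[OF u coframe(1)[OF u]] beta_Wd[OF u] W_0[OF u] coframe(5,8)[OF u]
      determinant_nonzero[OF u nc] by simp_all
  show "\<exists>L. ((\<lambda>t. psi u (W u t) / beta u (W u t)) \<longlongrightarrow> L) at_top"
    by (rule slope_converges[OF *])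
  show "\<exists>L. ((\<lambda>t. psi u (W u t) / beta u (W u t)) \<longlongrightarrow> L) at_bot"
    by (rule slope_converges_at_bot[OF *])
qed

lemma line_of_inv_transpose:
  "flow_push A g \<phi> t u (line_of \<xi>) = line_of (inv_transpose SM (\<phi> t) u \<xi>)"
proof -
  have "inv_transpose SM (\<phi> t) u (\<lambda>v. r * \<xi> v) = (\<lambda>v. r * inv_transpose SM (\<phi> t) u \<xi> v)" for r
    by (auto simp: inv_transpose_def)
  then show ?thesis by (auto simp: flow_push_def line_of_def image_iff)
qed

text \<open>Applied with \<open>Fl = at_top\<close> for \<open>G\<^sub>s\<close> and \<open>Fl = at_bot\<close> for \<open>G\<^sub>u\<close>.\<close>

lemma limit_bundle:
  fixes m :: "'m tpoint \<Rightarrow> real" and Fl :: "real filter"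
  assumes v: "v \<in> carrier SM"
    and Fl: "Fl \<noteq> bot" "\<And>s. filterlim (\<lambda>t. t - s) Fl Fl" "\<And>c. \<forall>\<^sub>F t in Fl. t \<noteq> c"
    and nc: "\<And>s t. t \<noteq> 0 \<Longrightarrow> beta (\<phi> s v) (W (\<phi> s v) t) \<noteq> 0"
    and lim: "\<And>s. ((\<lambda>t. psi (\<phi> s v) (W (\<phi> s v) t) / beta (\<phi> s v) (W (\<phi> s v) t)) \<longlongrightarrow> m (\<phi> s v)) Fl"
  defines "G \<equiv> \<lambda>u. line_of (\<lambda>w. psi u w + (- m u) * beta u w)"
  shows "line_subbundle_along A g lam \<phi> v G" "invariant_along A g \<phi> v G"
    "limitin (projective_topology (Sigma_bundle A g lam (\<phi> s v)))
      (\<lambda>t. annihilator (\<phi> s v) (W (\<phi> s v) t)) (G (\<phi> s v)) Fl"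
    "G (\<phi> s v) \<inter> Hstar A g (\<phi> s v) = {\<lambda>_. 0}"
proof -
  have c: "\<phi> s v \<in> carrier SM" for s by (rule flow_carrier[OF v])
  have sec: "(\<lambda>w. psi u w + r * beta u w) \<in> Sigma_bundle A g lam u - {\<lambda>_. 0}" if "u \<in> carrier SM"
    for u r
  proof -
    have "(\<lambda>w. psi u w + r * beta u w) \<in> cotangent_space SM u"
      using cotangent_comb[OF coframe(2,1)[OF that], of 1 r] by simp
    moreover have "psi u (V u) + r * beta u (V u) = 1" using coframe(5,8)[OF that] by simp
    then have "(\<lambda>w. psi u w + r * beta u w) \<noteq> (\<lambda>_. 0)" by (metis zero_neq_one)
    ultimately show ?thesis using coframe(3,6)[OF that] by (simp add: Sigma_bundle_def)
  qed
  show limitin: "limitin (projective_topology (Sigma_bundle A g lam (\<phi> s v)))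
      (\<lambda>t. annihilator (\<phi> s v) (W (\<phi> s v) t)) (G (\<phi> s v)) Fl"
  proof -
    let ?u = "\<phi> s v"
    let ?K = "\<lambda>r w. psi ?u w + (- r) * beta ?u w"
    let ?r = "\<lambda>t. psi ?u (W ?u t) / beta ?u (W ?u t)"
    \<comment> \<open>Functions carry the topology of pointwise convergence, so continuity in the
      slope is checked at each argument \<open>w\<close>.\<close>
    have "continuous_on UNIV ?K"
      by (intro continuous_on_coordinatewise_then_product continuous_intros)
    then have "isCont ?K (m ?u)" by (simp add: continuous_on_eq_continuous_at)
    from isCont_tendsto_compose[OF this lim] have "((\<lambda>t. ?K (?r t)) \<longlongrightarrow> ?K (m ?u)) Fl" .
    then have "limitin (projective_topology (Sigma_bundle A g lam ?u)) (\<lambda>t. line_of (?K (?r t)))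
      (G ?u) Fl"
      unfolding G_def by (rule limitin_line_of[OF _ always_eventually]) (intro allI sec c)+
    moreover have "\<forall>\<^sub>F t in Fl. line_of (?K (?r t)) = annihilator ?u (W ?u t)"
      using Fl(3)[of 0]
    proof eventually_elim
      case (elim t)
      have b: "beta ?u (W ?u t) \<noteq> 0" by (rule nc[OF elim])
      have "(\<lambda>w. beta ?u (W ?u t) * psi ?u w + (- psi ?u (W ?u t)) * beta ?u w) =
          (\<lambda>w. beta ?u (W ?u t) * ?K (?r t) w)"
        using b by (auto simp: field_simps)
      then show ?case
        using annihilator_line[OF c W_transversal[OF c], of s t] line_of_scale[OF b, of "?K (?r
          t)"] by simp
    qed
    ultimately show ?thesis by (rule limitin_transform_eventually[rotated])
  qed
  show "G (\<phi> s v) \<inter> Hstar A g (\<phi> s v) = {\<lambda>_. 0}"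
  proof (intro subset_antisym subsetI)
    let ?u = "\<phi> s v"
    fix \<xi> assume \<xi>: "\<xi> \<in> G ?u \<inter> Hstar A g ?u"
    then obtain r where r: "\<xi> = (\<lambda>w. r * (psi ?u w + (- m ?u) * beta ?u w))"
      by (auto simp: G_def line_of_def)
    obtain r' where "\<xi> = (\<lambda>w. r' * beta ?u w)" using \<xi> by (auto simp: Hstar_def line_of_def)
    then have "\<xi> (V ?u) = 0" using coframe(5)[OF c] by simp
    then have "r = 0" using r coframe(5,8)[OF c] by simp
    then show "\<xi> \<in> {\<lambda>_. 0}" using r by simp
  next
    fix \<xi> :: "'m sm_covector" assume "\<xi> \<in> {\<lambda>_. 0}"
    moreover have "(\<lambda>_. 0) \<in> line_of \<zeta>" for \<zeta> :: "'m sm_covector"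
      unfolding line_of_def by (rule range_eqI[of _ _ 0]) simp
    ultimately show "\<xi> \<in> G (\<phi> s v) \<inter> Hstar A g (\<phi> s v)" by (simp add: G_def Hstar_def)
  qed
  have push: "flow_push A g \<phi> t (\<phi> s v) (G (\<phi> s v)) = G (\<phi> t (\<phi> s v))" for s t
  proof -
    let ?u = "\<phi> s v"
    let ?q = "\<phi> t ?u"
    have q: "?q = \<phi> (t + s) v" using flow_add[OF v] by simp
    have qc: "?q \<in> carrier SM" by (rule flow_carrier[OF c])
    \<comment> \<open>Modulo \<open>F\<close>, this is the limit of \<open>W\<close> rescaled to
      have \<open>beta\<close> component 1. Its annihilator is \<open>G ?u\<close>, so invariance
      becomes a statement about the single vector \<open>dphi t ?u z\<close>.\<close>
    define z where "z = frame_sum ?u 0 1 (m ?u)"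
    have zT: "z \<in> tangent_space SM ?u"
      unfolding z_def frame_sum_def
      by (intro SM.tangent_vcomb field_tangent horizontal_tangent vertical_tangent c)
    have z: "\<xi> z = \<xi> (H ?u) + m ?u * \<xi> (V ?u)" if "\<xi> \<in> cotangent_space SM ?u" for \<xi>
      unfolding z_def using cotangent_frame_sum[OF c that] by simp
    have bz: "beta ?u z = 1" "psi ?u z = m ?u"
      using z[OF coframe(1)[OF c]] z[OF coframe(2)[OF c]] coframe(4,5,7,8)[OF c] by simp_all
    have Gz: "G ?u = annihilator ?u z"
      using annihilator_line[OF c, of s z] bz by (simp add: G_def)
    \<comment> \<open>A covector of Sigma at \<open>?q\<close> is pulled back to \<open>?u\<close>
      and evaluated on the rescaled vectors, which converge to \<open>z\<close> modulo
      \<open>F\<close>.\<close>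
    have slope: "((\<lambda>r. pull t ?u \<eta> (W ?u r) / beta ?u (W ?u r)) \<longlongrightarrow> \<eta> (dphi t ?u z)) Fl"
      if \<eta>: "\<eta> \<in> cotangent_space SM ?q" "\<eta> (F ?q) = 0" for \<eta>
    proof -
      let ?\<xi> = "pull t ?u \<eta>"
      have \<xi>: "?\<xi> \<in> cotangent_space SM ?u" "?\<xi> (F ?u) = 0"
        using pull_cotangent[OF c \<eta>(1)] pull_field[OF c, where \<xi> = \<eta> and t = t, OF \<eta>(2)] by auto
      have "((\<lambda>r. ?\<xi> (H ?u) + ?\<xi> (V ?u) * (psi ?u (W ?u r) / beta ?u (W ?u r))) \<longlongrightarrow>
          ?\<xi> (H ?u) + ?\<xi> (V ?u) * m ?u) Fl"
        by (intro tendsto_intros lim)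
      moreover have "?\<xi> (H ?u) + ?\<xi> (V ?u) * m ?u = \<eta> (dphi t ?u z)"
        using z[OF \<xi>(1)] pull_apply[OF c zT] by (simp add: mult.commute)
      moreover have "\<forall>\<^sub>F r in Fl. ?\<xi> (H ?u) + ?\<xi> (V ?u) * (psi ?u (W ?u r) / beta ?u (W ?u r)) =
          ?\<xi> (W ?u r) / beta ?u (W ?u r)"
        using Fl(3)[of 0]
      proof eventually_elim
        case (elim r)
        then show ?case
          using covector_expand[OF c \<xi>, of "W ?u r"] nc[OF elim, of s] by (simp add: field_simps)
      qed
      ultimately show ?thesis using Lim_transform_eventually by force
    qed
    note k = slope[OF coframe(1,3)[OF qc]] and l = slope[OF coframe(2,6)[OF qc]]
    have pW: "pull t ?u \<eta> (W ?u r) = \<eta> (W ?q (r - t))" for \<eta> r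
      using pull_apply[OF c W_tangent[OF c]] W_flow[OF c, of t s "r - t"] by simp
    have "((\<lambda>r. psi ?q (W ?q (r - t)) / beta ?q (W ?q (r - t))) \<longlongrightarrow> m ?q) Fl"
      using filterlim_compose[OF lim[of "t + s"] Fl(2)[of t]] q by simp
    \<comment> \<open>The slope at \<open>?q\<close>, with time shifted by \<open>t\<close>, times
      the ratio of the two \<open>beta\<close> components is the quotient whose limit is known from
      \<open>l\<close>. Comparing the limits shows that \<open>dphi t ?u z\<close> has slope
      \<open>m ?q\<close>.\<close>
    from tendsto_mult[OF this k]
    have "((\<lambda>r. psi ?q (W ?q (r - t)) / beta ?q (W ?q (r - t)) * (beta ?q (W ?q (r - t)) / beta ?u
      (W ?u r))) \<longlongrightarrow>
        m ?q * beta ?q (dphi t ?u z)) Fl" by (simp add: pW)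
    moreover have "\<forall>\<^sub>F r in Fl. psi ?q (W ?q (r - t)) / beta ?q (W ?q (r - t)) * (beta ?q (W ?q (r
      - t)) / beta ?u (W ?u r)) =
        psi ?q (W ?q (r - t)) / beta ?u (W ?u r)"
      using Fl(3)[of t]
    proof eventually_elim
      case (elim r)
      then have "beta ?q (W ?q (r - t)) \<noteq> 0" using nc[of "r - t" "t + s"] q by simp
      then show ?case by simp
    qed
    ultimately have "((\<lambda>r. psi ?q (W ?q (r - t)) / beta ?u (W ?u r)) \<longlongrightarrow> m ?q * beta ?q (dphi t ?u
      z)) Fl"
      by (rule Lim_transform_eventually)
    then have pz: "psi ?q (dphi t ?u z) = m ?q * beta ?q (dphi t ?u z)"
      using tendsto_unique[OF Fl(1)] l by (simp add: pW)
    have nz: "beta ?q (dphi t ?u z) \<noteq> 0 \<or> psi ?q (dphi t ?u z) \<noteq> 0"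
      by (rule transversal_component_flow[OF c zT]) (simp add: bz)
    then have bq: "beta ?q (dphi t ?u z) \<noteq> 0" using pz by auto
    have "annihilator ?q (dphi t ?u z) = line_of (\<lambda>w. beta ?q (dphi t ?u z) * (psi ?q w + (- m ?q)
      * beta ?q w))"
      unfolding annihilator_line[OF qc nz] pz by (simp add: algebra_simps)
    also have "\<dots> = G ?q" unfolding G_def by (rule line_of_scale[OF bq])
    finally show ?thesis using flow_push_annihilator[OF c zT, of t] Gz by simp
  qed
  then show "invariant_along A g \<phi> v G" by (simp add: invariant_along_def)
  show "line_subbundle_along A g lam \<phi> v G"
    unfolding line_subbundle_along_def
  proof (intro conjI allI)
    show "G (\<phi> s v) \<in> projective_space (Sigma_bundle A g lam (\<phi> s v))" for s
      unfolding G_def projective_space_def using sec[OF c] by blast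
    \<comment> \<open>\<open>m\<close> is a pointwise limit, with no regularity along the orbit at
      hand. A smooth section is obtained instead by transporting the single covector at
      \<open>v\<close>; by invariance it spans \<open>G\<close> along the whole orbit.\<close>
    define \<xi>0 where "\<xi>0 = (\<lambda>w. psi v w + (- m v) * beta v w)"
    have \<xi>0: "\<xi>0 \<in> cotangent_space SM v"
      unfolding \<xi>0_def using cotangent_comb[OF coframe(2,1)[OF v], of 1 "- m v"] by simp
    define \<xi> where "\<xi> s = inv_transpose SM (\<phi> s) v \<xi>0" for s
    have "G (\<phi> s v) = line_of (\<xi> s)" for s
      using push[of s 0] flow_0[OF v] line_of_inv_transpose[of s v \<xi>0]
      by (simp add: G_def \<xi>_def \<xi>0_def)
    moreover have "smooth_covector_along SM (\<lambda>s. \<phi> s v) \<xi>"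
      unfolding smooth_covector_along_def
    proof (intro conjI allI ballI)
      show "\<xi> s \<in> cotangent_space SM (\<phi> s v)" for s
        unfolding \<xi>_def by (rule inv_transpose_cotangent[OF v \<xi>0])
      fix s C assume C: "C \<in> charts_at SM (\<phi> s v)"
      obtain C0 where C0: "C0 \<in> charts_at SM v" using v unfolding carrier_iff by blast
      obtain \<epsilon> where \<epsilon>: "0 < \<epsilon>" "\<And>r. r \<in> {s - \<epsilon><..<s + \<epsilon>} \<Longrightarrow> \<phi> r v \<in> fst C"
        "\<And>e. smooth_on (\<lambda>r. dphi (- r) (\<phi> r v) (coord_vec SM C (\<phi> r v) e) C0) {s - \<epsilon><..<s + \<epsilon>}"
        by (rule push_coord[OF v C0 C]) (rule that)
      let ?I = "{s - \<epsilon><..<s + \<epsilon>}"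
      have l: "bounded_linear (\<lambda>e. \<xi>0 (coord_vec SM C0 v e))"
        using SM.cotangent_coord(1)[OF \<xi>0 C0] by (simp add: linear_conv_bounded_linear)
      have "smooth_on (\<lambda>r. \<xi> r (coord_vec SM C (\<phi> r v) e)) ?I" for e
      proof (rule smooth_on_cong)
        show "smooth_on (\<lambda>r. \<xi>0 (coord_vec SM C0 v (dphi (- r) (\<phi> r v) (coord_vec SM C (\<phi> r v) e)
          C0))) ?I"
          by (rule smooth_on_linear[OF _ l \<epsilon>(3)]) simp
        fix r assume "r \<in> ?I"
        then have Cr: "C \<in> charts_at SM (\<phi> r v)" using \<epsilon>(2) C by (simp add: charts_at_iff)
        note w = SM.coord_vec_tangent[OF Cr, of e]
        show "\<xi> r (coord_vec SM C (\<phi> r v) e) =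
            \<xi>0 (coord_vec SM C0 v (dphi (- r) (\<phi> r v) (coord_vec SM C (\<phi> r v) e) C0))"
          using inv_transpose_flow[OF v w] SM.cotangent_coord(2)[OF \<xi>0 C0 dphi_inverse'(2)[OF v w]]
          by (simp add: \<xi>_def)
      qed simp
      then show "\<exists>\<epsilon>>0. (\<lambda>s. \<phi> s v) ` {s - \<epsilon><..<s + \<epsilon>} \<subseteq> fst C \<and>
          (\<forall>e. smooth_on (\<lambda>r. \<xi> r (coord_vec SM C (\<phi> r v) e)) {s - \<epsilon><..<s + \<epsilon>})"
        using \<epsilon>(1,2) by (intro exI[of _ \<epsilon>]) auto
    qed
    ultimately show "\<exists>\<xi>. smooth_covector_along SM (\<lambda>s. \<phi> s v) \<xi> \<and> (\<forall>s. G (\<phi> s v) = line_of (\<xi> s))"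
      by blast
  qed
qed

section \<open>Conjugate points\<close>

abbreviation tcoord :: "'m \<Rightarrow> ('m, real^2) chart \<Rightarrow> (('m, real^2) tangent, real^2) chart" where
  "tcoord p c \<equiv> (tangent_space A p, \<lambda>w. w c)"

lemma tcoord_charts_at:
  "w \<in> tangent_space A p \<Longrightarrow> K \<in> charts_at (tangent_space_atlas A p) w \<longleftrightarrow> (\<exists>c. K = tcoord p c \<and>
    c \<in> charts_at A p)"
  by (auto simp: charts_at_iff[of K] tangent_space_atlas_def)

lemma tcoord_inj: "c \<in> charts_at A p \<Longrightarrow> inj_on (\<lambda>w. w c) (tangent_space A p)"
  by (rule inj_onI) (rule tangent_eqI)

lemma tcoord_range: "c \<in> charts_at A p \<Longrightarrow> chart_range (tcoord p c) = UNIV"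
proof -
  assume c: "c \<in> charts_at A p"
  have "y \<in> (\<lambda>w. w c) ` tangent_space A p" for y
  proof (rule image_eqI[where x = "coord_vec A c p y"])
    show "y = coord_vec A c p y c" by (rule coord_vec_coord[OF c, symmetric])
  qed (rule coord_vec_tangent[OF c])
  then show ?thesis by (auto simp: chart_range_def)
qed

lemma tcoord_inv: "c \<in> charts_at A p \<Longrightarrow> chart_inv (tcoord p c) y = coord_vec A c p y"
  unfolding chart_inv_def
  using inv_into_f_f[OF tcoord_inj coord_vec_tangent, of c p c y] by (simp add: coord_vec_coord)

lemma diff_atlas_tangent_space: "diff_atlas (tangent_space_atlas A p)"
proof
  fix K assume "K \<in> tangent_space_atlas A p"
  then show "inj_on (snd K) (fst K)" using tcoord_inj by (auto simp: tangent_space_atlas_def)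
next
  fix w K L
  assume "K \<in> charts_at (tangent_space_atlas A p) w" "L \<in> charts_at (tangent_space_atlas A p) w"
  moreover from this have "w \<in> tangent_space A p"
    by (auto simp: charts_at_iff tangent_space_atlas_def)
  ultimately obtain c d where K: "K = tcoord p c" "c \<in> charts_at A p"
    and L: "L = tcoord p d" "d \<in> charts_at A p"
    using tcoord_charts_at by metis
  show "\<forall>\<^sub>F x in nhds (snd K w). x \<in> chart_range K \<and> chart_inv K x \<in> fst L"
    unfolding K(1) L(1) using tcoord_range[OF K(2)] tcoord_inv[OF K(2)] coord_vec_tangent[OF K(2)]
    by simp
  have "transition K L = frechet_derivative (transition c d) (at (snd c p))"
  proof
    fix y
    show "transition K L y = frechet_derivative (transition c d) (at (snd c p)) y"
      using tangent_transition[OF coord_vec_tangent[OF K(2)] K(2) L(2), of y]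
        coord_vec_coord[OF K(2)]
      by (simp add: transition_def K(1) L(1) tcoord_inv[OF K(2)])
  qed
  then show "transition K L differentiable (at (snd K w))"
    using linear_transition[OF K(2) L(2)]
    by (simp add: linear_conv_bounded_linear bounded_linear_imp_differentiable)
qed

lemma sm_chart_base_coord:
  assumes "d \<in> A" "w \<in> fst (sm_chart A g d b)"
  shows "fst (snd (sm_chart A g d b) w) = snd d (fst w)"
proof -
  obtain x \<theta> where "x \<in> chart_range d" "b - pi < \<theta>" "\<theta> < b + pi" "w = smp d x \<theta>"
    using assms(2) sm_chart_fst[OF assms(1)] by blast
  then show ?thesis using sm_chart_snd[OF assms(1)] by (simp add: fst_smp snd_chart_inv)
qed

lemma frame_independent:
  assumes "c \<in> A" "x \<in> chart_range c" "p *\<^sub>R uvec c x \<theta> + q *\<^sub>R cJ c x (uvec c x \<theta>) = 0"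
  shows "p = 0 \<and> q = 0"
proof -
  let ?n = "uvec c x \<theta>"
  have n: "ip c x ?n ?n = 1" "ip c x ?n (cJ c x ?n) = 0" "ip c x (cJ c x ?n) ?n = 0"
    "ip c x (cJ c x ?n) (cJ c x ?n) = 1"
    using uvec_unit[OF assms(1,2)] ip_cJ_self[OF assms(1,2)] ip_cJ_cJ[OF assms(1,2)]
      ip_sym[of c x "cJ c x ?n" ?n] by simp_all
  have z: "ip c x 0 y = 0" for y by (simp add: ip_def)
  have "ip c x (p *\<^sub>R ?n + q *\<^sub>R cJ c x ?n) ?n =
    p" "ip c x (p *\<^sub>R ?n + q *\<^sub>R cJ c x ?n) (cJ c x ?n) = q"
    by (simp_all add: ip_add_left ip_scale_left n)
  then show ?thesis unfolding assms(3) z by simp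
qed

text \<open>Differentiating \<open>y = sqrt (ip c x y y) *\<^sub>R uvec c x (angle c \<theta> x
  y)\<close> at \<open>T *\<^sub>R n\<close> splits a direction into its radial part and
  \<open>T\<close> times its angular part. As \<open>T > 0\<close>, the two parts are coordinates on
  the plane.\<close>

lemma polar_derivative:
  fixes \<theta> :: real
  assumes c: "c \<in> A" "x \<in> chart_range c" and T: "0 < T"
  defines "n \<equiv> uvec c x \<theta>"
  obtains R' \<Theta>' where
    "((\<lambda>y. sqrt (ip c x y y)) has_derivative R') (at (T *\<^sub>R n))"
    "(angle c \<theta> x has_derivative \<Theta>') (at (T *\<^sub>R n))"
    "\<And>\<eta>. \<eta> = R' \<eta> *\<^sub>R n + (T * \<Theta>' \<eta>) *\<^sub>R cJ c x n"
    "\<forall>\<^sub>F y in nhds (T *\<^sub>R n). 0 < ip c x y n"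
proof -
  let ?y0 = "T *\<^sub>R n"
  have n1: "ip c x n n = 1" by (simp add: n_def uvec_unit[OF c])
  have pos: "0 < ip c x ?y0 n" using T by (simp add: ip_scale_left n1)
  have y00: "ip c x ?y0 ?y0 = T * T" by (simp add: ip_scale_left ip_scale_right n1)
  have "(\<lambda>y. ip c x y y) differentiable (at ?y0)"
    by (rule ip_differentiable[OF c]) simp_all
  then have "(\<lambda>y. sqrt (ip c x y y)) differentiable (at ?y0)"
    by (rule differentiable_sqrt) (use y00 T in simp)
  then obtain R' where R': "((\<lambda>y. sqrt (ip c x y y)) has_derivative R') (at ?y0)"
    unfolding differentiable_def by blast
  have "(\<lambda>y. angle c \<theta> x y) differentiable (at ?y0)"
    by (rule angle_differentiable[OF c pos[unfolded n_def]]) (simp_all add: n_def)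
  then obtain \<Theta>' where \<Theta>': "(angle c \<theta> x has_derivative \<Theta>') (at ?y0)"
    unfolding differentiable_def by blast
  have "(\<lambda>y. ip c x y n) differentiable (at ?y0)"
    by (rule ip_differentiable[OF c]) simp_all
  from order_tendstoD(1)[OF differentiable_imp_tendsto_nhds[OF this] pos]
  have ev: "\<forall>\<^sub>F y in nhds ?y0. 0 < ip c x y n" .
  have \<theta>: "angle c \<theta> x ?y0 = \<theta>" unfolding n_def by (rule angle_uvec[OF c T]) simp
  have pair: "((\<lambda>y. (x, angle c \<theta> x y)) has_derivative (\<lambda>h. (0, \<Theta>' h))) (at ?y0)"
    by (intro has_derivative_Pair has_derivative_const \<Theta>')
  have U: "((\<lambda>z. uvec c (fst z) (snd z)) has_derivative
      frechet_derivative (\<lambda>z. uvec c (fst z) (snd z)) (at (x, \<theta>))) (at (x, angle c \<theta> x ?y0))"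
    unfolding \<theta> by (rule frechet_has_derivative[OF uvec_differentiable[OF c]])
  have u: "((\<lambda>y. uvec c x (angle c \<theta> x y)) has_derivative (\<lambda>h. \<Theta>' h *\<^sub>R cJ c x n)) (at ?y0)"
    using has_derivative_compose[OF pair U] by (simp add: n_def uvec_theta_derivative[OF c])
  have "((\<lambda>y. sqrt (ip c x y y) *\<^sub>R uvec c x (angle c \<theta> x y)) has_derivative
      (\<lambda>h. sqrt (ip c x ?y0 ?y0) *\<^sub>R \<Theta>' h *\<^sub>R cJ c x n + R' h *\<^sub>R uvec c x (angle c \<theta> x ?y0)))
        (at ?y0)"
    by (rule has_derivative_scaleR[OF R' u])
  moreover have "\<forall>\<^sub>F y in nhds ?y0. y = sqrt (ip c x y y) *\<^sub>R uvec c x (angle c \<theta> x y)"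
    using ev unfolding n_def by eventually_elim (rule polar_decomposition[OF c])
  ultimately have D: "((\<lambda>y. y) has_derivative
      (\<lambda>h. sqrt (ip c x ?y0 ?y0) *\<^sub>R \<Theta>' h *\<^sub>R cJ c x n + R' h *\<^sub>R uvec c x (angle c \<theta> x ?y0)))
        (at ?y0)"
    by (rule has_derivative_eventually_eq)
  have "\<eta> = R' \<eta> *\<^sub>R n + (T * \<Theta>' \<eta>) *\<^sub>R cJ c x n" for \<eta>
    using fun_cong[OF has_derivative_unique[OF has_derivative_ident D], of \<eta>] T
    unfolding y00 \<theta> n_def[symmetric] by (simp add: add.commute)
  with R' \<Theta>' show ?thesis using ev by (rule that)
qed

end

section \<open>The differential of the exponential map and conjugacy\<close>

context thermostat_system
begin

text \<open>The partial derivatives are the velocity of the orbit and the differential of the time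
  \<open>T\<close> map; the joint differentiability contained in the smoothness of the flow combines
  them.\<close>

lemma flow_base_derivative:
  assumes u: "u \<in> carrier SM" and C: "C \<in> charts_at SM u" and D: "D \<in> charts_at SM (\<phi> T u)"
  shows "((\<lambda>q. snd D (\<phi> (fst q) (chart_inv C (snd q)))) has_derivative
      (\<lambda>(h, e). h *\<^sub>R F (\<phi> T u) D + dphi T u (coord_vec SM C u e) D)) (at (T, snd C u))"
    and "\<forall>\<^sub>F q in nhds (T, snd C u). \<phi> (fst q) (chart_inv C (snd q)) \<in> fst D"
proof -
  let ?\<Psi> = "\<lambda>q. snd D (\<phi> (fst q) (chart_inv C (snd q)))" and ?z = "snd C u"
  obtain Q where Q: "open Q" "(T, ?z) \<in> Q" "\<And>s z. (s, z) \<in> Q \<Longrightarrow> z \<in> chart_range C"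
      "\<And>s z. (s, z) \<in> Q \<Longrightarrow> \<phi> s (chart_inv C z) \<in> fst D" "smooth_on ?\<Psi> Q"
    by (rule flow_coord[OF C D]) (rule that)
  show "\<forall>\<^sub>F q in nhds (T, ?z). \<phi> (fst q) (chart_inv C (snd q)) \<in> fst D"
    unfolding eventually_nhds using Q(1,2,4) by (intro exI[of _ Q]) auto
  have inv0: "chart_inv C ?z = u" by (rule SM.chart_inv_snd_at[OF C])
  have \<Psi>d: "?\<Psi> differentiable (at (T, ?z))" by (rule smooth_on_differentiable[OF Q(5,1,2)])
  let ?D = "frechet_derivative ?\<Psi> (at (T, ?z))"
  have l: "linear ?D" by (rule linear_frechet[OF \<Psi>d])
  have t: "?D (h, 0) = h *\<^sub>R F (\<phi> T u) D" for h
  proof -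
    have 1: "((\<lambda>s. ?\<Psi> (s, ?z)) has_derivative (\<lambda>h. ?D (h, 0))) (at T)"
      by (rule has_derivative_compose[OF slice_has_derivative(2) frechet_has_derivative[OF \<Psi>d]])
    have "(snd D \<circ> (\<lambda>s. \<phi> s u)) differentiable (at T)"
      using flow_diff_curve[OF u, of T] D unfolding diff_curve_def by blast
    moreover have "vector_derivative (snd D \<circ> (\<lambda>s. \<phi> s u)) (at T) = F (\<phi> T u) D"
      using fun_cong[OF flow_velocity[OF u, of T], of D] D by (simp add: velocity_def)
    ultimately have 2: "((\<lambda>s. ?\<Psi> (s, ?z)) has_derivative (\<lambda>h. h *\<^sub>R F (\<phi> T u) D)) (at T)"
      by (simp add: vector_derivative_works has_vector_derivative_def inv0 comp_def)
    from fun_cong[OF has_derivative_unique[OF 1 2], of h] show ?thesis .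
  qed
  have s: "?D (0, e) = dphi T u (coord_vec SM C u e) D" for e
  proof -
    have "dphi T u (coord_vec SM C u e) D = frechet_derivative (snd D \<circ> \<phi> T \<circ> chart_inv C) (at ?z)
      e"
      unfolding dphi_def
      using differential_coord[OF diff_atlas_SM flow_diff_at[OF u] SM.coord_vec_tangent[OF C] C D]
        SM.coord_vec_coord[OF C] by simp
    also have "snd D \<circ> \<phi> T \<circ> chart_inv C = (\<lambda>z. ?\<Psi> (T, z))" by auto
    also have "frechet_derivative (\<lambda>z. ?\<Psi> (T, z)) (at ?z) e = ?D (0, e)"
      using frechet_chain[OF differentiableI[OF slice_has_derivative(1)], of ?\<Psi> T ?z]
        \<Psi>d frechet_eqI[OF slice_has_derivative(1), of T ?z] by simp
    finally show ?thesis by simp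
  qed
  have "?D (h, e) = h *\<^sub>R F (\<phi> T u) D + dphi T u (coord_vec SM C u e) D" for h e
    using linear_add[OF l, of "(h, 0)" "(0, e)"] t s by simp
  then have "?D = (\<lambda>(h, e). h *\<^sub>R F (\<phi> T u) D + dphi T u (coord_vec SM C u e) D)" by auto
  then show "(?\<Psi> has_derivative (\<lambda>(h, e). h *\<^sub>R F (\<phi> T u) D + dphi T u (coord_vec SM C u e) D))
    (at (T, ?z))"
    using frechet_has_derivative[OF \<Psi>d] by simp
qed

text \<open>The exponential map runs the flow for a time equal to the radius, from the unit vector
  at the given angle. On a half plane radius and angle are differentiable functions of
  \<open>y\<close>, so the differential can be found by the chain rule.\<close>

lemma exp_polar:
  assumes c: "c \<in> charts_at A p" and y: "0 < ip c (snd c p) y (uvec c (snd c p) \<theta>)"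
  shows "thermostat_exp g \<phi> p (coord_vec A c p y) =
    fst (\<phi> (sqrt (ip c (snd c p) y y)) (smp c (snd c p) (angle c \<theta> (snd c p) y)))"
proof -
  let ?x = "snd c p" and ?w = "coord_vec A c p y"
  have cA: "c \<in> A" "?x \<in> chart_range c" using c by (auto simp: charts_at_iff snd_in_chart_range)
  let ?r = "sqrt (ip c ?x y y)"
  have "y \<noteq> 0" using y by (auto simp: ip_def)
  then have r: "0 < ?r" using ip_pos[OF cA] by simp
  have wt: "?w \<in> tangent_space A p" by (rule coord_vec_tangent[OF c])
  have gw: "sqrt (g p ?w ?w) = ?r" using metric_coord[OF c wt wt] coord_vec_coord[OF c] by simp
  have "(\<lambda>d. ?w d /\<^sub>R ?r) = vcomb (1 / ?r) ?w 0 ?w" by (auto simp: vcomb_def inverse_eq_divide)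
  moreover have "vcomb (1 / ?r) ?w 0 ?w c = uvec c ?x (angle c \<theta> ?x y)"
  proof -
    have "(1 / ?r) *\<^sub>R y = (1 / ?r) *\<^sub>R (?r *\<^sub>R uvec c ?x (angle c \<theta> ?x y))"
      by (rule arg_cong[OF polar_decomposition[OF cA y]])
    also have "\<dots> = uvec c ?x (angle c \<theta> ?x y)" using r by simp
    finally show ?thesis using coord_vec_coord[OF c] by (simp add: vcomb_def)
  qed
  ultimately have "(p, \<lambda>d. ?w d /\<^sub>R ?r) = smp c ?x (angle c \<theta> ?x y)"
    using smp_eqI[OF c tangent_vcomb[OF wt wt]] by simp
  then show ?thesis using r gw by (simp add: thermostat_exp_def Let_def)
qed

text \<open>Let \<open>k\<close> be the component of \<open>dphi T u (V u)\<close> along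
  \<open>F\<close>. A direction with radial part \<open>R'\<close> and angular part
  \<open>\<Theta>'\<close> is sent to the combination of a unit vector and its rotation with
  coefficients \<open>R' + \<Theta>' k\<close> and \<open>\<Theta>'\<close> times the
  \<open>beta\<close> component, because \<open>V\<close> projects to 0. This linear map is
  injective iff the \<open>beta\<close> component is nonzero.\<close>

lemma exp_singular_iff:
  assumes u: "u \<in> carrier SM" and T: "0 < T"
  shows "exp_singular_at A g \<phi> (fst u) (\<lambda>c. T *\<^sub>R snd u c) \<longleftrightarrow> beta (\<phi> T u) (dphi T u (V u)) = 0"
proof -
  let ?p = "fst u" and ?q = "\<phi> T u" and ?TA = "tangent_space_atlas A (fst u)"
  let ?w = "\<lambda>c. T *\<^sub>R snd u c" and ?E = "thermostat_exp g \<phi> (fst u)"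
  interpret TA: diff_atlas ?TA by (rule diff_atlas_tangent_space)
  have ub: "u \<in> unit_tangent_bundle A g" using u by (simp add: carrier_SM)
  then have pu: "?p \<in> carrier A" "snd u \<in> tangent_space A ?p"
    by (auto simp: unit_tangent_bundle_def)
  then obtain c where c: "c \<in> charts_at A ?p" unfolding carrier_iff by blast
  let ?x = "snd c ?p"
  obtain \<theta> where \<theta>: "u = smp c ?x \<theta>" using bundle_smp[OF ub c] by blast
  have cA: "c \<in> A" "?x \<in> chart_range c" using c by (auto simp: charts_at_iff snd_in_chart_range)
  let ?n = "uvec c ?x \<theta>"
  let ?y0 = "T *\<^sub>R ?n"
  have uc: "snd u c = ?n" using snd_smp_coord[OF cA, of \<theta>] \<theta> by simp
  have wt: "?w \<in> tangent_space A ?p"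
    using tangent_vcomb[OF pu(2) pu(2), of T 0] by (simp add: vcomb_def)
  have wc: "?w = coord_vec A c ?p ?y0" using tangent_eq_coord_vec[OF wt c] uc by simp
  let ?K = "tcoord ?p c"
  have K: "?K \<in> charts_at ?TA ?w" using tcoord_charts_at[OF wt] c by blast
  have Kw: "snd ?K ?w = ?y0" using uc by simp
  let ?C = "sm_chart A g c \<theta>"
  have C: "?C \<in> charts_at SM u" using sm_charts_atI[OF cA, of \<theta>] \<theta> by simp
  have Cu: "snd ?C u = (?x, \<theta>)" using sm_chart_snd[OF cA, of \<theta> \<theta>] \<theta> by simp
  have V: "V u = coord_vec SM ?C u (0, 1)"
    using SM.tangent_eq_coord_vec[OF vertical_tangent[OF u] C] vertical_coord[OF C] by simp
  obtain R' \<Theta>' where R': "((\<lambda>y. sqrt (ip c ?x y y)) has_derivative R') (at ?y0)"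
    and \<Theta>': "(angle c \<theta> ?x has_derivative \<Theta>') (at ?y0)"
    and dec: "\<And>\<eta>. \<eta> = R' \<eta> *\<^sub>R ?n + (T * \<Theta>' \<eta>) *\<^sub>R cJ c ?x ?n"
    and ev: "\<forall>\<^sub>F y in nhds ?y0. 0 < ip c ?x y ?n"
    by (rule polar_derivative[OF cA T, of \<theta>]) (rule that)
  have evA: "\<forall>\<^sub>F y in nhds ?y0. \<theta> - pi < angle c \<theta> ?x y \<and> angle c \<theta> ?x y < \<theta> + pi"
    using differentiable_imp_tendsto_nhds[OF differentiableI[OF \<Theta>']] angle_uvec[OF cA T, of \<theta> \<theta>]
    by (auto intro!: eventually_conj order_tendstoD)
  have R0: "sqrt (ip c ?x ?y0 ?y0) = T"
    using T by (simp add: ip_scale_left ip_scale_right uvec_unit[OF cA])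
  have \<Theta>0: "angle c \<theta> ?x ?y0 = \<theta>" by (rule angle_uvec[OF cA T]) simp
  have Ew: "?E ?w = fst ?q"
    using exp_polar[OF c, of ?y0 \<theta>] eventually_nhds_x_imp_x[OF ev] wc R0 \<Theta>0 \<theta> by simp
  let ?z = "dphi T u (V u)"
  have qc: "?q \<in> carrier SM" by (rule flow_carrier[OF u])
  have zt: "?z \<in> tangent_space SM ?q" by (rule dphi_tangent[OF u vertical_tangent[OF u]])
  obtain k where k: "?z = frame_sum ?q k (beta ?q ?z) (psi ?q ?z)" using coframe(9)[OF qc zt]
    by blast
  have main: "\<exists>\<eta>q. differential ?TA A ?E ?w \<zeta> d =
    (R' (\<zeta> ?K) + \<Theta>' (\<zeta> ?K) * k) *\<^sub>R uvec d (snd d (fst ?q)) \<eta>q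
      + (\<Theta>' (\<zeta> ?K) * beta ?q ?z) *\<^sub>R cJ d (snd d (fst ?q)) (uvec d (snd d (fst ?q)) \<eta>q)"
    if \<zeta>: "\<zeta> \<in> tangent_space ?TA ?w" and d: "d \<in> charts_at A (fst ?q)" for \<zeta> d
  proof -
    let ?xq = "snd d (fst ?q)"
    obtain \<eta>q where \<eta>q: "?q = smp d ?xq \<eta>q"
      using bundle_smp[OF _ d] qc carrier_SM by blast
    have dA: "d \<in> A" "?xq \<in> chart_range d" using d by (auto simp: charts_at_iff snd_in_chart_range)
    let ?D = "sm_chart A g d \<eta>q"
    have D: "?D \<in> charts_at SM ?q" using sm_charts_atI[OF dA, of \<eta>q] \<eta>q by simp
    let ?\<Psi> = "\<lambda>q. snd ?D (\<phi> (fst q) (chart_inv ?C (snd q)))"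
    let ?P = "\<lambda>y. (sqrt (ip c ?x y y), ?x, angle c \<theta> ?x y)"
    have P: "(?P has_derivative (\<lambda>h. (R' h, 0, \<Theta>' h))) (at ?y0)"
      by (intro has_derivative_Pair has_derivative_const R' \<Theta>')
    have P0: "?P ?y0 = (T, snd ?C u)" using R0 \<Theta>0 Cu by simp
    have "((\<lambda>y. ?\<Psi> (?P y)) has_derivative
        (\<lambda>h. R' h *\<^sub>R F ?q ?D + dphi T u (coord_vec SM ?C u (0, \<Theta>' h)) ?D)) (at ?y0)"
    proof -
      have "(?\<Psi> has_derivative (\<lambda>(h, e). h *\<^sub>R F ?q ?D + dphi T u (coord_vec SM ?C u e) ?D)) (at
        (?P ?y0))"
        unfolding P0 by (rule flow_base_derivative(1)[OF u C D])
      from has_derivative_compose[OF P this] show ?thesis unfolding split_conv .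
    qed
    moreover have "dphi T u (coord_vec SM ?C u (0, s)) ?D = s *\<^sub>R ?z ?D" for s
    proof -
      have "coord_vec SM ?C u (0, s) = vcomb s (V u) 0 (V u)"
        using SM.coord_vec_vcomb[OF C, of s "(0, 1)" 0 "(0, 1)"] V by simp
      then have "dphi T u (coord_vec SM ?C u (0, s)) = vcomb s ?z 0 ?z"
        by (simp only: dphi_vcomb[OF u vertical_tangent[OF u] vertical_tangent[OF u]])
      then show ?thesis by (simp add: vcomb_def)
    qed
    ultimately have "((\<lambda>y. ?\<Psi> (?P y)) has_derivative (\<lambda>h. R' h *\<^sub>R F ?q ?D + \<Theta>' h *\<^sub>R ?z ?D)) (at
      ?y0)"
      by simp
    from bounded_linear.has_derivative[OF bounded_linear_fst this]
    have "((\<lambda>y. fst (?\<Psi> (?P y))) has_derivative (\<lambda>h. R' h *\<^sub>R fst (F ?q ?D) + \<Theta>' h *\<^sub>R fst (?z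
      ?D))) (at ?y0)"
      by simp
    moreover have "\<forall>\<^sub>F y in nhds ?y0. ((snd d \<circ> ?E) \<circ> chart_inv ?K) y = fst (?\<Psi> (?P y))"
    proof -
      have "(?P \<longlongrightarrow> ?P ?y0) (nhds ?y0)" by (rule differentiable_imp_tendsto_nhds[OF
        differentiableI[OF P]])
      then have "(?P \<longlongrightarrow> (T, snd ?C u)) (nhds ?y0)" unfolding P0 .
      from eventually_compose_filterlim[OF flow_base_derivative(2)[OF u C D] this] ev evA
      show ?thesis
      proof eventually_elim
        case (elim y)
        define a where "a = angle c \<theta> ?x y"
        have "chart_inv ?C (?x, a) = smp c ?x a"
          using sm_chart_inv[OF cA, of \<theta> a] elim(3) by (simp add: a_def)
        then show ?case
          using elim sm_chart_base_coord[OF dA(1), of _ \<eta>q] exp_polar[OF c elim(2)]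
          by (simp add: tcoord_inv[OF c] a_def)
      qed
    qed
    ultimately have E': "(((snd d \<circ> ?E) \<circ> chart_inv ?K) has_derivative
        (\<lambda>h. R' h *\<^sub>R fst (F ?q ?D) + \<Theta>' h *\<^sub>R fst (?z ?D))) (at (snd ?K ?w))"
      unfolding Kw by (rule has_derivative_eventually_eq)
    have "differential ?TA A ?E ?w \<zeta> d = R' (\<zeta> ?K) *\<^sub>R fst (F ?q ?D) + \<Theta>' (\<zeta> ?K) *\<^sub>R fst (?z ?D)"
      using TA.dir_deriv_coord[OF \<zeta> K differentiableI[OF E']] frechet_eqI[OF E'] d Ew
      by (simp add: differential_def)
    moreover have "fst (F ?q ?D) = uvec d ?xq \<eta>q" "fst (H ?q ?D) =
      cJ d ?xq (uvec d ?xq \<eta>q)" "V ?q ?D = (0, 1)"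
      using frame_coord[OF dA(1) refl dA(2) _ _ \<eta>q, of \<eta>q] by simp_all
    moreover have "?z ?D = frame_sum ?q k (beta ?q ?z) (psi ?q ?z) ?D" by (rule fun_cong[OF k])
    ultimately have "differential ?TA A ?E ?w \<zeta> d = (R' (\<zeta> ?K) + \<Theta>' (\<zeta> ?K) * k) *\<^sub>R uvec d ?xq \<eta>q
      + (\<Theta>' (\<zeta> ?K) * beta ?q ?z) *\<^sub>R cJ d ?xq (uvec d ?xq \<eta>q)"
      by (simp add: frame_sum_def vcomb_def algebra_simps)
    then show ?thesis by blast
  qed
  show ?thesis
  proof
    assume "exp_singular_at A g \<phi> ?p ?w"
    then obtain \<zeta> where \<zeta>: "\<zeta> \<in> tangent_space ?TA ?w" "\<zeta> \<noteq> (\<lambda>_. 0)" "differential ?TA A ?E ?w \<zeta> =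
      (\<lambda>_. 0)"
      unfolding exp_singular_at_def by blast
    have "fst ?q \<in> carrier A" using qc carrier_SM by (auto simp: unit_tangent_bundle_def)
    then obtain d where d: "d \<in> charts_at A (fst ?q)" unfolding carrier_iff by blast
    have dA: "d \<in> A" "snd d (fst ?q) \<in> chart_range d" using d
      by (auto simp: charts_at_iff snd_in_chart_range)
    have ze: "R' (\<zeta> ?K) + \<Theta>' (\<zeta> ?K) * k = 0 \<and> \<Theta>' (\<zeta> ?K) * beta ?q ?z = 0"
      using main[OF \<zeta>(1) d] \<zeta>(3) frame_independent[OF dA] by metis
    show "beta ?q ?z = 0"
    proof (rule ccontr)
      assume "beta ?q ?z \<noteq> 0"
      then have "\<Theta>' (\<zeta> ?K) = 0" "R' (\<zeta> ?K) = 0" using ze by auto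
      then have "\<zeta> ?K = 0" using dec[of "\<zeta> ?K"] by simp
      then have "\<zeta> = (\<lambda>_. 0)" using TA.tangent_eqI[OF \<zeta>(1) TA.tangent_zero K] by simp
      then show False using \<zeta>(2) by simp
    qed
  next
    assume b: "beta ?q ?z = 0"
    \<comment> \<open>The direction with radial part \<open>- k\<close> and angular part 1: the
      radial motion cancels the \<open>F\<close> component of the transported vertical
      vector.\<close>
    define \<eta> where "\<eta> = (- k) *\<^sub>R ?n + T *\<^sub>R cJ c ?x ?n"
    let ?\<zeta> = "coord_vec ?TA ?K ?w \<eta>"
    have \<zeta>: "?\<zeta> \<in> tangent_space ?TA ?w" "?\<zeta> ?K = \<eta>"
      using TA.coord_vec_tangent[OF K] TA.coord_vec_coord[OF K] by auto
    have "(- k - R' \<eta>) *\<^sub>R ?n + (T - T * \<Theta>' \<eta>) *\<^sub>R cJ c ?x ?n = 0"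
      using dec[of \<eta>] unfolding \<eta>_def[symmetric] by (simp add: algebra_simps \<eta>_def)
    from frame_independent[OF cA this] have e: "R' \<eta> = - k" "\<Theta>' \<eta> = 1" using T by auto
    have "\<eta> \<noteq> 0"
    proof
      assume "\<eta> = 0"
      then show False using frame_independent[OF cA, of "- k" \<theta> T] T by (simp add: \<eta>_def)
    qed
    then have "?\<zeta> \<noteq> (\<lambda>_. 0)" using \<zeta>(2) by metis
    moreover have "differential ?TA A ?E ?w ?\<zeta> = (\<lambda>_. 0)"
    proof
      fix d
      show "differential ?TA A ?E ?w ?\<zeta> d = 0"
      proof (cases "d \<in> charts_at A (fst ?q)")
        case True
        then show ?thesis using main[OF \<zeta>(1) True] \<zeta>(2) e b by simp
      next
        case False
        then show ?thesis using Ew by (simp add: differential_def)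
      qed
    qed
    ultimately show "exp_singular_at A g \<phi> ?p ?w"
      unfolding exp_singular_at_def using \<zeta>(1) by blast
  qed
qed

text \<open>\<open>conjugate_along\<close> always starts at the smaller parameter, so for negative
  times the two points have to exchange roles. Because \<open>W u 0 = V u\<close>, the determinant
  for the times \<open>t\<close> and 0 is just \<open>- beta u (W u t)\<close>.\<close>

lemma conjugacy_symmetric:
  assumes u: "u \<in> carrier SM"
  shows "beta u (W u t) = 0 \<longleftrightarrow> beta (\<phi> t u) (W (\<phi> t u) (- t)) = 0"
proof -
  have *: "beta (\<phi> t u) (W (\<phi> t u) (- t)) \<noteq> 0 \<Longrightarrow> beta u (W u t) \<noteq> 0" if "u \<in> carrier SM" for u t
    using determinant_nonzero[OF that, of t 0] coframe(5,8)[OF that] W_0[OF that] by simp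
  from *[OF u, of t] *[OF flow_carrier[OF u, of t], of "- t"] flow_inverse(1)[OF u, of t]
  show ?thesis by auto
qed

lemma conjugate_iff:
  assumes v: "v \<in> carrier SM" and t: "t \<noteq> 0"
  shows "flow_push A g \<phi> t (\<phi> t0 v) (Hstar A g (\<phi> t0 v)) = Hstar A g (\<phi> (t0 + t) v) \<longleftrightarrow>
    conjugate_along A g \<phi> v t0 (t0 + t)"
proof -
  let ?q = "\<phi> (t0 + t) v" and ?p = "\<phi> t0 v"
  have c: "?q \<in> carrier SM" "?p \<in> carrier SM" using flow_carrier[OF v] by auto
  have qp: "\<phi> t ?p = ?q" "\<phi> (- t) ?q = ?p"
    using flow_add[OF v, of t t0] flow_add[OF v, of "- t" "t0 + t"] by (simp_all add: add.commute)
  have 1: "flow_push A g \<phi> t ?p (Hstar A g ?p) = Hstar A g ?q \<longleftrightarrow> beta ?q (W ?q (- t)) = 0"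
    using flow_push_Hstar_eq_iff[OF c(1), of "- t"] qp by simp
  show ?thesis
  proof (cases "0 < t")
    case True
    then have "conjugate_along A g \<phi> v t0 (t0 + t) \<longleftrightarrow> beta ?q (dphi t ?p (V ?p)) = 0"
      using exp_singular_iff[OF c(2) True] qp by (simp add: conjugate_along_def Let_def)
    then show ?thesis using 1 qp by (simp add: W_def)
  next
    case False
    then have nt: "0 < - t" using t by simp
    then have "conjugate_along A g \<phi> v t0 (t0 + t) \<longleftrightarrow> beta ?p (dphi (- t) ?q (V ?q)) = 0"
      using exp_singular_iff[OF c(1) nt] qp by (simp add: conjugate_along_def min_def Let_def)
    then show ?thesis using 1 qp conjugacy_symmetric[OF c(2), of t] by (simp add: W_def)
  qed
qed

lemma no_conjugate_bundles:
  assumes v: "v \<in> carrier SM"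
    and nc: "\<And>s t. t \<noteq> 0 \<Longrightarrow> beta (\<phi> s v) (W (\<phi> s v) t) \<noteq> 0"
  shows "\<exists>Gs Gu.
             line_subbundle_along A g lam \<phi> v Gs \<and> invariant_along A g \<phi> v Gs \<and>
             line_subbundle_along A g lam \<phi> v Gu \<and> invariant_along A g \<phi> v Gu \<and>
             (\<forall>s. let u = \<phi> s v in
                limitin (projective_topology (Sigma_bundle A g lam u))
                  (\<lambda>t. flow_push A g \<phi> (- t) (\<phi> t u) (Hstar A g (\<phi> t u))) (Gs u) at_top \<and>
                limitin (projective_topology (Sigma_bundle A g lam u))
                  (\<lambda>t. flow_push A g \<phi> t (\<phi> (- t) u) (Hstar A g (\<phi> (- t) u))) (Gu u) at_top \<and>
                Gs u \<inter> Hstar A g u = {\<lambda>_. 0} \<and> Gu u \<inter> Hstar A g u = {\<lambda>_. 0})"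
proof -
  have c: "\<phi> s v \<in> carrier SM" for s by (rule flow_carrier[OF v])
  have nc': "beta (\<phi> r (\<phi> s v)) (W (\<phi> r (\<phi> s v)) t) \<noteq> 0" if "t \<noteq> 0" for r s t
    using nc[OF that, of "r + s"] flow_add[OF v] by simp
  \<comment> \<open>The limits are chosen as functions of the point and not of the parameter, so
    that the bundles are well defined also when the orbit closes up.\<close>
  define ms where "ms u = (SOME L. ((\<lambda>t. psi u (W u t) / beta u (W u t)) \<longlongrightarrow> L) at_top)" for u
  define mu where "mu u = (SOME L. ((\<lambda>t. psi u (W u t) / beta u (W u t)) \<longlongrightarrow> L) at_bot)" for u
  have ms: "((\<lambda>t. psi (\<phi> s v) (W (\<phi> s v) t) / beta (\<phi> s v) (W (\<phi> s v) t)) \<longlongrightarrow> ms (\<phi> s v)) at_top"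
    for s
    unfolding ms_def by (rule someI_ex[OF W_slope_converges(1)[OF c nc']])
  have mu: "((\<lambda>t. psi (\<phi> s v) (W (\<phi> s v) t) / beta (\<phi> s v) (W (\<phi> s v) t)) \<longlongrightarrow> mu (\<phi> s v)) at_bot"
    for s
    unfolding mu_def by (rule someI_ex[OF W_slope_converges(2)[OF c nc']])
  have top: "filterlim (\<lambda>t. t - s) at_top at_top" "\<forall>\<^sub>F t in at_top. t \<noteq> s" for s :: real
  proof -
    show "filterlim (\<lambda>t. t - s) at_top at_top"
      unfolding filterlim_at_top
    proof
      fix Z show "\<forall>\<^sub>F t in at_top. Z \<le> t - s"
        using eventually_ge_at_top[of "Z + s"] by eventually_elim simp
    qed
    show "\<forall>\<^sub>F t in at_top. t \<noteq> s" using eventually_gt_at_top[of s] by eventually_elim simp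
  qed
  have bot: "filterlim (\<lambda>t. t - s) at_bot at_bot" "\<forall>\<^sub>F t in at_bot. t \<noteq> s" for s :: real
  proof -
    show "filterlim (\<lambda>t. t - s) at_bot at_bot"
      unfolding filterlim_at_bot
    proof
      fix Z show "\<forall>\<^sub>F t in at_bot. t - s \<le> Z"
        using eventually_le_at_bot[of "Z + s"] by eventually_elim simp
    qed
    show "\<forall>\<^sub>F t in at_bot. t \<noteq> s" using eventually_gt_at_bot[of s] by eventually_elim simp
  qed
  note S = limit_bundle[OF v trivial_limit_at_top_linorder top nc ms]
  note U = limit_bundle[OF v trivial_limit_at_bot_linorder bot nc mu]
  let ?G = "\<lambda>m u. line_of (\<lambda>w. psi u w + (- m u) * beta u w)"
  show ?thesis
  proof (rule exI[of _ "?G ms"], rule exI[of _ "?G mu"], intro conjI allI)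
    fix s
    let ?u = "\<phi> s v"
    have 1: "(\<lambda>t. flow_push A g \<phi> (- t) (\<phi> t ?u) (Hstar A g (\<phi> t ?u))) =
      (\<lambda>t. annihilator ?u (W ?u t))"
      by (rule ext) (rule flow_push_Hstar[OF c])
    have 2: "(\<lambda>t. flow_push A g \<phi> t (\<phi> (- t) ?u) (Hstar A g (\<phi> (- t) ?u))) =
      (\<lambda>t. annihilator ?u (W ?u (- t)))"
    proof
      show "flow_push A g \<phi> t (\<phi> (- t) ?u) (Hstar A g (\<phi> (- t) ?u)) = annihilator ?u (W ?u (- t))"
        for t
        using flow_push_Hstar[OF c[of s], of "- t"] by simp
    qed
    \<comment> \<open>The unstable bundle is a limit of \<open>W\<close> at minus infinity, here
      read in the reversed time.\<close>
    have "limitin (projective_topology (Sigma_bundle A g lam ?u)) (\<lambda>t. annihilator ?u (W ?u (-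
      t))) (?G mu ?u) at_top"
      by (rule limitin_compose_filterlim[OF U(3) filterlim_uminus_at_bot_at_top])
    then show "let u = ?u in
                limitin (projective_topology (Sigma_bundle A g lam u))
                  (\<lambda>t. flow_push A g \<phi> (- t) (\<phi> t u) (Hstar A g (\<phi> t u))) (?G ms u) at_top \<and>
                limitin (projective_topology (Sigma_bundle A g lam u))
                  (\<lambda>t. flow_push A g \<phi> t (\<phi> (- t) u) (Hstar A g (\<phi> (- t) u))) (?G mu u) at_top \<and>
                ?G ms u \<inter> Hstar A g u = {\<lambda>_. 0} \<and> ?G mu u \<inter> Hstar A g u = {\<lambda>_. 0}"
      unfolding Let_def 1 2 using S(3,4) U(4) by blast
  qed (rule S(1,2) U(1,2), assumption)+
qed

end

theorem theorem1p5:
  fixes A :: "('m, real^2) atlas" and g :: "'m metric" and lam :: "'m tpoint \<Rightarrow> real"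
    and \<phi> :: "real \<Rightarrow> 'm tpoint \<Rightarrow> 'm tpoint" and v :: "'m tpoint"
  assumes "thermostat A g lam"
    and "thermostat_flow A g lam \<phi>"
    and "v \<in> unit_tangent_bundle A g"
  shows "((\<exists>t0 t. t \<noteq> 0 \<and>
             flow_push A g \<phi> t (\<phi> t0 v) (Hstar A g (\<phi> t0 v)) = Hstar A g (\<phi> (t0 + t) v)) \<or>
          (\<exists>Gs Gu.
             line_subbundle_along A g lam \<phi> v Gs \<and> invariant_along A g \<phi> v Gs \<and>
             line_subbundle_along A g lam \<phi> v Gu \<and> invariant_along A g \<phi> v Gu \<and>
             (\<forall>s. let u = \<phi> s v in
                limitin (projective_topology (Sigma_bundle A g lam u))
                  (\<lambda>t. flow_push A g \<phi> (- t) (\<phi> t u) (Hstar A g (\<phi> t u))) (Gs u) at_top \<and>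
                limitin (projective_topology (Sigma_bundle A g lam u))
                  (\<lambda>t. flow_push A g \<phi> t (\<phi> (- t) u) (Hstar A g (\<phi> (- t) u))) (Gu u) at_top \<and>
                Gs u \<inter> Hstar A g u = {\<lambda>_. 0} \<and> Gu u \<inter> Hstar A g u = {\<lambda>_. 0}))) \<and>
         (\<forall>t0 t. t \<noteq> 0 \<longrightarrow>
            (flow_push A g \<phi> t (\<phi> t0 v) (Hstar A g (\<phi> t0 v)) = Hstar A g (\<phi> (t0 + t) v) \<longleftrightarrow>
             conjugate_along A g \<phi> v t0 (t0 + t)))"
proof -
  interpret thermostat_system A g lam \<phi>
    using assms(1,2) by unfold_locales (auto simp: thermostat_def)
  have v: "v \<in> carrier (sm_atlas A g)" using assms(3) by (simp add: carrier_SM)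
  show ?thesis
  proof (intro conjI allI impI)
    show "(flow_push A g \<phi> t (\<phi> t0 v) (Hstar A g (\<phi> t0 v)) = Hstar A g (\<phi> (t0 + t) v) \<longleftrightarrow>
             conjugate_along A g \<phi> v t0 (t0 + t))" if "t \<noteq> 0" for t0 t
      by (rule conjugate_iff[OF v that])
    show "(\<exists>t0 t. t \<noteq> 0 \<and>
             flow_push A g \<phi> t (\<phi> t0 v) (Hstar A g (\<phi> t0 v)) = Hstar A g (\<phi> (t0 + t) v)) \<or>
          (\<exists>Gs Gu.
             line_subbundle_along A g lam \<phi> v Gs \<and> invariant_along A g \<phi> v Gs \<and>
             line_subbundle_along A g lam \<phi> v Gu \<and> invariant_along A g \<phi> v Gu \<and>
             (\<forall>s. let u = \<phi> s v in
                limitin (projective_topology (Sigma_bundle A g lam u))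
                  (\<lambda>t. flow_push A g \<phi> (- t) (\<phi> t u) (Hstar A g (\<phi> t u))) (Gs u) at_top \<and>
                limitin (projective_topology (Sigma_bundle A g lam u))
                  (\<lambda>t. flow_push A g \<phi> t (\<phi> (- t) u) (Hstar A g (\<phi> (- t) u))) (Gu u) at_top \<and>
                Gs u \<inter> Hstar A g u = {\<lambda>_. 0} \<and> Gu u \<inter> Hstar A g u = {\<lambda>_. 0}))"
      (is "?conj \<or> ?bundles")
    proof (cases ?conj)
      case True
      then show ?thesis by (rule disjI1)
    next
      case False
      have "beta (\<phi> s v) (W (\<phi> s v) t) \<noteq> 0" if "t \<noteq> 0" for s t
      proof
        assume "beta (\<phi> s v) (W (\<phi> s v) t) = 0"
        then have "flow_push A g \<phi> (- t) (\<phi> t (\<phi> s v)) (Hstar A g (\<phi> t (\<phi> s v))) =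
          Hstar A g (\<phi> s v)"
          using flow_push_Hstar_eq_iff[OF flow_carrier[OF v]] by blast
        \<comment> \<open>A zero of the \<open>beta\<close> component says that the line at
          parameter \<open>t + s\<close> is carried to the line at parameter \<open>s\<close>, a
          coincidence over the nonzero time \<open>- t\<close>.\<close>
        then have "- t \<noteq> 0 \<and> flow_push A g \<phi> (- t) (\<phi> (t + s) v) (Hstar A g (\<phi> (t + s) v)) =
          Hstar A g (\<phi> (t + s + - t) v)"
          using that flow_add[OF v, of t s] by simp
        then show False using False by blast
      qed
      then show ?thesis by (intro disjI2 no_conjugate_bundles[OF v])
    qed
  qed
qed

end
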